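(* For every $\alpha\in(0,1]$ one has $\beta^{\ast}(\alpha)=\alpha/(1+\alpha)$.
   Context: A Beurling generalized prime system is an unbounded non-decreasing sequence $\mathcal{P}: p_1\le p_2\le\dots$ of real numbers with $p_1>1$; its generalized integers $\mathcal{N}$ are the multiplicative semigroup generated by $1$ and $\mathcal{P}$ (counted with multiplicity). Let $\pi(x)$ and $N(x)$ count the generalized primes and generalized integers not exceeding $x$. Let $\operatorname{Li}(x)=\int_1^x \frac{1-u^{-1}}{\log u}\,du$. For $\alpha\in(0,1]$, say a system satisfies (P$_\alpha$) if there is $c>0$ with $\pi(x)=\operatorname{Li}(x)+O(x\exp(-c\log^{\alpha}x))$, and for $\beta\in(0,1]$ say it satisfies (N$_\beta$) if there are constants $\rho>0$ and $c'>0$ with $N(x)=\rho x+O(x\exp(-c'\log^{\beta}x))$. Define $\beta^{\ast}(\alpha)$ as the supremum of all $\beta\in(0,1]$ such that every Beurling generalized number system satisfying (P$_\alpha$) also satisfies (N$_\beta$). *)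

theory Defs
  imports "HOL-Analysis.Analysis" "HOL-Library.Landau_Symbols" "HOL-Library.Multiset"
begin

text \<open>The primes are indexed from 0: \<open>p 0\<close> is the \<open>p\<^sub>1\<close> of the
  usual notation. Repeated values are allowed.\<close>

definition beurling_system :: "(nat \<Rightarrow> real) \<Rightarrow> bool" where
  "beurling_system p \<longleftrightarrow> mono p \<and> p 0 > 1 \<and> \<not> bdd_above (range p)"

definition prime_count :: "(nat \<Rightarrow> real) \<Rightarrow> real \<Rightarrow> nat" where
  "prime_count p x = card {i. p i \<le> x}"

text \<open>A generalized integer, counted with multiplicity, is a formal product of primes, that is
  a finite multiset of prime indices; the empty multiset gives 1. Distinct multisets are counted
  separately even if their products are equal as real numbers.\<close>

definition gen_int_value :: "(nat \<Rightarrow> real) \<Rightarrow> nat multiset \<Rightarrow> real" where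
  "gen_int_value p M = (\<Prod>i\<in>#M. p i)"

definition integer_count :: "(nat \<Rightarrow> real) \<Rightarrow> real \<Rightarrow> nat" where
  "integer_count p x = card {M. gen_int_value p M \<le> x}"

text \<open>The integrand extends continuously to \<open>u = 1\<close>; its value there in HOL (0, by division
  by zero) does not affect the integral.\<close>

definition Li :: "real \<Rightarrow> real" where
  "Li x = integral {1..x} (\<lambda>u. (1 - inverse u) / ln u)"

definition prime_cond :: "real \<Rightarrow> (nat \<Rightarrow> real) \<Rightarrow> bool" where
  "prime_cond \<alpha> p \<longleftrightarrow>
    (\<exists>c>0. (\<lambda>x. real (prime_count p x) - Li x) \<in> O(\<lambda>x. x * exp (- c * ln x powr \<alpha>)))"

definition integer_cond :: "real \<Rightarrow> (nat \<Rightarrow> real) \<Rightarrow> bool" where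
  "integer_cond \<beta> p \<longleftrightarrow>
    (\<exists>\<rho>>0. \<exists>c>0. (\<lambda>x. real (integer_count p x) - \<rho> * x) \<in> O(\<lambda>x. x * exp (- c * ln x powr \<beta>)))"

definition beta_star :: "real \<Rightarrow> real" where
  "beta_star \<alpha> =
    Sup {\<beta>. 0 < \<beta> \<and> \<beta> \<le> 1 \<and> (\<forall>p. beurling_system p \<longrightarrow> prime_cond \<alpha> p \<longrightarrow> integer_cond \<beta> p)}"

text \<open>The sets counted above are finite, so the cardinalities are the intended ones.\<close>

lemma finite_primes_le:
  assumes "beurling_system p"
  shows "finite {i. p i \<le> x}"
proof -
  have m: "mono p" using assms by (simp add: beurling_system_def)
  obtain n where n: "x < p n"
    using assms unfolding beurling_system_def bdd_above_def by (force simp: not_le)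
  have "i \<le> n" if "p i \<le> x" for i
  proof (rule ccontr)
    assume "\<not> i \<le> n"
    then have "p n \<le> p i" using monoD[OF m, of n i] by simp
    then show False using n that by simp
  qed
  then show ?thesis by (auto intro: finite_subset[of _ "{..n}"])
qed

lemma prime_gt_1: "beurling_system p \<Longrightarrow> p i > 1"
  unfolding beurling_system_def by (meson le0 less_le_trans monoD)

lemma gen_int_value_ge_power:
  assumes "beurling_system p"
  shows "p 0 ^ size M \<le> gen_int_value p M"
proof (induction M)
  case (add i M)
  have "p 0 \<le> p i" using assms by (auto simp: beurling_system_def intro: monoD)
  then have "p 0 * p 0 ^ size M \<le> p i * gen_int_value p M"
    using add prime_gt_1[OF assms, of 0] by (intro mult_mono) auto
  then show ?case by (simp add: gen_int_value_def)
qed (simp add: gen_int_value_def)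

lemma gen_int_value_ge_1: "beurling_system p \<Longrightarrow> 1 \<le> gen_int_value p M"
  using gen_int_value_ge_power[of p M] prime_gt_1[of p 0] one_le_power[of "p 0" "size M"]
  by linarith

lemma prime_le_gen_int_value:
  assumes "beurling_system p" "i \<in># M"
  shows "p i \<le> gen_int_value p M"
proof -
  obtain M' where M': "M = add_mset i M'" using multi_member_split[OF assms(2)] by auto
  have "p i * 1 \<le> p i * gen_int_value p M'"
    using gen_int_value_ge_1[OF assms(1), of M'] prime_gt_1[OF assms(1), of i]
    by (intro mult_left_mono) auto
  then show ?thesis by (simp add: M' gen_int_value_def)
qed

lemma finite_gen_ints_le:
  assumes "beurling_system p"
  shows "finite {M. gen_int_value p M \<le> x}"
proof -
  obtain n where n: "x < p 0 ^ n"
    using real_arch_pow[OF prime_gt_1[OF assms, of 0], of x] by blast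
  let ?S = "{i. p i \<le> x}"
  have "{M. gen_int_value p M \<le> x} \<subseteq> mset ` {xs. set xs \<subseteq> ?S \<and> length xs \<le> n}"
  proof
    fix M assume "M \<in> {M. gen_int_value p M \<le> x}"
    then have le: "gen_int_value p M \<le> x" by simp
    obtain xs where xs: "M = mset xs" using ex_mset[of M] by blast
    have "p 0 ^ size M < p 0 ^ n"
      using gen_int_value_ge_power[OF assms, of M] le n by linarith
    then have "size M < n"
      using prime_gt_1[OF assms, of 0] power_less_imp_less_exp by blast
    moreover have "set xs \<subseteq> ?S"
      using prime_le_gen_int_value[OF assms, of _ M] le xs by force
    ultimately show "M \<in> mset ` {xs. set xs \<subseteq> ?S \<and> length xs \<le> n}"
      using xs by auto
  qed
  moreover have "finite {xs. set xs \<subseteq> ?S \<and> length xs \<le> n}"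
    using finite_lists_length_le[OF finite_primes_le[OF assms]] .
  ultimately show ?thesis by (rule finite_surj[rotated])
qed

end

theory Submission
  imports Defs
begin

text \<open>
  Lower bound for \<open>\<beta>\<^sup>*\<close> (Diamond's argument, made finite). Round all \<open>ln p\<close> up to a lattice
  \<open>\<delta>\<int>\<close> with \<open>\<delta> \<rightarrow> 0\<close> for fixed \<open>x\<close>. The counting problem becomes one about power series, and
  \<open>N(x) / x\<close> becomes a partial sum of coefficients of \<open>exp g\<close>, where \<open>g\<close> is the normalized difference
  between the prime powers and the reference system \<open>Li\<close>. Split \<open>g\<close> at height
  \<open>h = (ln x) powr (1 / (1 + \<alpha>))\<close>. The partial sums of the upper part are
  \<open>O(exp (- c h powr \<alpha>))\<close> by partial summation, which survives exponentiation because the total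
  variation of \<open>g\<close> is \<open>O(ln ln x)\<close>; the exponential of the lower part has tail about
  \<open>exp (- ln x / h)\<close> by Rankin's trick. Both errors are \<open>exp (- c (ln x) powr (\<alpha> / (1 + \<alpha>)))\<close>.

  Upper bound. Round the logarithms of the \<open>Li\<close>-primes in \<open>(exp j, exp (j + 1)]\<close> up to multiples
  of \<open>1 / m\<close>, \<open>m \<approx> exp (j powr \<alpha>)\<close>; this preserves (P\<open>\<^sub>\<alpha>\<close>). The products of
  \<open>n \<approx> j powr \<alpha>\<close> primes from this window stay on the same lattice, so by the pigeonhole principle \<open>N\<close>
  has a jump of relative size at least \<open>exp (- O(j powr \<alpha> * ln j))\<close> at some \<open>x\<close> with
  \<open>ln x \<approx> j powr (1 + \<alpha>)\<close>.
\<close>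

text \<open>On a lattice, the multiplicative convolutions of measures behind the exponential become
  Cauchy products of power series. For fixed \<open>x\<close> an integer up to \<open>x\<close> has
  a bounded number of prime factors, so rounding shifts its logarithm by a bounded multiple of
  \<delta>. Every estimate is therefore kept uniform in \<delta>. The height h balances the two
  errors: h^\<alpha> = ln x / h holds exactly for h = (ln x)^(1 / (1 + \<alpha>)). A total variation
  O(ln ln x) is harmless because its exponential is only a power of ln x, which part of the decay
  absorbs. The density is positive since it is approximated by exponentials of bounded numbers. In
  the counterexample, the pigeonhole principle over the lattice costs a factor exp (O(j^\<alpha>)),
  and choosing n distinct primes costs exp (O(n ln j)) through the density of primes and the
  division by n!. Up to the logarithm, n of order j^\<alpha> is the largest number of factors for
  which the second loss does not dominate, and it makes ln x = n j as large as possible. The extra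
  ln j is invisible to a supremum.\<close>

unbundle no vec_syntax
unbundle fps_syntax

section \<open>Exponentials of formal power series\<close>

text \<open>This is the exponential only for a vanishing constant coefficient, since
  \<open>oo\<close> truncates the composition at each degree; hence the recurring hypothesis
  \<open>a $ 0 = 0\<close>.\<close>

definition fps_Exp :: "real fps \<Rightarrow> real fps" where
  "fps_Exp a = fps_exp 1 oo a"

lemma fps_Exp_nth: "fps_Exp a $ n = (\<Sum>i\<le>n. (a ^ i $ n) / fact i)"
  by (simp add: fps_Exp_def fps_compose_nth fps_exp_def atLeast0AtMost)

lemma fps_Exp_nth_0 [simp]: "fps_Exp a $ 0 = 1"
  by (simp add: fps_Exp_nth)

lemma fps_deriv_Exp:
  assumes "a $ 0 = 0"
  shows "fps_deriv (fps_Exp a) = fps_Exp a * fps_deriv a"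
  using fps_compose_deriv[OF assms, of "fps_exp 1"] by (simp add: fps_Exp_def)

text \<open>Integrating factor: for every solution \<open>G\<close> the product
  \<open>G * fps_Exp (- a)\<close> has derivative 0 and hence equals 1. Both \<open>F\<close> and
  \<open>fps_Exp a\<close> are solutions, and the common factor cancels.\<close>

lemma fps_Exp_unique:
  assumes a: "a $ 0 = 0" and F: "fps_deriv F = F * fps_deriv a" "F $ 0 = 1"
  shows "F = fps_Exp a"
proof -
  have inv: "G * fps_Exp (- a) = 1" if G: "fps_deriv G = G * fps_deriv a" "G $ 0 = 1" for G
  proof -
    have "fps_deriv (G * fps_Exp (- a)) = 0"
      using a by (simp add: fps_deriv_Exp G(1) algebra_simps)
    then have "G * fps_Exp (- a) = fps_const ((G * fps_Exp (- a)) $ 0)"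
      by (simp only: fps_deriv_eq_0_iff)
    then show ?thesis using G(2) by simp
  qed
  have "F * fps_Exp (- a) = fps_Exp a * fps_Exp (- a)"
    using inv[OF F] inv[OF fps_deriv_Exp[OF a]] by simp
  moreover have "fps_Exp (- a) \<noteq> 0"
    using inv[OF F] by auto
  ultimately show ?thesis by simp
qed

lemma fps_Exp_add:
  assumes "a $ 0 = 0" "b $ 0 = 0"
  shows "fps_Exp (a + b) = fps_Exp a * fps_Exp b"
  by (rule fps_Exp_unique[symmetric])
    (use assms in \<open>simp_all add: fps_deriv_Exp algebra_simps\<close>)

lemma fps_Exp_0 [simp]: "fps_Exp 0 = 1"
  by (rule fps_Exp_unique[symmetric]) auto

section \<open>Partial sums and weighted absolute sums of coefficients\<close>

definition psum :: "nat \<Rightarrow> real fps \<Rightarrow> real" where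
  "psum n a = (\<Sum>k\<le>n. a $ k)"

text \<open>For \<open>s = 1\<close> this is the total variation up to \<open>n\<close>; weights
  \<open>s > 1\<close> serve for Rankin's trick.\<close>

definition wsum :: "real \<Rightarrow> nat \<Rightarrow> real fps \<Rightarrow> real" where
  "wsum s n a = (\<Sum>k\<le>n. \<bar>a $ k\<bar> * s ^ k)"

lemma wsum_nonneg: "s \<ge> 0 \<Longrightarrow> wsum s n a \<ge> 0"
  by (auto simp: wsum_def intro!: sum_nonneg)

lemma wsum_mono:
  assumes "s \<ge> 0" "m \<le> n"
  shows "wsum s m a \<le> wsum s n a"
  unfolding wsum_def by (intro sum_mono2) (use assms in auto)

text \<open>The index triangle i + j \<le> n lies inside the square i, j \<le> n.\<close>

lemma wsum_mult_le:
  assumes "s \<ge> 0"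
  shows "wsum s n (a * b) \<le> wsum s n a * wsum s n b"
proof -
  let ?g = "\<lambda>i j. (\<bar>a $ i\<bar> * s ^ i) * (\<bar>b $ j\<bar> * s ^ j)"
  have "wsum s n (a * b) \<le> (\<Sum>k\<le>n. \<Sum>i\<le>k. ?g i (k - i))"
    unfolding wsum_def
  proof (intro sum_mono)
    fix k
    have "\<bar>(a * b) $ k\<bar> * s ^ k \<le> (\<Sum>i\<le>k. \<bar>a $ i * b $ (k - i)\<bar>) * s ^ k"
      unfolding fps_mult_nth atLeast0AtMost
      by (intro mult_right_mono sum_abs) (use assms in auto)
    also have "\<dots> = (\<Sum>i\<le>k. ?g i (k - i))"
      unfolding sum_distrib_right
    proof (intro sum.cong refl)
      fix i assume "i \<in> {..k}"
      then have "s ^ k = s ^ i * s ^ (k - i)"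
        by (simp add: power_add[symmetric])
      then show "\<bar>a $ i * b $ (k - i)\<bar> * s ^ k = ?g i (k - i)"
        by (simp add: abs_mult)
    qed
    finally show "\<bar>(a * b) $ k\<bar> * s ^ k \<le> (\<Sum>i\<le>k. ?g i (k - i))" .
  qed
  also have "\<dots> = (\<Sum>(i, j)\<in>{(i, j). i + j \<le> n}. ?g i j)"
    by (rule sum.triangle_reindex_eq[symmetric])
  also have "\<dots> \<le> (\<Sum>(i, j)\<in>{..n} \<times> {..n}. ?g i j)"
    by (intro sum_mono2) (use assms in auto)
  also have "\<dots> = wsum s n a * wsum s n b"
    by (simp add: wsum_def sum_product sum.cartesian_product)
  finally show ?thesis .
qed

lemma wsum_power_le:
  assumes "s \<ge> 0"
  shows "wsum s n (a ^ i) \<le> wsum s n a ^ i"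
proof (induction i)
  case 0
  have "wsum s n 1 = (\<Sum>k\<in>{0}. \<bar>(1 :: real fps) $ k\<bar> * s ^ k)"
    unfolding wsum_def by (intro sum.mono_neutral_right) (auto simp: fps_one_nth)
  then show ?case by simp
next
  case (Suc i)
  have "wsum s n (a ^ Suc i) \<le> wsum s n a * wsum s n (a ^ i)"
    using wsum_mult_le[OF assms] by simp
  also have "\<dots> \<le> wsum s n a * wsum s n a ^ i"
    by (intro mult_left_mono Suc.IH wsum_nonneg assms)
  finally show ?case by simp
qed

lemma power_fps_nth_eq_0:
  fixes a :: "real fps"
  assumes "a $ 0 = 0" "k < i"
  shows "a ^ i $ k = 0"
  using assms(2)
proof (induction i arbitrary: k)
  case (Suc i)
  have "a $ j * a ^ i $ (k - j) = 0" if "j \<le> k" for j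
    using assms(1) Suc that by (cases j) auto
  then show ?case unfolding power_Suc fps_mult_nth by (intro sum.neutral) simp
qed simp

lemma psum_Exp:
  assumes "a $ 0 = 0"
  shows "psum n (fps_Exp a) = (\<Sum>i\<le>n. psum n (a ^ i) / fact i)"
proof -
  have "fps_Exp a $ k = (\<Sum>i\<le>n. (a ^ i $ k) / fact i)" if "k \<le> n" for k
    unfolding fps_Exp_nth
    by (intro sum.mono_neutral_left) (use that power_fps_nth_eq_0[OF assms] in auto)
  then have "psum n (fps_Exp a) = (\<Sum>k\<le>n. \<Sum>i\<le>n. (a ^ i $ k) / fact i)"
    by (simp add: psum_def)
  also have "\<dots> = (\<Sum>i\<le>n. psum n (a ^ i) / fact i)"
    by (subst sum.swap) (simp add: psum_def sum_divide_distrib)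
  finally show ?thesis .
qed

lemma sum_pow_fact_le_exp:
  assumes "(V :: real) \<ge> 0"
  shows "(\<Sum>i\<le>n. V ^ i / fact i) \<le> exp V"
proof -
  have "(\<Sum>i\<le>n. V ^ i / fact i) \<le> (\<Sum>i. V ^ i / fact i)"
    by (intro sum_le_suminf) (use assms summable_exp[of V] in \<open>auto simp: field_simps\<close>)
  also have "\<dots> = exp V"
    by (simp add: exp_def field_simps)
  finally show ?thesis .
qed

lemma wsum_Exp_le:
  assumes "a $ 0 = 0" "s \<ge> 0"
  shows "wsum s n (fps_Exp a) \<le> exp (wsum s n a)"
proof -
  have "\<bar>fps_Exp a $ k\<bar> \<le> (\<Sum>i\<le>n. \<bar>a ^ i $ k\<bar> / fact i)" if "k \<le> n" for k
  proof -
    have "\<bar>fps_Exp a $ k\<bar> \<le> (\<Sum>i\<le>k. \<bar>(a ^ i $ k) / fact i\<bar>)"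
      unfolding fps_Exp_nth by (rule sum_abs)
    also have "\<dots> \<le> (\<Sum>i\<le>n. \<bar>a ^ i $ k\<bar> / fact i)"
      using that by (simp add: abs_divide) (intro sum_mono2; auto)
    finally show ?thesis .
  qed
  then have "wsum s n (fps_Exp a) \<le> (\<Sum>k\<le>n. (\<Sum>i\<le>n. \<bar>a ^ i $ k\<bar> / fact i) * s ^ k)"
    unfolding wsum_def by (intro sum_mono mult_right_mono) (use assms in auto)
  also have "\<dots> = (\<Sum>i\<le>n. wsum s n (a ^ i) / fact i)"
    unfolding sum_distrib_right by (subst sum.swap) (simp add: wsum_def sum_divide_distrib)
  also have "\<dots> \<le> (\<Sum>i\<le>n. wsum s n a ^ i / fact i)"
    by (intro sum_mono divide_right_mono wsum_power_le assms) auto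
  also have "\<dots> \<le> exp (wsum s n a)"
    by (intro sum_pow_fact_le_exp wsum_nonneg assms)
  finally show ?thesis .
qed

lemma psum_mult: "psum n (a * b) = (\<Sum>k\<le>n. a $ k * psum (n - k) b)"
proof -
  have "psum n (a * b) = (\<Sum>(i, j)\<in>{(i, j). i + j \<le> n}. a $ i * b $ j)"
    by (simp add: psum_def fps_mult_nth atLeast0AtMost sum.triangle_reindex_eq)
  also have "{(i, j). i + j \<le> n} = Sigma {..n} (\<lambda>i. {..n - i})"
    by auto
  also have "(\<Sum>(i, j)\<in>Sigma {..n} (\<lambda>i. {..n - i}). a $ i * b $ j) = (\<Sum>k\<le>n. a $ k * psum (n - k) b)"
    by (subst sum.Sigma[symmetric]) (auto simp: psum_def sum_distrib_left)
  finally show ?thesis .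
qed

lemma abs_psum_mult_le:
  assumes "\<And>k. k \<le> n \<Longrightarrow> \<bar>psum k b\<bar> \<le> \<epsilon>"
  shows "\<bar>psum n (a * b)\<bar> \<le> wsum 1 n a * \<epsilon>"
proof -
  have "\<bar>psum n (a * b)\<bar> \<le> (\<Sum>k\<le>n. \<bar>a $ k * psum (n - k) b\<bar>)"
    unfolding psum_mult by (rule sum_abs)
  also have "\<dots> \<le> (\<Sum>k\<le>n. \<bar>a $ k\<bar> * \<epsilon>)"
    by (intro sum_mono) (auto simp: abs_mult intro!: mult_left_mono assms)
  finally show ?thesis by (simp add: wsum_def sum_distrib_right)
qed

text \<open>In \<open>a ^ i\<close> only one factor is estimated by its small partial sums, the
  other i - 1 by the total variation V. After division by i! this is at most \<epsilon> V^(i - 1) /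
  (i - 1)!, so \<epsilon> enters linearly and exponentiation costs one factor exp V.\<close>

lemma psum_Exp_small:
  assumes a: "a $ 0 = 0" and \<epsilon>: "\<And>k. k \<le> n \<Longrightarrow> \<bar>psum k a\<bar> \<le> \<epsilon>"
  shows "\<bar>psum n (fps_Exp a) - 1\<bar> \<le> \<epsilon> * exp (wsum 1 n a)"
proof -
  let ?V = "wsum 1 n a"
  have V: "?V \<ge> 0" by (simp add: wsum_nonneg)
  have \<epsilon>0: "\<epsilon> \<ge> 0" using \<epsilon>[of 0] by simp
  have one: "psum n (1 :: real fps) = 1"
  proof -
    have "psum n 1 = (\<Sum>k\<in>{0}. (1 :: real fps) $ k)"
      unfolding psum_def by (intro sum.mono_neutral_right) (auto simp: fps_one_nth)
    then show ?thesis by simp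
  qed
  have "psum n (fps_Exp a) - 1 = (\<Sum>i\<in>{..n} - {0}. psum n (a ^ i) / fact i)"
    unfolding psum_Exp[OF a] by (subst sum.remove[of _ 0]) (auto simp: one)
  also have "\<bar>\<dots>\<bar> \<le> (\<Sum>i\<in>{..n} - {0}. \<epsilon> * (?V ^ (i - 1) / fact (i - 1)))"
  proof (rule order.trans[OF sum_abs], intro sum_mono)
    fix i assume "i \<in> {..n} - {0}"
    then obtain j where j: "i = Suc j" by (cases i) auto
    have "\<bar>psum n (a ^ j * a)\<bar> \<le> wsum 1 n (a ^ j) * \<epsilon>"
      by (intro abs_psum_mult_le \<epsilon>)
    also have "\<dots> \<le> ?V ^ j * \<epsilon>"
      by (intro mult_right_mono wsum_power_le \<epsilon>0) auto
    finally have "\<bar>psum n (a ^ i)\<bar> \<le> \<epsilon> * ?V ^ j"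
      by (simp add: j mult.commute)
    then have "\<bar>psum n (a ^ i)\<bar> / fact i \<le> \<epsilon> * ?V ^ j / fact j"
      using V \<epsilon>0 by (intro frac_le) (auto simp: j intro!: fact_mono)
    then show "\<bar>psum n (a ^ i) / fact i\<bar> \<le> \<epsilon> * (?V ^ (i - 1) / fact (i - 1))"
      by (simp add: j)
  qed
  also have "\<dots> = \<epsilon> * (\<Sum>i\<in>{..n} - {0}. ?V ^ (i - 1) / fact (i - 1))"
    by (simp add: sum_distrib_left)
  also have "(\<Sum>i\<in>{..n} - {0}. ?V ^ (i - 1) / fact (i - 1)) = (\<Sum>j<n. ?V ^ j / fact j)"
    by (rule sum.reindex_bij_witness[of _ Suc "\<lambda>i. i - 1"]) auto
  also have "\<dots> \<le> (\<Sum>j\<le>n. ?V ^ j / fact j)"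
    using V by (intro sum_mono2) auto
  also have "\<dots> \<le> exp ?V"
    by (rule sum_pow_fact_le_exp[OF V])
  finally show ?thesis using \<epsilon>0 by (simp add: mult_left_mono)
qed

text \<open>Beyond both supports a partial sum is evaluation at 1, which is multiplicative.\<close>

lemma psum_mult_finite:
  assumes a: "\<And>k. k > A \<Longrightarrow> a $ k = 0" and b: "\<And>k. k > B \<Longrightarrow> b $ k = 0"
    and N: "A + B \<le> N"
  shows "psum N (a * b) = psum A a * psum B b"
    and "\<And>k. k > A + B \<Longrightarrow> (a * b) $ k = 0"
proof -
  have "psum N (a * b) = (\<Sum>k\<le>N. a $ k * psum (N - k) b)"
    by (rule psum_mult)
  also have "\<dots> = (\<Sum>k\<le>A. a $ k * psum (N - k) b)"
    by (intro sum.mono_neutral_right) (use N a in auto)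
  also have "\<dots> = (\<Sum>k\<le>A. a $ k * psum B b)"
  proof (intro sum.cong refl)
    fix k assume "k \<in> {..A}"
    then have "B \<le> N - k" using N by auto
    then have "psum (N - k) b = psum B b"
      unfolding psum_def by (intro sum.mono_neutral_right) (use b in auto)
    then show "a $ k * psum (N - k) b = a $ k * psum B b" by simp
  qed
  finally show "psum N (a * b) = psum A a * psum B b"
    by (simp add: psum_def sum_distrib_right)
  show "(a * b) $ k = 0" if "k > A + B" for k
    unfolding fps_mult_nth
  proof (intro sum.neutral ballI)
    fix i
    show "a $ i * b $ (k - i) = 0"
      using a[of i] b[of "k - i"] that by (cases "i > A") auto
  qed
qed

lemma psum_power_finite:
  assumes a: "\<And>k. k > H \<Longrightarrow> a $ k = 0"
  shows "(\<forall>k > i * H. a ^ i $ k = 0) \<and> (\<forall>N \<ge> i * H. psum N (a ^ i) = psum H a ^ i)"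
proof (induction i)
  case 0
  have "psum N (1 :: real fps) = (\<Sum>k\<in>{0}. (1 :: real fps) $ k)" for N
    unfolding psum_def by (intro sum.mono_neutral_right) (auto simp: fps_one_nth)
  then show ?case by auto
next
  case (Suc i)
  have *: "\<And>k. i * H < k \<Longrightarrow> a ^ i $ k = 0" using Suc by blast
  have "psum N (a ^ Suc i) = psum H a ^ Suc i" if "Suc i * H \<le> N" for N
    using psum_mult_finite(1)[OF a *, where N = N] that Suc by simp
  moreover have "a ^ Suc i $ k = 0" if "k > Suc i * H" for k
    using psum_mult_finite(2)[OF a *, where N = k] that by simp
  ultimately show ?case by blast
qed

text \<open>Rankin's trick: the mass of \<open>fps_Exp a\<close> beyond \<open>n\<close> is at most \<open>s powr - n\<close> times its
  \<open>s\<close>-weighted mass.\<close>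

lemma psum_Exp_finite:
  assumes a0: "a $ 0 = 0" and a: "\<And>k. k > H \<Longrightarrow> a $ k = 0" and s: "s \<ge> 1"
  shows "\<bar>psum n (fps_Exp a) - exp (psum H a)\<bar> \<le> exp (wsum s H a) / s ^ n"
proof -
  let ?G = "psum H a" and ?W = "wsum s H a"
  have W: "wsum s N a \<le> ?W" for N
  proof -
    have "wsum s N a \<le> wsum s (max N H) a"
      using s by (intro wsum_mono) auto
    also have "\<dots> = ?W"
      unfolding wsum_def by (intro sum.mono_neutral_right) (use a in auto)
    finally show ?thesis .
  qed
  have W0: "?W \<ge> 0" using s by (simp add: wsum_nonneg)
  \<comment> \<open>The two sides differ only in coefficients with index k > n, where the factor
    \<open>s ^ k / s ^ n\<close>, at least 1, may be inserted.\<close>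
  have bd: "\<bar>?G ^ i - psum n (a ^ i)\<bar> \<le> ?W ^ i / s ^ n" for i
  proof -
    define N where "N = max n (i * H)"
    have "?G ^ i = psum N (a ^ i)"
      using psum_power_finite[of H a i, OF a] by (simp add: N_def)
    also have "\<dots> = psum n (a ^ i) + (\<Sum>k\<in>{n<..N}. a ^ i $ k)"
    proof -
      have "{..N} = {..n} \<union> {n<..N}" by (auto simp: N_def)
      then show ?thesis unfolding psum_def by (simp only:) (rule sum.union_disjoint; auto)
    qed
    finally have "\<bar>?G ^ i - psum n (a ^ i)\<bar> = \<bar>\<Sum>k\<in>{n<..N}. a ^ i $ k\<bar>" by simp
    also have "\<dots> \<le> (\<Sum>k\<in>{n<..N}. \<bar>a ^ i $ k\<bar> * s ^ k / s ^ n)"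
    proof (rule order.trans[OF sum_abs], intro sum_mono)
      fix k assume "k \<in> {n<..N}"
      then have "s ^ n \<le> s ^ k" using s by (intro power_increasing) auto
      then show "\<bar>a ^ i $ k\<bar> \<le> \<bar>a ^ i $ k\<bar> * s ^ k / s ^ n"
        using s by (auto simp: divide_simps intro!: mult_left_mono)
    qed
    also have "\<dots> = (\<Sum>k\<in>{n<..N}. \<bar>a ^ i $ k\<bar> * s ^ k) / s ^ n"
      by (simp add: sum_divide_distrib)
    also have "\<dots> \<le> wsum s N (a ^ i) / s ^ n"
      unfolding wsum_def using s by (intro divide_right_mono sum_mono2) auto
    also have "\<dots> \<le> wsum s N a ^ i / s ^ n"
      using s by (intro divide_right_mono wsum_power_le) auto
    also have "\<dots> \<le> ?W ^ i / s ^ n"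
      using s W by (intro divide_right_mono power_mono wsum_nonneg) auto
    finally show ?thesis .
  qed
  have e: "(\<lambda>i. x ^ i / fact i) sums exp x" for x :: real
    using exp_converges[of x] by (simp add: field_simps)
  have p: "(\<lambda>i. psum n (a ^ i) / fact i) sums psum n (fps_Exp a)"
    unfolding psum_Exp[OF a0]
    by (rule sums_finite) (auto simp: psum_def power_fps_nth_eq_0[OF a0])
  have d: "(\<lambda>i. ?G ^ i / fact i - psum n (a ^ i) / fact i) sums (exp ?G - psum n (fps_Exp a))"
    by (intro sums_diff e p)
  have w: "(\<lambda>i. (?W ^ i / fact i) / s ^ n) sums (exp ?W / s ^ n)"
    by (intro sums_divide e)
  have le: "\<bar>?G ^ i / fact i - psum n (a ^ i) / fact i\<bar> \<le> (?W ^ i / fact i) / s ^ n" for i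
  proof -
    have "\<bar>?G ^ i / fact i - psum n (a ^ i) / fact i\<bar> = \<bar>?G ^ i - psum n (a ^ i)\<bar> / fact i"
      by (simp add: diff_divide_distrib[symmetric] abs_divide)
    also have "\<dots> \<le> (?W ^ i / s ^ n) / fact i"
      by (intro divide_right_mono bd) auto
    finally show ?thesis by (simp add: field_simps)
  qed
  have "exp ?G - psum n (fps_Exp a) \<le> exp ?W / s ^ n"
    by (rule sums_le[OF _ d w]) (use le in \<open>auto simp: abs_le_iff\<close>)
  moreover have "- (exp ?G - psum n (fps_Exp a)) \<le> exp ?W / s ^ n"
    by (rule sums_le[OF _ sums_minus[OF d] w]) (use le in \<open>auto simp: abs_le_iff\<close>)
  ultimately show ?thesis by (simp add: abs_le_iff)
qed

section \<open>Lattice points and generating functions\<close>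

text \<open>Cutting g at H makes the exponential a product. Replacing the upper factor by 1 costs
  \<epsilon> exp V, spread over the mass exp V of the lower factor; this gives
  \<open>exp (2 * V)\<close>. The other term is Rankin's trick for the lower factor.\<close>

lemma psum_Exp_split:
  assumes g0: "g $ 0 = 0" and H: "0 < H" and \<epsilon>0: "\<epsilon> \<ge> 0"
    and \<epsilon>: "\<And>k. \<lbrakk>H \<le> k; k \<le> n\<rbrakk> \<Longrightarrow> \<bar>psum k g - psum H g\<bar> \<le> \<epsilon>"
    and V: "wsum 1 n g \<le> V" and Hn: "H \<le> n"
  shows "\<bar>psum n (fps_Exp g) - exp (psum H g)\<bar>
    \<le> \<epsilon> * exp (2 * V) + exp (exp 1 * V - real n / real H)"
proof -
  define g1 where "g1 = Abs_fps (\<lambda>k. if k \<le> H then g $ k else 0)"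
  define g2 where "g2 = Abs_fps (\<lambda>k. if k \<le> H then 0 else g $ k)"
  \<comment> \<open>With this weight \<open>s ^ H = exp 1\<close>, so the weighted mass of
    \<open>g1\<close> is at most \<open>exp 1 * V\<close>, while \<open>s ^ n\<close> is exp (n /
    H).\<close>
  define s :: real where "s = exp (1 / real H)"
  have s1: "s \<ge> 1" by (simp add: s_def)
  have g: "g = g1 + g2" by (simp add: g1_def g2_def fps_eq_iff)
  have g10: "g1 $ 0 = 0" and g20: "g2 $ 0 = 0" using g0 by (simp_all add: g1_def g2_def)
  have V1: "wsum 1 n g1 \<le> V" and V2: "wsum 1 n g2 \<le> V"
    by (rule order.trans[OF _ V]; unfold wsum_def, intro sum_mono, simp add: g1_def g2_def)+
  have psH: "psum H g1 = psum H g" by (simp add: psum_def g1_def)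
  have ps2: "\<bar>psum k g2\<bar> \<le> \<epsilon>" if "k \<le> n" for k
  proof (cases "H \<le> k")
    case True
    have "psum k g - psum H g = psum k g2"
    proof -
      have "psum k g1 = psum H g1"
        unfolding psum_def by (intro sum.mono_neutral_right) (use True in \<open>auto simp: g1_def\<close>)
      moreover have "psum k g = psum k g1 + psum k g2"
        by (simp add: psum_def g sum.distrib)
      ultimately show ?thesis using psH by simp
    qed
    then show ?thesis using \<epsilon>[OF True that] by simp
  next
    case False
    then have "psum k g2 = 0" by (simp add: psum_def g2_def)
    then show ?thesis using \<epsilon>0 by simp
  qed
  have E2: "\<bar>psum k (fps_Exp g2) - 1\<bar> \<le> \<epsilon> * exp V" if "k \<le> n" for k
  proof -
    have "\<bar>psum k (fps_Exp g2) - 1\<bar> \<le> \<epsilon> * exp (wsum 1 k g2)"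
      by (rule psum_Exp_small[OF g20]) (use ps2 that in auto)
    also have "\<dots> \<le> \<epsilon> * exp V"
      using wsum_mono[of 1 k n g2] that V2 \<epsilon>0 by (intro mult_left_mono) auto
    finally show ?thesis .
  qed
  have "psum n (fps_Exp g) - psum n (fps_Exp g1)
      = (\<Sum>k\<le>n. fps_Exp g1 $ k * (psum (n - k) (fps_Exp g2) - 1))"
    unfolding g fps_Exp_add[OF g10 g20] psum_mult
    by (simp add: psum_def[of n "fps_Exp g1"] algebra_simps sum_subtractf)
  also have "\<bar>\<dots>\<bar> \<le> (\<Sum>k\<le>n. \<bar>fps_Exp g1 $ k\<bar> * (\<epsilon> * exp V))"
    by (rule order.trans[OF sum_abs], intro sum_mono)
      (auto simp: abs_mult intro!: mult_left_mono E2)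
  also have "\<dots> = wsum 1 n (fps_Exp g1) * (\<epsilon> * exp V)"
    by (simp add: wsum_def sum_distrib_right)
  also have "\<dots> \<le> exp V * (\<epsilon> * exp V)"
  proof (intro mult_right_mono)
    show "wsum 1 n (fps_Exp g1) \<le> exp V"
      using wsum_Exp_le[OF g10, of 1 n] V1 by (smt (verit) exp_le_cancel_iff)
  qed (use \<epsilon>0 in auto)
  also have "\<dots> = \<epsilon> * exp (2 * V)"
    by (simp add: exp_add[symmetric] algebra_simps mult_2[symmetric])
  finally have 1: "\<bar>psum n (fps_Exp g) - psum n (fps_Exp g1)\<bar> \<le> \<epsilon> * exp (2 * V)" .
  have sH: "s ^ H = exp 1"
    using H by (simp add: s_def exp_of_nat_mult[symmetric])
  have "wsum s H g1 \<le> exp 1 * V"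
  proof -
    have "wsum s H g1 \<le> (\<Sum>k\<le>H. \<bar>g1 $ k\<bar> * exp 1)"
      unfolding wsum_def sH[symmetric]
      by (intro sum_mono mult_left_mono power_increasing) (use s1 in auto)
    also have "\<dots> = exp 1 * wsum 1 H g1"
      by (simp add: wsum_def sum_distrib_left mult.commute)
    also have "\<dots> \<le> exp 1 * V"
      using wsum_mono[of 1 H n g1] V1 Hn by (intro mult_left_mono) auto
    finally show ?thesis .
  qed
  moreover have "s ^ n = exp (real n / real H)"
    by (simp add: s_def exp_of_nat_mult[symmetric])
  moreover have "\<bar>psum n (fps_Exp g1) - exp (psum H g1)\<bar> \<le> exp (wsum s H g1) / s ^ n"
    by (rule psum_Exp_finite[OF g10 _ s1]) (simp add: g1_def)
  ultimately have "\<bar>psum n (fps_Exp g1) - exp (psum H g)\<bar> \<le> exp (exp 1 * V - real n / real H)"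
    unfolding psH exp_diff by (smt (verit) divide_right_mono exp_ge_zero exp_le_cancel_iff)
  with 1 show ?thesis by linarith
qed

text \<open>The series of - log (1 - (w z)^l): at n = k l the coefficient is w^n / k. It is the
  logarithm of the Euler factor of a prime at lattice position l, and the weight w = exp (-
  \<delta>) divides counts by size.\<close>

definition log_series :: "real \<Rightarrow> nat \<Rightarrow> real fps" where
  "log_series w l = Abs_fps (\<lambda>n. if n > 0 \<and> l dvd n then real l / real n * w ^ n else 0)"

lemma log_series_nth_0 [simp]: "log_series w l $ 0 = 0"
  by (simp add: log_series_def)

lemma fps_mult_one_minus_nth:
  "(F * (1 - fps_const c * fps_X ^ l)) $ n = F $ n - (if n < l then 0 else c * F $ (n - l))"
  for c :: "'a :: comm_ring_1"
proof -
  have "F * (1 - fps_const c * fps_X ^ l) = F - fps_const c * (F * fps_X ^ l)"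
    by (simp add: right_diff_distrib mult.left_commute)
  then show ?thesis by (simp add: fps_X_power_mult_right_nth)
qed

lemma fps_Exp_log_series:
  assumes l: "l > 0"
  shows "fps_Exp (log_series w l) * (1 - fps_const (w ^ l) * fps_X ^ l) = 1"
proof -
  let ?E = "fps_Exp (log_series w l)" and ?D = "fps_deriv (log_series w l)"
  let ?Q = "1 - fps_const (w ^ l) * fps_X ^ l :: real fps"
  have Dn: "?D $ n = (if l dvd Suc n then real l * w ^ Suc n else 0)" for n
    by (simp add: log_series_def del: power_Suc of_nat_Suc)
  \<comment> \<open>The derivative is a geometric series with step l, so multiplication by
    \<open>?Q\<close> telescopes to its first term, at index l - 1.\<close>
  have D: "?D * ?Q = fps_const (real l * w ^ l) * fps_X ^ (l - 1)"
  proof (rule fps_ext)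
    fix n
    have "(?D * ?Q) $ n = ?D $ n - (if n < l then 0 else w ^ l * ?D $ (n - l))"
      by (rule fps_mult_one_minus_nth)
    also have "\<dots> = (if n = l - 1 then real l * w ^ l else 0)"
    proof (cases "n < l")
      case True
      then have "l dvd Suc n \<longleftrightarrow> n = l - 1"
        using l by (auto dest: dvd_imp_le)
      then show ?thesis using True l by (auto simp: Dn simp del: power_Suc fps_deriv_nth)
    next
      case False
      then have "Suc n = Suc (n - l) + l" by simp
      then have "l dvd Suc n \<longleftrightarrow> l dvd Suc (n - l)" "w ^ Suc n = w ^ l * w ^ Suc (n - l)"
        by (metis dvd_add_left_iff dvd_refl, metis power_add mult.commute)
      then show ?thesis using False l by (auto simp: Dn simp del: power_Suc fps_deriv_nth)
    qed
    finally show "(?D * ?Q) $ n = (fps_const (real l * w ^ l) * fps_X ^ (l - 1)) $ n"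
      by (simp add: fps_X_power_nth)
  qed
  have Q: "fps_deriv ?Q = - (fps_const (real l * w ^ l) * fps_X ^ (l - 1))"
  proof -
    have "fps_deriv ?Q = - (fps_const (w ^ l) * (of_nat l * fps_X ^ (l - 1)))"
      by (simp add: fps_deriv_power' del: fps_const_power)
    also have "(of_nat l :: real fps) = fps_const (real l)"
      by (simp add: fps_of_nat)
    also have "fps_const (w ^ l) * (fps_const (real l) * fps_X ^ (l - 1))
        = fps_const (real l * w ^ l) * (fps_X :: real fps) ^ (l - 1)"
      by (simp add: mult.assoc[symmetric] mult.commute)
    finally show ?thesis .
  qed
  have "fps_deriv (?E * ?Q) = ?E * (?D * ?Q) - ?E * (fps_const (real l * w ^ l) * fps_X ^ (l - 1))"
    unfolding fps_deriv_mult Q by (simp add: fps_deriv_Exp algebra_simps del: fps_const_mult)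
  also have "\<dots> = 0" unfolding D by simp
  finally have "?E * ?Q = fps_const ((?E * ?Q) $ 0)"
    by (simp only: fps_deriv_eq_0_iff)
  moreover have "(?E * ?Q) $ 0 = 1" using l by simp
  ultimately show ?thesis by simp
qed

definition reps :: "('a \<Rightarrow> nat) \<Rightarrow> 'a set \<Rightarrow> nat \<Rightarrow> 'a multiset set" where
  "reps l I n = {M. set_mset M \<subseteq> I \<and> (\<Sum>i\<in>#M. l i) = n}"

lemma finite_reps:
  assumes "finite I" "\<And>i. i \<in> I \<Longrightarrow> l i > 0"
  shows "finite (reps l I n)"
proof -
  have "size M \<le> (\<Sum>i\<in>#M. l i)" if "set_mset M \<subseteq> I" for M
    using that
  proof (induction M)
    case (add i M)
    then show ?case using assms(2)[of i] by simp
  qed simp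
  then have "reps l I n \<subseteq> mset ` {xs. set xs \<subseteq> I \<and> length xs \<le> n}"
    unfolding reps_def by (smt (verit, best) ex_mset image_iff mem_Collect_eq set_mset_mset size_mset subsetI)
  then show ?thesis
    using finite_lists_length_le[OF assms(1)] finite_surj by blast
qed

text \<open>A multiset over \<open>insert i I\<close> either avoids i or loses one copy of it. This
  is the coefficient form of multiplying by one Euler factor.\<close>

lemma card_reps_insert:
  assumes "finite I" "i \<notin> I" "\<And>j. j \<in> insert i I \<Longrightarrow> l j > 0"
  shows "card (reps l (insert i I) n)
    = card (reps l I n) + (if l i \<le> n then card (reps l (insert i I) (n - l i)) else 0)"
proof -
  let ?A = "if l i \<le> n then add_mset i ` reps l (insert i I) (n - l i) else {}"
  have "reps l (insert i I) n = reps l I n \<union> ?A"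
  proof (intro equalityI subsetI)
    fix M assume M: "M \<in> reps l (insert i I) n"
    show "M \<in> reps l I n \<union> ?A"
    proof (cases "i \<in># M")
      case True
      then obtain M' where M': "M = add_mset i M'" by (meson multi_member_split)
      then have "l i \<le> n" "M' \<in> reps l (insert i I) (n - l i)"
        using M by (auto simp: reps_def)
      then show ?thesis using M' by auto
    qed (use M in \<open>auto simp: reps_def\<close>)
  qed (auto simp: reps_def split: if_splits)
  moreover have "reps l I n \<inter> ?A = {}"
  proof (rule equals0I)
    fix M assume M: "M \<in> reps l I n \<inter> ?A"
    then have "i \<in># M" by (auto split: if_splits)
    moreover have "set_mset M \<subseteq> I" using M by (simp add: reps_def)
    ultimately show False using assms(2) by blast
  qed
  moreover have "finite (reps l I n)"
    using assms by (intro finite_reps) simp_all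
  moreover have "finite (reps l (insert i I) (n - l i))"
    using assms by (intro finite_reps) simp_all
  moreover have "card (add_mset i ` reps l (insert i I) (n - l i)) = card (reps l (insert i I) (n - l i))"
    by (rule card_image) (simp add: inj_on_def)
  ultimately show ?thesis by (simp add: card_Un_disjoint)
qed

text \<open>Euler product, one prime at a time: multiplied by the inverse Euler factor
  \<open>?Q\<close> of the new prime, both sides become the series for \<open>I\<close>, the right
  one by \<open>card_reps_insert\<close>. Then \<open>?Q\<close> is cancelled.\<close>

lemma fps_Exp_sum_log_series:
  fixes w :: real and l :: "'a \<Rightarrow> nat"
  assumes "finite I" "\<And>i. i \<in> I \<Longrightarrow> l i > 0"
  shows "fps_Exp (\<Sum>i\<in>I. log_series w (l i)) = Abs_fps (\<lambda>n. w ^ n * real (card (reps l I n)))"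
  using assms
proof (induction I rule: finite_induct)
  case empty
  have "reps l {} n = (if n = 0 then {{#}} else {})" for n
    by (auto simp: reps_def)
  then show ?case by (auto simp: fps_eq_iff)
next
  case (insert i I)
  let ?R = "\<lambda>I. Abs_fps (\<lambda>n. w ^ n * real (card (reps l I n)))"
  let ?Q = "1 - fps_const (w ^ l i) * fps_X ^ l i :: real fps"
  have li: "l i > 0" using insert.prems by simp
  have "fps_Exp (\<Sum>i\<in>insert i I. log_series w (l i)) * ?Q
      = fps_Exp (\<Sum>i\<in>I. log_series w (l i)) * (fps_Exp (log_series w (l i)) * ?Q)"
    using insert.hyps by (simp add: fps_Exp_add fps_sum_nth mult_ac)
  also have "\<dots> = ?R I"
    using insert by (simp add: fps_Exp_log_series[OF li])
  also have "\<dots> = ?R (insert i I) * ?Q"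
  proof (rule fps_ext)
    fix n
    have "(?R (insert i I) * ?Q) $ n
        = ?R (insert i I) $ n - (if n < l i then 0 else w ^ l i * ?R (insert i I) $ (n - l i))"
      by (rule fps_mult_one_minus_nth)
    also have "\<dots> = ?R I $ n"
    proof (cases "l i \<le> n")
      case True
      then have "w ^ n = w ^ l i * w ^ (n - l i)" by (simp flip: power_add)
      then show ?thesis
        using True card_reps_insert[of I i l n] insert
        by (simp add: distrib_left)
    next
      case False
      then show ?thesis
        using card_reps_insert[of I i l n] insert
        by simp
    qed
    finally show "?R I $ n = (?R (insert i I) * ?Q) $ n" by simp
  qed
  finally have "fps_Exp (\<Sum>i\<in>insert i I. log_series w (l i)) * ?Q = ?R (insert i I) * ?Q" .
  moreover have "?Q \<noteq> 0"
    using fps_Exp_log_series[OF li, of w] by (metis mult_zero_right zero_neq_one)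
  ultimately show ?case by simp
qed

text \<open>For w = exp (- \<delta>) and t = \<delta> n the coefficient is \<delta> (1 - exp (- t))
  / t, the density of exp (- t) dLi(exp t) times the mesh width. So this is \<open>Li\<close> on the
  lattice, in the normalization used for the primes.\<close>

definition lat_Li :: "real \<Rightarrow> real fps" where
  "lat_Li w = log_series 1 1 - log_series w 1"

lemma lat_Li_nth: "lat_Li w $ n = (if n = 0 then 0 else (1 - w ^ n) / real n)"
  by (simp add: lat_Li_def log_series_def field_simps)

text \<open>The factor \<open>fps_Exp (lat_Li w)\<close> is \<open>(1 - w z) / (1 - z)\<close>, whose coefficients weighted by
  \<open>w powr - n\<close> have partial sums \<open>w powr - n\<close> exactly; this is the lattice counterpart of the
  continuous system with \<open>\<pi>(x) = Li(x)\<close> and \<open>N(x) = x\<close>.\<close>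

lemma card_reps_le_eq:
  assumes I: "finite I" "\<And>i. i \<in> I \<Longrightarrow> l i > 0" and w: "w > 0"
  shows "real (card {M. set_mset M \<subseteq> I \<and> (\<Sum>i\<in>#M. l i) \<le> n})
    = psum n (fps_Exp ((\<Sum>i\<in>I. log_series w (l i)) - lat_Li w)) / w ^ n"
proof -
  let ?P = "\<Sum>i\<in>I. log_series w (l i)"
  let ?g = "?P - lat_Li w"
  \<comment> \<open>Formally \<open>?S\<close> is \<open>fps_Exp ?g\<close> divided by 1 - z. This
    denominator is the one in \<open>fps_Exp (lat_Li w)\<close>, which leaves
    \<open>fps_Exp ?P = ?S * ?Xw\<close>.\<close>
  let ?S = "Abs_fps (\<lambda>n. psum n (fps_Exp ?g))"
  let ?X1 = "1 - fps_X :: real fps" and ?Xw = "1 - fps_const w * fps_X :: real fps"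
  have P0: "?P $ 0 = 0" and L0: "lat_Li w $ 0 = 0" and g0: "?g $ 0 = 0"
    by (simp_all add: fps_sum_nth lat_Li_nth)
  have S: "?S * ?X1 = fps_Exp ?g"
  proof (rule fps_ext)
    fix n
    show "(?S * ?X1) $ n = fps_Exp ?g $ n"
      using fps_mult_one_minus_nth[of ?S 1 1 n] by (cases n) (simp_all add: psum_def)
  qed
  have e1: "fps_Exp (log_series 1 1) * ?X1 = 1"
    using fps_Exp_log_series[of 1 1] by simp
  have ew: "fps_Exp (log_series w 1) * ?Xw = 1"
    using fps_Exp_log_series[of 1 w] by simp
  have "fps_Exp (log_series 1 1) = fps_Exp (lat_Li w) * fps_Exp (log_series w 1)"
    by (subst fps_Exp_add[symmetric]) (simp_all add: lat_Li_def)
  then have "fps_Exp (log_series 1 1) * ?Xw = fps_Exp (lat_Li w)"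
    using ew by (simp add: mult.assoc)
  then have "fps_Exp (lat_Li w) * ?X1 = (fps_Exp (log_series 1 1) * ?X1) * ?Xw"
    by (simp only: mult_ac)
  then have "fps_Exp (lat_Li w) * ?X1 = ?Xw"
    by (simp only: e1 mult_1)
  moreover have "fps_Exp ?P = fps_Exp ?g * fps_Exp (lat_Li w)"
    using fps_Exp_add[OF g0 L0] by simp
  ultimately have "fps_Exp ?P * ?X1 = (?S * ?X1) * ?Xw"
    by (simp only: S mult.assoc)
  then have "fps_Exp ?P * ?X1 = (?S * ?Xw) * ?X1"
    by (simp only: mult_ac)
  moreover have "?X1 \<noteq> 0" using e1 by auto
  ultimately have PS: "fps_Exp ?P = ?S * ?Xw" by simp
  \<comment> \<open>Divided by w^n, this recursion telescopes: the counts up to n add up to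
    \<open>?S $ n / w ^ n\<close>.\<close>
  have R: "w ^ n * real (card (reps l I n)) = ?S $ n - (if n < 1 then 0 else w * ?S $ (n - 1))" for n
  proof -
    have "w ^ n * real (card (reps l I n)) = fps_Exp ?P $ n"
      by (subst fps_Exp_sum_log_series) (use I in auto)
    also have "\<dots> = (?S * ?Xw) $ n" by (simp only: PS)
    finally have "w ^ n * real (card (reps l I n)) = (?S * ?Xw) $ n" .
    then show ?thesis using fps_mult_one_minus_nth[of ?S w 1 n] by simp
  qed
  have main: "(\<Sum>k\<le>n. real (card (reps l I k))) = ?S $ n / w ^ n"
  proof (induction n)
    case 0
    then show ?case using R[of 0] by simp
  next
    case (Suc n)
    have "w ^ Suc n * real (card (reps l I (Suc n))) = ?S $ Suc n - w * ?S $ n"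
      using R[of "Suc n"] by simp
    then have "real (card (reps l I (Suc n))) = (?S $ Suc n - w * ?S $ n) / w ^ Suc n"
      using w by (simp add: field_simps)
    then show ?case
      using Suc w by (simp add: diff_divide_distrib)
  qed
  have "{M. set_mset M \<subseteq> I \<and> (\<Sum>i\<in>#M. l i) \<le> n} = (\<Union>k\<le>n. reps l I k)"
    by (auto simp: reps_def)
  also have "card \<dots> = (\<Sum>k\<le>n. card (reps l I k))"
    by (rule card_UN_disjoint) (use I in \<open>auto simp: reps_def intro!: finite_reps[unfolded reps_def]\<close>)
  finally show ?thesis using main by simp
qed

section \<open>The logarithmic integral\<close>

abbreviation li_density :: "real \<Rightarrow> real" where
  "li_density u \<equiv> (1 - inverse u) / ln u"

lemma one_minus_inverse_le_ln:
  assumes "u \<ge> 1"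
  shows "1 - inverse u \<le> ln (u :: real)"
  using ln_le_minus_one[of "inverse u"] assms by (simp add: ln_inverse)

lemma li_density_nonneg: "u \<ge> 1 \<Longrightarrow> 0 \<le> li_density u"
  by (simp add: inverse_le_1_iff)

lemma li_density_le_1: "u \<ge> 1 \<Longrightarrow> li_density u \<le> 1"
  using one_minus_inverse_le_ln[of u] by (cases "u = 1") (auto simp: divide_simps mult.commute)

text \<open>Boundedness and measurability are used because the HOL value 0 at u = 1 breaks
  continuity there.\<close>

lemma li_density_integrable:
  assumes "1 \<le> a"
  shows "li_density integrable_on {a..b}"
proof (rule measurable_bounded_by_integrable_imp_integrable_real)
  show "li_density \<in> borel_measurable (lebesgue_on {a..b})"
    by (intro measurable_restrict_space1 measurable_completion) measurable
  show "(\<lambda>_. 1 :: real) integrable_on {a..b}" by (rule integrable_const_ivl)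
  show "\<bar>li_density u\<bar> \<le> 1" if "u \<in> {a..b}" for u
    using li_density_nonneg[of u] li_density_le_1[of u] that assms by auto
qed auto

lemma Li_diff:
  assumes "1 \<le> x" "x \<le> y"
  shows "Li y - Li x = integral {x..y} li_density"
  using Henstock_Kurzweil_Integration.integral_combine[OF assms li_density_integrable[of 1 y]]
  by (simp add: Li_def)

lemma Li_1 [simp]: "Li 1 = 0"
  by (simp add: Li_def)

lemma Li_diff_le:
  assumes "1 \<le> x" "x \<le> y"
  shows "Li y - Li x \<le> y - x"
proof -
  have "integral {x..y} li_density \<le> integral {x..y} (\<lambda>_. 1)"
    by (intro integral_le li_density_integrable li_density_le_1) (use assms in auto)
  then show ?thesis using assms by (simp add: Li_diff)
qed

lemma Li_mono:
  assumes "1 \<le> x" "x \<le> y"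
  shows "Li x \<le> Li y"
proof -
  have "0 \<le> integral {x..y} li_density"
    by (intro integral_nonneg li_density_integrable li_density_nonneg) (use assms in auto)
  then show ?thesis using Li_diff[OF assms] by simp
qed

lemma Li_nonneg: "1 \<le> x \<Longrightarrow> 0 \<le> Li x"
  using Li_mono[of 1 x] by simp

lemma Li_diff_ge:
  assumes "2 \<le> x" "x \<le> y"
  shows "(y - x) / (2 * ln y) \<le> Li y - Li x"
proof -
  have "integral {x..y} (\<lambda>_. 1 / (2 * ln y)) \<le> integral {x..y} li_density"
  proof (intro integral_le li_density_integrable)
    fix u assume u: "u \<in> {x..y}"
    then have "0 < ln u" "ln u \<le> ln y" "inverse u \<le> 1 / 2"
      using assms by (auto simp: field_simps)
    then have "1 / (2 * ln y) \<le> (1 / 2) / ln u" "(1 / 2) / ln u \<le> li_density u"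
      by (auto simp: field_simps intro!: divide_right_mono)
    then show "1 / (2 * ln y) \<le> li_density u" by linarith
  qed (use assms in auto)
  then show ?thesis using assms by (simp add: Li_diff)
qed

lemma continuous_on_Li: "continuous_on {1..} Li"
proof -
  have "1-lipschitz_on {1..} Li"
  proof (rule lipschitz_onI)
    fix x y :: real assume "x \<in> {1..}" "y \<in> {1..}"
    then show "dist (Li x) (Li y) \<le> 1 * dist x y"
      using Li_diff_le[of x y] Li_diff_le[of y x] Li_mono[of x y] Li_mono[of y x]
      by (cases "x \<le> y") (auto simp: dist_real_def)
  qed simp
  then show ?thesis by (rule lipschitz_on_continuous_on)
qed

text \<open>Concavity: the slopes of secants of ln from the point 1 decrease. In the variable t = ln
  u this is monotonicity of (exp t - 1) / t, on which the Riemann sums rest.\<close>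

lemma ln_secant_mono:
  assumes "1 \<le> u" "u \<le> (v :: real)"
  shows "(u - 1) / ln u \<le> (v - 1) / ln v"
proof (cases "u = 1")
  case False
  with assms have u: "1 < u" "1 < v" by auto
  define t where "t = (u - 1) / (v - 1)"
  have "t * (v - 1) = u - 1" using u by (simp add: t_def)
  then have "(1 - t) *\<^sub>R 1 + t *\<^sub>R v = u"
    by (simp add: algebra_simps)
  moreover have "0 \<le> t" "t \<le> 1"
    using assms u by (auto simp: t_def)
  ultimately have t: "0 \<le> t" "t \<le> 1" "(1 - t) *\<^sub>R 1 + t *\<^sub>R v = u"
    by simp_all
  have "(1 - t) * ln 1 + t * ln v \<le> ln u"
    using concave_onD[OF ln_concave t(1,2), of 1 v] u t(3) by simp
  then show ?thesis using u by (simp add: t_def field_simps)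
qed (use assms in auto)

text \<open>The integrand is the monotone function (u - 1) / ln u times 1 / u, and 1 / u integrates
  to ln (b / a).\<close>

lemma Li_step_bounds:
  assumes "1 \<le> a" "a \<le> (b :: real)"
  shows "(a - 1) / ln a * ln (b / a) \<le> Li b - Li a"
    and "Li b - Li a \<le> (b - 1) / ln b * ln (b / a)"
proof -
  let ?\<phi> = "\<lambda>u :: real. (u - 1) / ln u"
  have int: "((\<lambda>u. c * inverse u) has_integral c * ln (b / a)) {a..b}" for c :: real
  proof -
    have "((\<lambda>u. c * inverse u) has_integral (c * ln b - c * ln a)) {a..b}"
      by (rule fundamental_theorem_of_calculus)
        (use assms in \<open>auto intro!: derivative_eq_intros
          simp: has_real_derivative_iff_has_vector_derivative[symmetric] field_simps\<close>)
    then show ?thesis using assms by (simp add: ln_div right_diff_distrib)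
  qed
  have Li: "(li_density has_integral (Li b - Li a)) {a..b}"
    using li_density_integrable[OF assms(1)] Li_diff[OF assms] by (simp add: has_integral_iff)
  have eq: "li_density u = ?\<phi> u * inverse u" if "u \<ge> 1" for u
    using that by (simp add: field_simps)
  show "?\<phi> a * ln (b / a) \<le> Li b - Li a"
    by (rule has_integral_le[OF int Li])
      (use assms in \<open>auto simp: eq simp del: times_divide_eq_left intro!: mult_right_mono ln_secant_mono\<close>)
  show "Li b - Li a \<le> ?\<phi> b * ln (b / a)"
    by (rule has_integral_le[OF Li int])
      (use assms in \<open>auto simp: eq simp del: times_divide_eq_left intro!: mult_right_mono ln_secant_mono\<close>)
qed

text \<open>Upper and lower Riemann sums of the integrand \<open>(exp t - 1) / t\<close> in the variable
  \<open>t = ln u\<close>.\<close>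

lemma lattice_Li_approx:
  assumes "\<delta> > 0"
  shows "\<bar>(\<Sum>j=1..n. (exp (\<delta> * real j) - 1) / real j) - Li (exp (\<delta> * real n))\<bar> \<le> \<delta> * exp (\<delta> * real n)"
proof -
  define \<phi> where "\<phi> j = (exp (\<delta> * real j) - 1) / (\<delta> * real j)" for j :: nat
  let ?D = "\<lambda>n. (\<Sum>j=1..n. \<delta> * \<phi> j) - Li (exp (\<delta> * real n))"
  \<comment> \<open>By monotonicity the error of the upper sum telescopes and never exceeds its last
    term. HOL gives \<open>\<phi> 0 = 0\<close> instead of the limit 1; 0 is still a lower bound on
    the first cell, so the induction starts correctly.\<close>
  have "0 \<le> ?D n \<and> ?D n \<le> \<delta> * \<phi> n"
  proof (induction n)
    case 0
    then show ?case by (simp add: \<phi>_def)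
  next
    case (Suc n)
    have eq: "ln (exp (\<delta> * real (Suc n)) / exp (\<delta> * real n)) = \<delta>"
      by (simp flip: exp_diff add: algebra_simps)
    have "\<phi> n * \<delta> \<le> Li (exp (\<delta> * real (Suc n))) - Li (exp (\<delta> * real n))"
      "Li (exp (\<delta> * real (Suc n))) - Li (exp (\<delta> * real n)) \<le> \<phi> (Suc n) * \<delta>"
      using Li_step_bounds[of "exp (\<delta> * real n)" "exp (\<delta> * real (Suc n))"] assms
      unfolding eq by (simp_all add: \<phi>_def)
    then show ?case using Suc by (auto simp: algebra_simps)
  qed
  moreover have "\<phi> n \<le> exp (\<delta> * real n)"
  proof (cases "n = 0")
    case False
    have "1 - exp (- (\<delta> * real n)) \<le> \<delta> * real n"
      using exp_ge_add_one_self[of "- (\<delta> * real n)"] by simp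
    then have "exp (\<delta> * real n) * (1 - exp (- (\<delta> * real n))) \<le> exp (\<delta> * real n) * (\<delta> * real n)"
      by (intro mult_left_mono) auto
    then have "exp (\<delta> * real n) - 1 \<le> exp (\<delta> * real n) * (\<delta> * real n)"
      by (simp add: right_diff_distrib flip: exp_add)
    then show ?thesis using False assms by (simp add: \<phi>_def field_simps)
  qed (simp add: \<phi>_def)
  moreover have "(\<Sum>j=1..n. \<delta> * \<phi> j) = (\<Sum>j=1..n. (exp (\<delta> * real j) - 1) / real j)"
    using assms by (simp add: \<phi>_def)
  ultimately show ?thesis
    using assms by (smt (verit) mult_left_mono)
qed

section \<open>Discretized prime systems\<close>

text \<open>Serves to absorb powers of ln x into part of the decay. With z = (1 + t)^(\<alpha> / 2)
  the logarithm of the left side is at most A z - B z^2 once t > 1, and completing the square bounds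
  this by A^2 / (4 B).\<close>

lemma poly_exp_powr_bounded:
  fixes \<kappa> \<alpha> :: real
  assumes "\<kappa> > 0" "\<alpha> > 0" "m \<ge> 0"
  shows "\<exists>K>0. \<forall>t\<ge>0. (1 + t) powr m * exp (- \<kappa> * t powr \<alpha>) \<le> K"
proof -
  define A where "A = 2 * m / \<alpha>"
  define B where "B = \<kappa> * (1 / 2) powr \<alpha>"
  have B: "B > 0" using assms by (simp add: B_def)
  have A: "A \<ge> 0" using assms by (simp add: A_def)
  have "(1 + t) powr m * exp (- \<kappa> * t powr \<alpha>) \<le> 2 powr m + exp (A\<^sup>2 / (4 * B))" if t: "t \<ge> 0" for t
  proof (cases "t \<le> 1")
    case True
    have "(1 + t) powr m * exp (- \<kappa> * t powr \<alpha>) \<le> 2 powr m * 1"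
      using True t assms by (intro mult_mono powr_mono2) auto
    then show ?thesis by (smt (verit) exp_gt_zero)
  next
    case False
    define z where "z = (1 + t) powr (\<alpha> / 2)"
    have "ln (1 + t) \<le> z / (\<alpha> / 2)"
      unfolding z_def by (rule ln_powr_bound) (use t assms in auto)
    then have "m * ln (1 + t) \<le> m * (z / (\<alpha> / 2))"
      using assms(3) by (rule mult_left_mono)
    then have 1: "m * ln (1 + t) \<le> A * z"
      by (simp add: A_def field_simps)
    have "B * z\<^sup>2 = \<kappa> * ((1 / 2) powr \<alpha> * (1 + t) powr \<alpha>)"
      using t by (simp add: B_def z_def power2_eq_square flip: powr_add)
    also have "\<dots> = \<kappa> * ((1 / 2) * (1 + t)) powr \<alpha>"
      using t by (subst powr_mult) auto
    also have "\<dots> \<le> \<kappa> * t powr \<alpha>"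
      using False assms by (intro mult_left_mono powr_mono2) auto
    finally have 2: "B * z\<^sup>2 \<le> \<kappa> * t powr \<alpha>" .
    have "A\<^sup>2 / (4 * B) - (A * z - B * z\<^sup>2) = (A - 2 * B * z)\<^sup>2 / (4 * B)"
      using B by (simp add: field_simps power2_eq_square)
    also have "\<dots> \<ge> 0" using B by simp
    finally have 3: "A * z - B * z\<^sup>2 \<le> A\<^sup>2 / (4 * B)" by simp
    have "(1 + t) powr m * exp (- \<kappa> * t powr \<alpha>) = exp (m * ln (1 + t) - \<kappa> * t powr \<alpha>)"
      using t by (simp add: powr_def exp_diff exp_minus field_simps)
    also have "\<dots> \<le> exp (A\<^sup>2 / (4 * B))"
      using 1 2 3 by simp
    finally show ?thesis by (smt (verit) powr_ge_zero)
  qed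
  then show ?thesis by (intro exI[of _ "2 powr m + exp (A\<^sup>2 / (4 * B))"]) (auto intro: add_pos_pos)
qed

text \<open>Telescoping against 1 / (1 + \<delta> j); the summand \<delta> of the bound is the term
  j = 0.\<close>

lemma sum_inverse_square_lattice_le:
  fixes \<delta> :: real
  assumes "\<delta> > 0"
  shows "(\<Sum>j=m..<n. \<delta> / (1 + \<delta> * real j)\<^sup>2) \<le> \<delta> + 1"
proof -
  have *: "(\<Sum>j<Suc n. \<delta> / (1 + \<delta> * real j)\<^sup>2) \<le> \<delta> + 1 - 1 / (1 + \<delta> * real n)" for n
  proof (induction n)
    case (Suc n)
    let ?a = "1 + \<delta> * real n" and ?b = "1 + \<delta> * real (Suc n)"
    have ab: "0 < ?a" "?a \<le> ?b" "0 < ?b" "?b = ?a + \<delta>"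
      using assms by (auto intro: add_pos_nonneg simp: algebra_simps)
    have "\<delta> / ?b\<^sup>2 \<le> \<delta> / (?a * ?b)"
      unfolding power2_eq_square using ab(1-3) assms
      by (intro divide_left_mono mult_right_mono mult_pos_pos) simp_all
    also have "\<dots> = 1 / ?a - 1 / ?b"
    proof -
      have "1 / a - 1 / b = (b - a) / (a * b)" if "0 < a" "0 < b" for a b :: real
        using that by (simp add: field_simps)
      then show ?thesis using ab(1,3,4) by simp
    qed
    finally have "\<delta> / ?b\<^sup>2 \<le> 1 / ?a - 1 / ?b" .
    then show ?case using Suc by simp
  qed simp
  have "(\<Sum>j=m..<n. \<delta> / (1 + \<delta> * real j)\<^sup>2) \<le> (\<Sum>j<Suc n. \<delta> / (1 + \<delta> * real j)\<^sup>2)"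
    using assms by (intro sum_mono2) auto
  also have "\<dots> \<le> \<delta> + 1 - 1 / (1 + \<delta> * real n)" by (rule *)
  also have "\<dots> \<le> \<delta> + 1" using assms by (simp add: add_nonneg_nonneg)
  finally show ?thesis .
qed

lemma sum_by_parts_weighted:
  fixes w :: real and D :: "nat \<Rightarrow> real"
  assumes "m \<le> n"
  shows "(\<Sum>j\<in>{m<..n}. w ^ j * (D j - D (j - 1)))
    = w ^ n * D n - w ^ m * D m + (\<Sum>j=m..<n. (w ^ j - w ^ Suc j) * D j)"
  using assms
proof (induction n rule: dec_induct)
  case (step n)
  have "{m<..Suc n} = insert (Suc n) {m<..n}" using step by auto
  then show ?case using step by (simp add: algebra_simps)
qed simp

section \<open>Size of the reference series and of the proper prime powers\<close>

lemma lat_Li_nth_le: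
  assumes "\<delta> > 0"
  shows "lat_Li (exp (- \<delta>)) $ Suc n \<le> 2 * (ln (1 + \<delta> * real (Suc n)) - ln (1 + \<delta> * real n))"
proof -
  let ?a = "1 + \<delta> * real n" and ?b = "1 + \<delta> * real (Suc n)"
  define x where "x = \<delta> * real (Suc n)"
  have x: "x > 0" using assms by (simp add: x_def)
  have ab: "0 < ?a" "?a \<le> ?b" using assms by (auto intro: add_pos_nonneg simp: algebra_simps)
  \<comment> \<open>The bounds x and 1 combine to 2 x / (1 + x), which is a good estimate for small
    and large x and telescopes into logarithms.\<close>
  have e: "1 - exp (- x) \<le> x" "1 - exp (- x) \<le> 1"
    using exp_ge_add_one_self[of "- x"] by simp_all
  have "(1 - exp (- x)) * (1 + x) = (1 - exp (- x)) + (1 - exp (- x)) * x"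
    by (simp add: algebra_simps)
  also have "\<dots> \<le> x + 1 * x"
    using e x by (intro add_mono mult_right_mono) auto
  finally have "1 - exp (- x) \<le> 2 * x / (1 + x)"
    using x by (simp add: field_simps)
  then have "(1 - exp (- x)) / real (Suc n) \<le> 2 * x / (1 + x) / real (Suc n)"
    by (rule divide_right_mono) simp
  also have "\<dots> = 2 * (\<delta> / ?b)"
    by (simp add: x_def)
  also have "\<delta> / ?b = 1 - inverse (?b / ?a)"
    using ab by (simp add: field_simps)
  also have "\<dots> \<le> ln (?b / ?a)"
    using ab by (intro one_minus_inverse_le_ln) simp
  also have "\<dots> = ln ?b - ln ?a"
    using ab by (simp add: ln_div)
  finally show ?thesis
    by (simp add: lat_Li_nth x_def exp_of_nat_mult[symmetric] mult.commute del: of_nat_Suc power_Suc)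
qed

text \<open>The reference mass grows logarithmically in the height \<delta> n, uniformly in
  \<delta>; this is the source of the O(ln ln x) for the total variation.\<close>

lemma sum_lat_Li_le:
  assumes "\<delta> > 0"
  shows "(\<Sum>j\<le>n. lat_Li (exp (- \<delta>)) $ j) \<le> 2 * ln (1 + \<delta> * real n)"
proof (induction n)
  case (Suc n)
  then show ?case using lat_Li_nth_le[OF assms, of n] by simp
qed (simp add: lat_Li_nth)

lemma lat_Li_nonneg:
  assumes "\<delta> > 0"
  shows "lat_Li (exp (- \<delta>)) $ j \<ge> 0"
proof -
  have "exp (- \<delta>) ^ j \<le> 1" using assms by (intro power_le_one) auto
  then show ?thesis by (simp add: lat_Li_nth)
qed

text \<open>The terms k \<ge> 2 at j = k l: the proper prime powers.\<close>

definition log_series_rest :: "real \<Rightarrow> nat \<Rightarrow> nat \<Rightarrow> real" where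
  "log_series_rest w l j = (if l dvd j \<and> l < j then real l / real j * w ^ j else 0)"

lemma log_series_rest_nonneg: "w \<ge> 0 \<Longrightarrow> log_series_rest w l j \<ge> 0"
  by (simp add: log_series_rest_def)

lemma log_series_split:
  assumes "l > 0"
  shows "log_series w l $ j = (if j = l then w ^ j else 0) + log_series_rest w l j"
proof (cases "l dvd j \<and> j > 0")
  case True
  then have "l \<le> j" by (simp add: dvd_imp_le)
  then show ?thesis using assms True by (simp add: log_series_def log_series_rest_def)
qed (use assms in \<open>auto simp: log_series_def log_series_rest_def\<close>)

text \<open>With u = (w v)^l the sum is dominated by u^2 + u^3 + ...; the separate bound
  \<open>r0\<close> allows one denominator for all primes.\<close>

lemma sum_log_series_rest_le:
  assumes l: "l > 0" and wv: "w \<ge> 0" "v \<ge> 0" "(w * v) ^ l \<le> r" "r \<le> r0" "r0 < 1"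
  shows "(\<Sum>j\<le>n. log_series_rest w l j * v ^ j) \<le> r\<^sup>2 / (1 - r0)"
proof -
  define u where "u = (w * v) ^ l"
  have u: "0 \<le> u" "u \<le> r" "u < 1" using wv by (auto simp: u_def)
  let ?f = "\<lambda>j. log_series_rest w l j * v ^ j"
  have "(\<Sum>j\<le>n. ?f j) \<le> (\<Sum>j\<in>(\<lambda>k. k * l) ` {2..n}. ?f j)"
  proof -
    have "(\<Sum>j\<le>n. ?f j) = (\<Sum>j\<in>{j. j \<le> n \<and> l dvd j \<and> l < j}. ?f j)"
      by (intro sum.mono_neutral_right) (auto simp: log_series_rest_def)
    also have "\<dots> \<le> (\<Sum>j\<in>(\<lambda>k. k * l) ` {2..n}. ?f j)"
    proof (rule sum_mono2)
      show "{j. j \<le> n \<and> l dvd j \<and> l < j} \<subseteq> (\<lambda>k. k * l) ` {2..n}"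
      proof
        fix j assume j: "j \<in> {j. j \<le> n \<and> l dvd j \<and> l < j}"
        then obtain k where k: "j = k * l" by (auto elim: dvdE simp: mult.commute)
        have "2 \<le> k" using j k l by (cases k; cases "k - 1") auto
        moreover have "k \<le> n"
        proof (rule order.trans)
          show "k \<le> k * l" using l by simp
        qed (use j k in simp)
        ultimately show "j \<in> (\<lambda>k. k * l) ` {2..n}" using k by (intro image_eqI[of _ _ k]) simp_all
      qed
    qed (use wv in \<open>auto intro!: mult_nonneg_nonneg log_series_rest_nonneg\<close>)
    finally show ?thesis .
  qed
  also have "\<dots> = (\<Sum>k=2..n. ?f (k * l))"
    using l by (subst sum.reindex) (auto simp: inj_on_def)
  also have "\<dots> \<le> (\<Sum>k=2..n. u ^ k)"
  proof (intro sum_mono)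
    fix k assume k: "k \<in> {2..n}"
    have eq: "w ^ (k * l) * v ^ (k * l) = u ^ k"
      by (simp add: u_def power_mult_distrib power_mult[symmetric] mult.commute)
    have "?f (k * l) = (real l / real (k * l)) * u ^ k"
      using k l eq by (simp add: log_series_rest_def)
    also have "\<dots> \<le> 1 * u ^ k"
      using k l u by (intro mult_right_mono) (auto simp: field_simps)
    finally show "?f (k * l) \<le> u ^ k" by simp
  qed
  also have "\<dots> \<le> u\<^sup>2 / (1 - u)"
  proof -
    have "(1 - u) * (\<Sum>k=2..n. u ^ k) \<le> u\<^sup>2"
    proof (cases "2 \<le> n")
      case True
      have "(1 - u) * (\<Sum>k=2..n. u ^ k) = u\<^sup>2 - u ^ Suc n"
        using sum_gp_multiplied[OF True, of u] by simp
      then show ?thesis using u by simp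
    qed (use u in simp)
    then show ?thesis using u by (simp add: field_simps)
  qed
  also have "\<dots> \<le> r\<^sup>2 / (1 - r0)"
    using u wv by (intro frac_le power_mono) auto
  finally show ?thesis .
qed

text \<open>The condition on the primes in the variable t = ln x, with one constant for all t \<ge>
  0, so that later estimates have no exceptional range.\<close>

locale malliavin =
  fixes p :: "nat \<Rightarrow> real" and C c \<alpha> :: real
  assumes beurling: "beurling_system p"
    and params: "C > 0" "c > 0" "0 < \<alpha>" "\<alpha> \<le> 1"
    and prime_err: "\<And>t. t \<ge> 0 \<Longrightarrow>
      \<bar>real (prime_count p (exp t)) - Li (exp t)\<bar> \<le> C * exp (t - c * t powr \<alpha>)"
begin

lemma prime_count_le:
  assumes "x \<ge> 1"
  shows "real (prime_count p x) \<le> (1 + C) * x"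
proof -
  have "real (prime_count p x) \<le> Li x + C * exp (ln x - c * ln x powr \<alpha>)"
    using prime_err[of "ln x"] assms by simp
  also have "Li x \<le> x" using Li_diff_le[of 1 x] assms by simp
  also have "C * exp (ln x - c * ln x powr \<alpha>) \<le> C * exp (ln x)"
    using params by (intro mult_left_mono) auto
  finally show ?thesis using assms by (simp add: algebra_simps)
qed

text \<open>By monotonicity at least i + 1 primes are \<le> \<open>p i\<close>, while the counting
  function is at most linear. This makes the sum of p^(- 3 / 2) converge.\<close>

lemma prime_ge: "real (Suc i) / (1 + C) \<le> p i"
proof -
  have "{..i} \<subseteq> {j. p j \<le> p i}"
    using beurling by (auto simp: beurling_system_def intro: monoD)
  then have "card {..i} \<le> prime_count p (p i)"
    unfolding prime_count_def by (intro card_mono finite_primes_le beurling)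
  then have "real (Suc i) \<le> (1 + C) * p i"
    using prime_count_le[of "p i"] prime_gt_1[OF beurling, of i] by simp
  then show ?thesis using params by (simp add: field_simps)
qed

lemma summable_prime_powr: "summable (\<lambda>i. p i powr (- 3 / 2))"
proof (rule summable_comparison_test')
  have "summable (\<lambda>n. real n powr (- 3 / 2))"
    by (subst summable_real_powr_iff) simp
  then have "summable (\<lambda>i. real (Suc i) powr (- 3 / 2))"
    by (subst summable_Suc_iff)
  then show "summable (\<lambda>i. (1 / (1 + C)) powr (- 3 / 2) * real (Suc i) powr (- 3 / 2))"
    by (rule summable_mult)
next
  fix i :: nat
  have "p i powr (- 3 / 2) \<le> (real (Suc i) / (1 + C)) powr (- 3 / 2)"
    using prime_ge[of i] params by (intro powr_mono2') auto
  also have "\<dots> = (1 / (1 + C)) powr (- 3 / 2) * real (Suc i) powr (- 3 / 2)"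
    using params by (subst powr_mult[symmetric]) auto
  finally show "norm (p i powr (- 3 / 2)) \<le> (1 / (1 + C)) powr (- 3 / 2) * real (Suc i) powr (- 3 / 2)"
    by simp
qed

definition lat :: "real \<Rightarrow> nat \<Rightarrow> nat" where
  "lat \<delta> i = nat \<lceil>ln (p i) / \<delta>\<rceil>"

text \<open>The cutoff at \<open>exp Y\<close> makes the sum finite and does not affect coefficients
  at positions j with \<delta> j \<le> Y.\<close>

definition diff_series :: "real \<Rightarrow> real \<Rightarrow> real fps" where
  "diff_series \<delta> Y = (\<Sum>i | p i \<le> exp Y. log_series (exp (- \<delta>)) (lat \<delta> i)) - lat_Li (exp (- \<delta>))"

definition fine_mesh :: "real \<Rightarrow> real \<Rightarrow> bool" where
  "fine_mesh \<delta> Y \<longleftrightarrow> 0 < \<delta> \<and> \<delta> \<le> 1 / 2 \<and> \<delta> \<le> C * exp (- c * Y powr \<alpha>)"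

text \<open>Rounding up gives an exact equivalence: at lattice points the rounded primes are counted
  like the original ones, and only \<open>Li\<close> carries a discretization error.\<close>

lemma lat_le_iff:
  assumes "\<delta> > 0"
  shows "lat \<delta> i \<le> n \<longleftrightarrow> p i \<le> exp (\<delta> * real n)"
proof -
  have "lat \<delta> i \<le> n \<longleftrightarrow> ln (p i) \<le> \<delta> * real n"
    using assms by (simp add: lat_def nat_le_iff ceiling_le_iff field_simps)
  also have "\<dots> \<longleftrightarrow> p i \<le> exp (\<delta> * real n)"
    using prime_gt_1[OF beurling, of i] ln_ge_iff[of "p i"] by (metis exp_le_cancel_iff exp_ln less_trans zero_less_one)
  finally show ?thesis .
qed

lemma lat_pos: "\<delta> > 0 \<Longrightarrow> lat \<delta> i > 0"
  using prime_gt_1[OF beurling, of i] by (simp add: lat_def)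

lemma ln_le_lat:
  assumes "\<delta> > 0"
  shows "ln (p i) \<le> \<delta> * real (lat \<delta> i)"
proof -
  have "p i \<le> exp (\<delta> * real (lat \<delta> i))" using lat_le_iff[OF assms] by blast
  then have "ln (p i) \<le> ln (exp (\<delta> * real (lat \<delta> i)))"
    using prime_gt_1[OF beurling, of i] by (subst ln_le_cancel_iff) auto
  then show ?thesis by simp
qed

lemma finite_primes [simp]: "finite {i. p i \<le> x}"
  by (rule finite_primes_le[OF beurling])

lemma diff_series_nth_0 [simp]: "diff_series \<delta> Y $ 0 = 0"
  by (simp add: diff_series_def fps_sum_nth lat_Li_nth)

section \<open>Coefficients of the difference series and their sums\<close>

definition count_diff :: "real \<Rightarrow> nat \<Rightarrow> real" where
  "count_diff \<delta> n = real (prime_count p (exp (\<delta> * real n))) - (\<Sum>j=1..n. (exp (\<delta> * real j) - 1) / real j)"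

definition power_part :: "real \<Rightarrow> real \<Rightarrow> nat \<Rightarrow> real" where
  "power_part \<delta> Y j = (\<Sum>i | p i \<le> exp Y. log_series_rest (exp (- \<delta>)) (lat \<delta> i) j)"

lemma power_part_nonneg: "power_part \<delta> Y j \<ge> 0"
  by (simp add: power_part_def sum_nonneg log_series_rest_nonneg)

text \<open>Position j receives primes rounded to j, whose number is an increment of the prime
  count, and proper prime powers. The second claim holds because that number is nonnegative; it
  later turns bounds for signed sums into bounds for absolute ones.\<close>

lemma diff_series_nth:
  assumes "\<delta> > 0" "\<delta> * real j \<le> Y" "j > 0"
  shows "diff_series \<delta> Y $ j = exp (- \<delta>) ^ j * (count_diff \<delta> j - count_diff \<delta> (j - 1)) + power_part \<delta> Y j"
    and "0 \<le> exp (- \<delta>) ^ j * (count_diff \<delta> j - count_diff \<delta> (j - 1)) + lat_Li (exp (- \<delta>)) $ j"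
proof -
  let ?w = "exp (- \<delta>)"
  let ?c = "real (card {i. lat \<delta> i = j})"
  have sub: "{i. lat \<delta> i = j} \<subseteq> {i. p i \<le> exp Y}"
  proof safe
    fix i assume "j = lat \<delta> i"
    then have "p i \<le> exp (\<delta> * real j)" by (simp flip: lat_le_iff[OF assms(1)])
    also have "\<dots> \<le> exp Y" using assms by simp
    finally show "p i \<le> exp Y" .
  qed
  have "(\<Sum>i | p i \<le> exp Y. log_series ?w (lat \<delta> i) $ j)
      = (\<Sum>i | p i \<le> exp Y. if lat \<delta> i = j then ?w ^ j else 0) + power_part \<delta> Y j"
    unfolding power_part_def sum.distrib[symmetric]
    by (intro sum.cong refl) (subst log_series_split, auto simp: lat_pos assms)
  also have "(\<Sum>i | p i \<le> exp Y. if lat \<delta> i = j then ?w ^ j else 0) = (\<Sum>i | lat \<delta> i = j. ?w ^ j)"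
    by (rule sum.mono_neutral_cong_right) (use sub in auto)
  finally have 1: "(\<Sum>i | p i \<le> exp Y. log_series ?w (lat \<delta> i) $ j) = ?c * ?w ^ j + power_part \<delta> Y j"
    by simp
  have "{i. lat \<delta> i \<le> j} = {i. lat \<delta> i \<le> j - 1} \<union> {i. lat \<delta> i = j}"
    using assms(3) by auto
  moreover have "finite {i. lat \<delta> i \<le> j - 1}" "finite {i. lat \<delta> i = j}"
    using sub by (auto simp: lat_le_iff[OF assms(1)] intro: finite_subset[OF _ finite_primes])
  ultimately have "card {i. lat \<delta> i \<le> j} = card {i. lat \<delta> i \<le> j - 1} + card {i. lat \<delta> i = j}"
    using assms(3) by (subst card_Un_disjoint[symmetric]) auto
  then have c: "real (prime_count p (exp (\<delta> * real j))) - real (prime_count p (exp (\<delta> * real (j - 1)))) = ?c"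
    unfolding prime_count_def lat_le_iff[OF assms(1), symmetric] by simp
  have "count_diff \<delta> j - count_diff \<delta> (j - 1) = ?c - (exp (\<delta> * real j) - 1) / real j"
    using c assms(3) by (cases j) (simp_all add: count_diff_def)
  moreover have "?w ^ j * ((exp (\<delta> * real j) - 1) / real j) = lat_Li ?w $ j"
    using assms(3) by (simp add: lat_Li_nth right_diff_distrib mult.commute flip: exp_of_nat_mult exp_add)
  ultimately have D: "?w ^ j * (count_diff \<delta> j - count_diff \<delta> (j - 1)) = ?c * ?w ^ j - lat_Li ?w $ j"
    by (simp only: right_diff_distrib mult.commute)
  show "diff_series \<delta> Y $ j = ?w ^ j * (count_diff \<delta> j - count_diff \<delta> (j - 1)) + power_part \<delta> Y j"
    using 1 D by (simp add: diff_series_def fps_sum_nth)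
  show "0 \<le> ?w ^ j * (count_diff \<delta> j - count_diff \<delta> (j - 1)) + lat_Li ?w $ j"
    unfolding D by simp
qed

text \<open>The prime error and, by \<open>fine_mesh\<close>, the discretization error of
  \<open>Li\<close> contribute C exp (t - c t^\<alpha>) each; hence the 2.\<close>

lemma count_diff_bound:
  assumes "fine_mesh \<delta> Y" "\<delta> * real n \<le> Y"
  shows "exp (- \<delta>) ^ n * \<bar>count_diff \<delta> n\<bar> \<le> 2 * C * exp (- c * (\<delta> * real n) powr \<alpha>)"
proof -
  let ?t = "\<delta> * real n"
  have \<delta>: "\<delta> > 0" "\<delta> \<le> C * exp (- c * Y powr \<alpha>)" using assms by (auto simp: fine_mesh_def)
  have t: "?t \<ge> 0" using \<delta> by simp
  have "\<delta> \<le> C * exp (- c * ?t powr \<alpha>)"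
  proof -
    have "C * exp (- c * Y powr \<alpha>) \<le> C * exp (- c * ?t powr \<alpha>)"
      using params t assms(2) by (auto intro!: mult_left_mono powr_mono2)
    then show ?thesis using \<delta> by simp
  qed
  then have "\<delta> * exp ?t \<le> (C * exp (- c * ?t powr \<alpha>)) * exp ?t"
    by (rule mult_right_mono) simp
  then have 1: "\<delta> * exp ?t \<le> C * exp (?t - c * ?t powr \<alpha>)"
    by (simp add: exp_diff exp_minus field_simps)
  have "\<bar>count_diff \<delta> n\<bar> \<le> 2 * C * exp (?t - c * ?t powr \<alpha>)"
    using prime_err[OF t] lattice_Li_approx[OF \<delta>(1), of n] 1 unfolding count_diff_def by linarith
  then have "exp (- ?t) * \<bar>count_diff \<delta> n\<bar> \<le> exp (- ?t) * (2 * C * exp (?t - c * ?t powr \<alpha>))"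
    by (rule mult_left_mono) simp
  also have "\<dots> = 2 * C * exp (- c * ?t powr \<alpha>)"
    by (simp add: exp_diff exp_minus field_simps)
  also have "exp (- ?t) = exp (- \<delta>) ^ n"
    by (simp add: exp_of_nat_mult[symmetric] mult.commute)
  finally show ?thesis .
qed

text \<open>Abel summation with the decay split in halves: one half is evaluated at the lower end m
  and taken out, the other pays for K / (1 + t)^2, whose lattice sum is bounded uniformly.\<close>

lemma sum_count_diff_bound:
  "\<exists>A>0. \<forall>\<delta> Y m n. fine_mesh \<delta> Y \<longrightarrow> m \<le> n \<longrightarrow> \<delta> * real n \<le> Y \<longrightarrow>
     \<bar>\<Sum>j\<in>{m<..n}. exp (- \<delta>) ^ j * (count_diff \<delta> j - count_diff \<delta> (j - 1))\<bar> \<le> A * exp (- (c / 2) * (\<delta> * real m) powr \<alpha>)"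
proof -
  obtain K where K: "K > 0" "\<And>t. t \<ge> 0 \<Longrightarrow> (1 + t) powr 2 * exp (- (c / 2) * t powr \<alpha>) \<le> K"
    using poly_exp_powr_bounded[of "c / 2" \<alpha> 2] params by auto
  show ?thesis
  proof (intro exI[of _ "4 * C + 4 * C * K"] conjI allI impI)
    show "4 * C + 4 * C * K > 0" using params K by (simp add: add_pos_pos)
    fix \<delta> Y and m n :: nat
    assume fine_mesh: "fine_mesh \<delta> Y" and mn: "m \<le> n" and n: "\<delta> * real n \<le> Y"
    have \<delta>: "0 < \<delta>" "\<delta> \<le> 1 / 2" using fine_mesh by (auto simp: fine_mesh_def)
    let ?w = "exp (- \<delta>)" and ?t = "\<lambda>j. \<delta> * real j"
    let ?E = "exp (- (c / 2) * ?t m powr \<alpha>)"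
    have mono: "exp (- (c / 2) * ?t j powr \<alpha>) \<le> ?E" if "m \<le> j" for j
      using that \<delta> params by (auto intro!: powr_mono2 mult_left_mono)
    have D: "?w ^ j * \<bar>count_diff \<delta> j\<bar> \<le> 2 * C * (?E * exp (- (c / 2) * ?t j powr \<alpha>))" if "m \<le> j" "j \<le> n" for j
    proof -
      have "?t j \<le> Y" using n that(2) \<delta> by (smt (verit) mult_left_mono of_nat_mono)
      then have "?w ^ j * \<bar>count_diff \<delta> j\<bar> \<le> 2 * C * exp (- c * ?t j powr \<alpha>)"
        by (rule count_diff_bound[OF fine_mesh])
      also have "exp (- c * ?t j powr \<alpha>) = exp (- (c / 2) * ?t j powr \<alpha>) * exp (- (c / 2) * ?t j powr \<alpha>)"
        by (simp flip: exp_add add: field_simps)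
      also have "2 * C * \<dots> \<le> 2 * C * (?E * exp (- (c / 2) * ?t j powr \<alpha>))"
        using mono[OF that(1)] params by (intro mult_left_mono mult_right_mono) auto
      finally show ?thesis .
    qed
    have D': "?w ^ j * \<bar>count_diff \<delta> j\<bar> \<le> 2 * C * ?E" if "m \<le> j" "j \<le> n" for j
    proof -
      have "?E * exp (- (c / 2) * ?t j powr \<alpha>) \<le> ?E * 1"
        using params by (intro mult_left_mono) auto
      then have "2 * C * (?E * exp (- (c / 2) * ?t j powr \<alpha>)) \<le> 2 * C * ?E"
        using params by (intro mult_left_mono) auto
      then show ?thesis using D[OF that] by linarith
    qed
    have S: "\<bar>\<Sum>j=m..<n. (?w ^ j - ?w ^ Suc j) * count_diff \<delta> j\<bar> \<le> 4 * C * K * ?E"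
    proof -
      have "\<bar>\<Sum>j=m..<n. (?w ^ j - ?w ^ Suc j) * count_diff \<delta> j\<bar> \<le> (\<Sum>j=m..<n. 2 * C * ?E * K * (\<delta> / (1 + ?t j)\<^sup>2))"
      proof (rule order.trans[OF sum_abs], intro sum_mono)
        fix j assume j: "j \<in> {m..<n}"
        have w: "0 \<le> 1 - ?w" "1 - ?w \<le> \<delta>"
          using \<delta> exp_ge_add_one_self[of "- \<delta>"] by auto
        have tj: "?t j \<ge> 0" using \<delta> by simp
        have "exp (- (c / 2) * ?t j powr \<alpha>) \<le> K / (1 + ?t j)\<^sup>2"
          using K(2)[OF tj] tj by (simp add: field_simps powr_numeral)
        then have "2 * C * (?E * exp (- (c / 2) * ?t j powr \<alpha>)) \<le> 2 * C * (?E * (K / (1 + ?t j)\<^sup>2))"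
          using params by (intro mult_left_mono) auto
        then have *: "?w ^ j * \<bar>count_diff \<delta> j\<bar> \<le> 2 * C * (?E * (K / (1 + ?t j)\<^sup>2))"
          using D[of j] j by force
        have "\<bar>(?w ^ j - ?w ^ Suc j) * count_diff \<delta> j\<bar> = (1 - ?w) * (?w ^ j * \<bar>count_diff \<delta> j\<bar>)"
        proof -
          have "?w ^ j - ?w ^ Suc j = (1 - ?w) * ?w ^ j" by (simp add: algebra_simps)
          then show ?thesis using w by (simp add: abs_mult)
        qed
        also have "\<dots> \<le> \<delta> * (2 * C * (?E * (K / (1 + ?t j)\<^sup>2)))"
          by (rule mult_mono[OF w(2) *]) (use \<delta> in auto)
        finally show "\<bar>(?w ^ j - ?w ^ Suc j) * count_diff \<delta> j\<bar> \<le> 2 * C * ?E * K * (\<delta> / (1 + ?t j)\<^sup>2)"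
          by (simp add: mult_ac)
      qed
      also have "\<dots> = 2 * C * ?E * K * (\<Sum>j=m..<n. \<delta> / (1 + ?t j)\<^sup>2)"
        by (simp add: sum_distrib_left)
      also have "\<dots> \<le> 2 * C * ?E * K * 2"
        using sum_inverse_square_lattice_le[OF \<delta>(1), of m n] \<delta>(2) params K
        by (intro mult_left_mono) auto
      finally show ?thesis by (simp add: mult_ac)
    qed
    have "\<bar>?w ^ n * count_diff \<delta> n\<bar> \<le> 2 * C * ?E" "\<bar>?w ^ m * count_diff \<delta> m\<bar> \<le> 2 * C * ?E"
      using D'[of n] D'[of m] mn by (auto simp: abs_mult)
    then have "\<bar>\<Sum>j\<in>{m<..n}. ?w ^ j * (count_diff \<delta> j - count_diff \<delta> (j - 1))\<bar> \<le> 4 * C * ?E + 4 * C * K * ?E"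
      unfolding sum_by_parts_weighted[OF mn] using S by linarith
    then show "\<bar>\<Sum>j\<in>{m<..n}. ?w ^ j * (count_diff \<delta> j - count_diff \<delta> (j - 1))\<bar> \<le> (4 * C + 4 * C * K) * ?E"
      by (simp add: distrib_right)
  qed
qed

text \<open>Rankin's trick with weight exp (\<delta> / 4): each prime contributes at most a constant
  times the square of p^(- 3 / 4), and p^(- 3 / 2) is summable. The weight gives back exp (- t / 4)
  at height t = \<delta> m.\<close>

lemma sum_power_part_bound:
  "\<exists>B>0. \<forall>\<delta> Y m n. \<delta> > 0 \<longrightarrow> (\<Sum>j\<in>{m<..n}. power_part \<delta> Y j) \<le> B * exp (- (\<delta> * real m) / 4)"
proof -
  define r where "r i = p i powr (- 3 / 4)" for i
  define B where "B = (\<Sum>i. p i powr (- 3 / 2)) / (1 - r 0)"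
  have r01: "r 0 < 1"
    using prime_gt_1[OF beurling, of 0] by (simp add: r_def powr_less_one)
  have r_le: "r i \<le> r 0" for i
  proof -
    have "p 0 \<le> p i" using beurling by (simp add: beurling_system_def monoD)
    then show ?thesis
      unfolding r_def using prime_gt_1[OF beurling, of 0] by (intro powr_mono2') auto
  qed
  have r2: "(r i)\<^sup>2 = p i powr (- 3 / 2)" for i
    by (simp add: r_def power2_eq_square flip: powr_add)
  have pp: "p i > 0" for i using prime_gt_1[OF beurling, of i] by simp
  have B: "B > 0"
    using r01 summable_prime_powr pp
    unfolding B_def by (intro divide_pos_pos suminf_pos) (simp_all add: less_imp_neq[symmetric])
  show ?thesis
  proof (intro exI[of _ B] conjI allI impI B)
    fix \<delta> Y :: real and m n :: nat
    assume \<delta>: "\<delta> > 0"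
    let ?w = "exp (- \<delta>)" and ?v = "exp (\<delta> / 4)"
    have "(\<Sum>j\<le>n. power_part \<delta> Y j * ?v ^ j)
        = (\<Sum>i | p i \<le> exp Y. \<Sum>j\<le>n. log_series_rest ?w (lat \<delta> i) j * ?v ^ j)"
      unfolding power_part_def sum_distrib_right by (rule sum.swap)
    also have "\<dots> \<le> (\<Sum>i | p i \<le> exp Y. (r i)\<^sup>2 / (1 - r 0))"
    proof (intro sum_mono sum_log_series_rest_le lat_pos \<delta> r_le r01)
      fix i
      have "(?w * ?v) ^ lat \<delta> i = exp (- (3 / 4) * (\<delta> * real (lat \<delta> i)))"
        by (simp add: exp_of_nat_mult[symmetric] field_simps flip: exp_add)
      also have "\<dots> \<le> exp (- (3 / 4) * ln (p i))"
        using ln_le_lat[OF \<delta>, of i] by simp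
      also have "\<dots> = r i"
        using pp[of i] by (simp add: r_def powr_def)
      finally show "(?w * ?v) ^ lat \<delta> i \<le> r i" .
    qed auto
    also have "\<dots> = (\<Sum>i | p i \<le> exp Y. p i powr (- 3 / 2)) / (1 - r 0)"
      by (simp add: r2 sum_divide_distrib)
    also have "\<dots> \<le> B"
      unfolding B_def using r01 summable_prime_powr
      by (intro divide_right_mono sum_le_suminf) auto
    finally have 1: "(\<Sum>j\<le>n. power_part \<delta> Y j * ?v ^ j) \<le> B" .
    have "(\<Sum>j\<in>{m<..n}. power_part \<delta> Y j) * ?v ^ m \<le> (\<Sum>j\<in>{m<..n}. power_part \<delta> Y j * ?v ^ j)"
      unfolding sum_distrib_right using \<delta>
      by (intro sum_mono mult_left_mono power_increasing power_part_nonneg) auto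
    also have "\<dots> \<le> (\<Sum>j\<le>n. power_part \<delta> Y j * ?v ^ j)"
      by (intro sum_mono2) (auto intro!: mult_nonneg_nonneg power_part_nonneg)
    finally have "(\<Sum>j\<in>{m<..n}. power_part \<delta> Y j) * ?v ^ m \<le> B" using 1 by simp
    moreover have "?v ^ m = exp (\<delta> * real m / 4)"
      by (simp add: exp_of_nat_mult[symmetric] mult.commute)
    ultimately show "(\<Sum>j\<in>{m<..n}. power_part \<delta> Y j) \<le> B * exp (- (\<delta> * real m) / 4)"
      by (simp add: exp_minus field_simps)
  qed
qed

text \<open>For the total variation: increment plus reference term is nonnegative, so a coefficient
  is in absolute value at most twice the reference term plus the increment plus the power part. The
  increments still sum to O(1) as signed numbers; only the reference mass grows.\<close>

lemma diff_series_bounds: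
  "\<exists>A>0. \<exists>a>0. \<forall>\<delta> Y m n. fine_mesh \<delta> Y \<longrightarrow> m \<le> n \<longrightarrow> \<delta> * real n \<le> Y \<longrightarrow>
     \<bar>psum n (diff_series \<delta> Y) - psum m (diff_series \<delta> Y)\<bar> \<le> A * exp (- a * (\<delta> * real m) powr \<alpha>) \<and>
     wsum 1 n (diff_series \<delta> Y) \<le> A + 4 * ln (1 + \<delta> * real n)"
proof -
  obtain A where A: "A > 0" "\<And>\<delta> Y m n. fine_mesh \<delta> Y \<Longrightarrow> m \<le> n \<Longrightarrow> \<delta> * real n \<le> Y \<Longrightarrow>
     \<bar>\<Sum>j\<in>{m<..n}. exp (- \<delta>) ^ j * (count_diff \<delta> j - count_diff \<delta> (j - 1))\<bar> \<le> A * exp (- (c / 2) * (\<delta> * real m) powr \<alpha>)"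
    using sum_count_diff_bound by blast
  obtain B where B: "B > 0" "\<And>\<delta> Y m n. \<delta> > 0 \<Longrightarrow> (\<Sum>j\<in>{m<..n}. power_part \<delta> Y j) \<le> B * exp (- (\<delta> * real m) / 4)"
    using sum_power_part_bound by blast
  \<comment> \<open>The 1 / 4 is for the prime powers: t^\<alpha> \<le> 1 + t gives exp (- t / 4)
    \<le> exp (1 - a t^\<alpha>), whence the factor \<open>exp 1\<close> in
    \<open>A'\<close>.\<close>
  define a where "a = min (c / 2) (1 / 4)"
  define A' where "A' = A + B * exp 1"
  have pos: "A' > 0" "a > 0" using A(1) B(1) params by (simp_all add: A'_def a_def add_pos_pos)
  have "\<bar>psum n (diff_series \<delta> Y) - psum m (diff_series \<delta> Y)\<bar> \<le> A' * exp (- a * (\<delta> * real m) powr \<alpha>) \<and>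
      wsum 1 n (diff_series \<delta> Y) \<le> A' + 4 * ln (1 + \<delta> * real n)"
    if fine_mesh: "fine_mesh \<delta> Y" and mn: "m \<le> n" and n: "\<delta> * real n \<le> Y" for \<delta> Y m n
  proof
    have \<delta>: "0 < \<delta>" using fine_mesh by (auto simp: fine_mesh_def)
    let ?w = "exp (- \<delta>)"
    let ?a = "\<lambda>j. ?w ^ j * (count_diff \<delta> j - count_diff \<delta> (j - 1))"
    have jY: "\<delta> * real j \<le> Y" if "j \<le> n" for j
      using n that \<delta> by (smt (verit) mult_left_mono of_nat_mono)
    have diff_series: "diff_series \<delta> Y $ j = ?a j + power_part \<delta> Y j" if "j \<in> {k<..n}" for j k
      using diff_series_nth(1)[OF \<delta> jY] that by auto
    have un: "{..n} = {..k} \<union> {k<..n}" if "k \<le> n" for k using that by auto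
    have "psum n (diff_series \<delta> Y) - psum m (diff_series \<delta> Y) = (\<Sum>j\<in>{m<..n}. diff_series \<delta> Y $ j)"
      unfolding psum_def un[OF mn] by (subst sum.union_disjoint) auto
    also have "\<dots> = (\<Sum>j\<in>{m<..n}. ?a j) + (\<Sum>j\<in>{m<..n}. power_part \<delta> Y j)"
      by (simp add: diff_series[of _ m] sum.distrib)
    finally have 1: "psum n (diff_series \<delta> Y) - psum m (diff_series \<delta> Y) = (\<Sum>j\<in>{m<..n}. ?a j) + (\<Sum>j\<in>{m<..n}. power_part \<delta> Y j)" .
    let ?t = "\<delta> * real m"
    have t: "?t \<ge> 0" using \<delta> by simp
    have "?t powr \<alpha> \<le> 1 + ?t"
    proof (cases "?t \<le> 1")
      case True
      then have "?t powr \<alpha> \<le> 1" using t params by (simp add: powr_le1)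
      then show ?thesis using t by simp
    next
      case False
      then have "?t powr \<alpha> \<le> ?t powr 1" using params by (intro powr_mono) auto
      then show ?thesis using False by simp
    qed
    then have "a * ?t powr \<alpha> \<le> (1 / 4) * (1 + ?t)"
      using t params by (intro mult_mono) (auto simp: a_def)
    then have "exp (- ?t / 4) \<le> exp (1 + - a * ?t powr \<alpha>)" by simp
    then have e1: "B * exp (- ?t / 4) \<le> B * (exp 1 * exp (- a * ?t powr \<alpha>))"
      unfolding exp_add using B(1) by (intro mult_left_mono) auto
    have "a * ?t powr \<alpha> \<le> c / 2 * ?t powr \<alpha>"
      by (intro mult_right_mono) (auto simp: a_def)
    then have e2: "A * exp (- (c / 2) * ?t powr \<alpha>) \<le> A * exp (- a * ?t powr \<alpha>)"
      using A(1) by (intro mult_left_mono) auto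
    have "0 \<le> (\<Sum>j\<in>{m<..n}. power_part \<delta> Y j)" by (intro sum_nonneg power_part_nonneg)
    then have "\<bar>psum n (diff_series \<delta> Y) - psum m (diff_series \<delta> Y)\<bar>
        \<le> A * exp (- a * ?t powr \<alpha>) + B * (exp 1 * exp (- a * ?t powr \<alpha>))"
      using 1 A(2)[OF fine_mesh mn n] B(2)[OF \<delta>, of Y m n] e1 e2 by linarith
    then show "\<bar>psum n (diff_series \<delta> Y) - psum m (diff_series \<delta> Y)\<bar> \<le> A' * exp (- a * ?t powr \<alpha>)"
      by (simp add: A'_def algebra_simps)
    have "wsum 1 n (diff_series \<delta> Y) = (\<Sum>j\<in>{0<..n}. \<bar>diff_series \<delta> Y $ j\<bar>)"
      unfolding wsum_def by (intro sum.mono_neutral_cong_right) auto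
    also have "\<dots> \<le> (\<Sum>j\<in>{0<..n}. 2 * lat_Li ?w $ j + ?a j + power_part \<delta> Y j)"
    proof (intro sum_mono)
      fix j assume j: "j \<in> {0<..n}"
      then have "0 \<le> ?a j + lat_Li ?w $ j"
        using diff_series_nth(2)[OF \<delta> jY] by auto
      then show "\<bar>diff_series \<delta> Y $ j\<bar> \<le> 2 * lat_Li ?w $ j + ?a j + power_part \<delta> Y j"
        using diff_series[OF j] lat_Li_nonneg[OF \<delta>, of j] power_part_nonneg[of \<delta> Y j] by linarith
    qed
    also have "\<dots> = 2 * (\<Sum>j\<in>{0<..n}. lat_Li ?w $ j) + (\<Sum>j\<in>{0<..n}. ?a j) + (\<Sum>j\<in>{0<..n}. power_part \<delta> Y j)"
      by (simp add: sum.distrib sum_distrib_left)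
    also have "\<dots> \<le> 2 * (2 * ln (1 + \<delta> * real n)) + A + B * exp 1"
    proof (intro add_mono)
      have "(\<Sum>j\<in>{0<..n}. lat_Li ?w $ j) = (\<Sum>j\<le>n. lat_Li ?w $ j)"
        by (intro sum.mono_neutral_left) (auto simp: lat_Li_nth)
      then show "2 * (\<Sum>j\<in>{0<..n}. lat_Li ?w $ j) \<le> 2 * (2 * ln (1 + \<delta> * real n))"
        using sum_lat_Li_le[OF \<delta>, of n] by simp
      show "(\<Sum>j\<in>{0<..n}. ?a j) \<le> A"
        using A(2)[OF fine_mesh _ n, of 0] params by simp
      have "(\<Sum>j\<in>{0<..n}. power_part \<delta> Y j) \<le> B * 1" using B(2)[OF \<delta>, of Y 0 n] by simp
      also have "\<dots> \<le> B * exp 1" using B(1) by (intro mult_left_mono) auto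
      finally show "(\<Sum>j\<in>{0<..n}. power_part \<delta> Y j) \<le> B * exp 1" .
    qed
    finally show "wsum 1 n (diff_series \<delta> Y) \<le> A' + 4 * ln (1 + \<delta> * real n)"
      by (simp add: A'_def)
  qed
  then show ?thesis using pos by blast
qed

end

section \<open>From primes to integers\<close>

lemma abs_exp_diff_le:
  assumes "x \<le> B" "y \<le> (B :: real)"
  shows "\<bar>exp x - exp y\<bar> \<le> exp B * \<bar>x - y\<bar>"
proof -
  have *: "exp v - exp u \<le> exp B * (v - u)" if "u \<le> v" "v \<le> B" for u v :: real
  proof -
    have "1 - exp (u - v) \<le> v - u"
      using exp_ge_add_one_self[of "u - v"] by linarith
    then have "exp v * (1 - exp (u - v)) \<le> exp B * (v - u)"
      using that by (intro mult_mono) auto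
    then show ?thesis by (simp add: right_diff_distrib flip: exp_add)
  qed
  show ?thesis
    using *[of x y] *[of y x] assms by (cases "x \<le> y") auto
qed

context malliavin
begin

abbreviation expo :: real where "expo \<equiv> \<alpha> / (1 + \<alpha>)"

text \<open>The number of lattice integers up to height \<delta> n, divided by exp (\<delta> n); see
  \<open>card_lattice_ints\<close>.\<close>

abbreviation S :: "real \<Rightarrow> real \<Rightarrow> nat \<Rightarrow> real" where
  "S \<delta> Y n \<equiv> psum n (fps_Exp (diff_series \<delta> Y))"

lemma expo_pos: "0 < expo"
  using params by simp

text \<open>Each S is close to the exponential of a partial sum of g at its own cut H, and two such
  partial sums are close by the decay of g. The constants do not depend on \<delta> and Y;
  \<open>L\<close> is exp (- A0), where A0 bounds the partial sums of g.\<close>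

lemma psum_Exp_cauchy:
  "\<exists>A>0. \<exists>a>0. \<exists>L>0. \<forall>\<delta> Y \<tau> n n'. fine_mesh \<delta> Y \<longrightarrow> 1 \<le> \<tau> \<longrightarrow>
     \<tau> \<le> \<delta> * real n \<longrightarrow> \<delta> * real n \<le> Y \<longrightarrow> \<tau> \<le> \<delta> * real n' \<longrightarrow> \<delta> * real n' \<le> Y \<longrightarrow>
     \<bar>S \<delta> Y n - S \<delta> Y n'\<bar> \<le> A * exp (- a * \<tau> powr expo) \<and>
     L - A * exp (- a * \<tau> powr expo) \<le> S \<delta> Y n \<and> \<bar>S \<delta> Y n\<bar> \<le> A"
proof -
  obtain A0 a0 where A0: "A0 > 0" "a0 > 0"
    and bd: "\<And>\<delta> Y m n. fine_mesh \<delta> Y \<Longrightarrow> m \<le> n \<Longrightarrow> \<delta> * real n \<le> Y \<Longrightarrow>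
     \<bar>psum n (diff_series \<delta> Y) - psum m (diff_series \<delta> Y)\<bar> \<le> A0 * exp (- a0 * (\<delta> * real m) powr \<alpha>)"
    and V: "\<And>\<delta> Y n. fine_mesh \<delta> Y \<Longrightarrow> \<delta> * real n \<le> Y \<Longrightarrow>
     wsum 1 n (diff_series \<delta> Y) \<le> A0 + 4 * ln (1 + \<delta> * real n)"
    using diff_series_bounds by (metis order.refl)
  have ps: "\<bar>psum n (diff_series \<delta> Y)\<bar> \<le> A0" if "fine_mesh \<delta> Y" "\<delta> * real n \<le> Y" for \<delta> Y n
    using bd[OF that(1) _ that(2), of 0] params by (simp add: psum_def)
  \<comment> \<open>With V = A0 + 4 ln (1 + t), exp (x V) is a constant times (1 + t)^(4 x).
    \<open>psum_Exp_split\<close> involves x = 2 and x = exp 1, hence the powers 8 and 4 * exp 1;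
    each is paid for with half of the available decay.\<close>
  obtain K1 where K1: "K1 > 0" "\<And>t. t \<ge> 0 \<Longrightarrow> (1 + t) powr 8 * exp (- (a0 / 4) * t powr expo) \<le> K1"
    using poly_exp_powr_bounded[of "a0 / 4" expo 8] A0 expo_pos by auto
  obtain K2 where K2: "K2 > 0" "\<And>t. t \<ge> 0 \<Longrightarrow> (1 + t) powr (4 * exp 1) * exp (- (1 / 2) * t powr expo) \<le> K2"
    using poly_exp_powr_bounded[of "1 / 2" expo "4 * exp 1"] expo_pos by auto
  define a where "a = min (a0 / 4) (1 / 2)"
  define A1 where "A1 = A0 * exp (2 * A0) * K1 + exp (exp 1 * A0) * K2"
  have a: "a > 0" and A1: "A1 > 0" using A0 K1 K2 by (auto simp: a_def A1_def intro!: add_pos_pos)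
  have step: "\<exists>H\<le>n. \<bar>S \<delta> Y n - exp (psum H (diff_series \<delta> Y))\<bar> \<le> A1 * exp (- a * (\<delta> * real n) powr expo) \<and>
      (\<delta> * real n) powr expo / 2 \<le> (\<delta> * real H) powr \<alpha>"
    if fm: "fine_mesh \<delta> Y" and t1: "1 \<le> \<delta> * real n" and tY: "\<delta> * real n \<le> Y" for \<delta> Y n
  proof -
    define t where "t = \<delta> * real n"
    define h where "h = t powr (1 / (1 + \<alpha>))"
    define H where "H = nat \<lfloor>h / \<delta>\<rfloor>"
    have \<delta>: "0 < \<delta>" "\<delta> \<le> 1 / 2" using fm by (auto simp: fine_mesh_def)
    have t: "t \<ge> 1" using t1 by (simp add: t_def)
    have h1: "1 \<le> h" using t params by (simp add: h_def ge_one_powr_ge_zero)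
    have ht: "h \<le> t"
    proof -
      have "h \<le> t powr 1" unfolding h_def using t params by (intro powr_mono) (auto simp: field_simps)
      then show ?thesis using t by simp
    qed
    have H0: "real H \<le> h / \<delta>" using h1 \<delta> by (simp add: H_def of_nat_nat)
    have H1: "h / \<delta> - 1 < real H" using h1 \<delta> by (simp add: H_def of_nat_nat)
    have "\<delta> \<le> h" using h1 \<delta> by linarith
    then have "1 \<le> h / \<delta>" using \<delta> by simp
    then have Hpos: "0 < H" by (simp add: H_def le_floor_iff)
    have "real H \<le> t / \<delta>" using H0 ht \<delta> by (meson divide_right_mono less_imp_le order.trans)
    then have Hn: "H \<le> n" using \<delta> by (simp add: t_def)
    have \<delta>H: "h / 2 \<le> \<delta> * real H"
    proof -
      have "\<delta> * (h / \<delta> - 1) \<le> \<delta> * real H" using H1 \<delta> by (intro mult_left_mono) auto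
      then show ?thesis using \<delta> h1 by (simp add: right_diff_distrib)
    qed
    have halpha: "h powr \<alpha> = t powr expo" by (simp add: h_def powr_powr)
    \<comment> \<open>Rounding h down to the lattice keeps at least h / 2, and (1 / 2)^\<alpha>
      \<ge> 1 / 2 because \<alpha> \<le> 1.\<close>
    have Halpha: "t powr expo / 2 \<le> (\<delta> * real H) powr \<alpha>"
    proof -
      have "(1 / 2 :: real) powr 1 \<le> (1 / 2) powr \<alpha>" using params by (intro powr_mono') auto
      then have "t powr expo / 2 \<le> (1 / 2) powr \<alpha> * h powr \<alpha>"
        unfolding halpha using mult_right_mono[of "1 / 2" "(1 / 2) powr \<alpha>" "t powr expo"] by simp
      also have "\<dots> = (h / 2) powr \<alpha>" using h1 by (simp add: powr_mult[symmetric])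
      also have "\<dots> \<le> (\<delta> * real H) powr \<alpha>" using \<delta>H h1 params by (intro powr_mono2) auto
      finally show ?thesis .
    qed
    have nH: "t powr expo \<le> real n / real H"
    proof -
      have "t powr expo = t powr (1 - 1 / (1 + \<alpha>))" using params by (simp add: field_simps)
      also have "\<dots> = t / h" using t by (simp add: h_def powr_diff)
      also have "\<dots> \<le> t / (\<delta> * real H)"
      proof (rule divide_left_mono)
        show "\<delta> * real H \<le> h" using H0 \<delta> by (simp add: field_simps)
        show "0 < h * (\<delta> * real H)" using h1 \<delta> Hpos by (intro mult_pos_pos) auto
      qed (use t in simp)
      also have "\<dots> = real n / real H" using \<delta> by (simp add: t_def)
      finally show ?thesis .
    qed
    define V where "V = A0 + 4 * ln (1 + t)"
    have eV: "exp (x * V) = exp (x * A0) * (1 + t) powr (4 * x)" for x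
      using t by (simp add: V_def powr_def exp_add[symmetric] algebra_simps)
    define \<epsilon> where "\<epsilon> = A0 * exp (- (a0 / 2) * t powr expo)"
    have \<epsilon>: "\<bar>psum k (diff_series \<delta> Y) - psum H (diff_series \<delta> Y)\<bar> \<le> \<epsilon>" if "H \<le> k" "k \<le> n" for k
    proof -
      have "\<delta> * real k \<le> Y" using tY that(2) \<delta> by (smt (verit) mult_left_mono of_nat_mono)
      then have "\<bar>psum k (diff_series \<delta> Y) - psum H (diff_series \<delta> Y)\<bar> \<le> A0 * exp (- a0 * (\<delta> * real H) powr \<alpha>)"
        by (intro bd fm that)
      also have "\<dots> \<le> \<epsilon>"
      proof -
        have "a0 * (t powr expo / 2) \<le> a0 * (\<delta> * real H) powr \<alpha>"
          using Halpha A0 by (intro mult_left_mono) auto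
        then show ?thesis unfolding \<epsilon>_def using A0 by (intro mult_left_mono) auto
      qed
      finally show ?thesis .
    qed
    have "\<bar>S \<delta> Y n - exp (psum H (diff_series \<delta> Y))\<bar> \<le> \<epsilon> * exp (2 * V) + exp (exp 1 * V - real n / real H)"
      using V[OF fm tY] A0 by (intro psum_Exp_split Hpos Hn \<epsilon>) (auto simp: \<epsilon>_def V_def t_def)
    also have "\<epsilon> * exp (2 * V) \<le> A0 * exp (2 * A0) * K1 * exp (- a * t powr expo)"
    proof -
      have "exp (- (a0 / 2) * t powr expo) = exp (- (a0 / 4) * t powr expo) * exp (- (a0 / 4) * t powr expo)"
        by (simp flip: exp_add)
      then have "\<epsilon> * exp (2 * V) = A0 * exp (2 * A0)
          * ((1 + t) powr 8 * exp (- (a0 / 4) * t powr expo)) * exp (- (a0 / 4) * t powr expo)"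
        unfolding eV \<epsilon>_def by simp
      also have "\<dots> \<le> A0 * exp (2 * A0) * K1 * exp (- (a0 / 4) * t powr expo)"
        using K1(2)[of t] t A0 by (intro mult_right_mono mult_left_mono) auto
      also have "\<dots> \<le> A0 * exp (2 * A0) * K1 * exp (- a * t powr expo)"
      proof -
        have "a * t powr expo \<le> a0 / 4 * t powr expo" by (intro mult_right_mono) (auto simp: a_def)
        then show ?thesis using A0 K1 by (intro mult_left_mono) auto
      qed
      finally show ?thesis .
    qed
    also have "exp (exp 1 * V - real n / real H) \<le> exp (exp 1 * A0) * K2 * exp (- a * t powr expo)"
    proof -
      have "exp (exp 1 * V - real n / real H) \<le> exp (exp 1 * V) * exp (- (t powr expo))"
        using nH by (simp flip: exp_add)
      also have "exp (- (t powr expo)) = exp (- (1 / 2) * t powr expo) * exp (- (1 / 2) * t powr expo)"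
        by (simp flip: exp_add)
      also have "exp (exp 1 * V) * \<dots> = exp (exp 1 * A0)
          * ((1 + t) powr (4 * exp 1) * exp (- (1 / 2) * t powr expo)) * exp (- (1 / 2) * t powr expo)"
        unfolding eV by simp
      also have "\<dots> \<le> exp (exp 1 * A0) * K2 * exp (- (1 / 2) * t powr expo)"
        using K2(2)[of t] t by (intro mult_right_mono mult_left_mono) auto
      also have "\<dots> \<le> exp (exp 1 * A0) * K2 * exp (- a * t powr expo)"
      proof -
        have "a * t powr expo \<le> 1 / 2 * t powr expo" by (intro mult_right_mono) (auto simp: a_def)
        then show ?thesis using K2 by (intro mult_left_mono) auto
      qed
      finally show ?thesis .
    qed
    finally have "\<bar>S \<delta> Y n - exp (psum H (diff_series \<delta> Y))\<bar> \<le> A1 * exp (- a * t powr expo)"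
      by (simp add: A1_def algebra_simps)
    then show ?thesis using Hn Halpha by (auto simp: t_def)
  qed
  define A where "A = 2 * A1 + exp A0 * A0 + exp A0"
  have A: "A > 0" using A1 A0 by (auto simp: A_def intro!: add_pos_pos)
  have "\<bar>S \<delta> Y n - S \<delta> Y n'\<bar> \<le> A * exp (- a * \<tau> powr expo) \<and>
     exp (- A0) - A * exp (- a * \<tau> powr expo) \<le> S \<delta> Y n \<and> \<bar>S \<delta> Y n\<bar> \<le> A"
    if fm: "fine_mesh \<delta> Y" and \<tau>: "1 \<le> \<tau>" and n: "\<tau> \<le> \<delta> * real n" "\<delta> * real n \<le> Y"
      and n': "\<tau> \<le> \<delta> * real n'" "\<delta> * real n' \<le> Y" for \<delta> Y \<tau> n n'
  proof -
    have \<delta>: "0 < \<delta>" using fm by (auto simp: fine_mesh_def)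
    let ?E = "exp (- a * \<tau> powr expo)"
    obtain H where H: "H \<le> n" "\<bar>S \<delta> Y n - exp (psum H (diff_series \<delta> Y))\<bar> \<le> A1 * exp (- a * (\<delta> * real n) powr expo)"
      "(\<delta> * real n) powr expo / 2 \<le> (\<delta> * real H) powr \<alpha>"
      using step[OF fm _ n(2)] n \<tau> by force
    obtain H' where H': "H' \<le> n'" "\<bar>S \<delta> Y n' - exp (psum H' (diff_series \<delta> Y))\<bar> \<le> A1 * exp (- a * (\<delta> * real n') powr expo)"
      "(\<delta> * real n') powr expo / 2 \<le> (\<delta> * real H') powr \<alpha>"
      using step[OF fm _ n'(2)] n' \<tau> by force
    have mono: "A1 * exp (- a * (\<delta> * real k) powr expo) \<le> A1 * ?E" if "\<tau> \<le> \<delta> * real k" for k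
    proof -
      have "\<tau> powr expo \<le> (\<delta> * real k) powr expo" using that \<tau> expo_pos by (intro powr_mono2) auto
      then show ?thesis using a A1 by (intro mult_left_mono) auto
    qed
    have HY: "\<delta> * real H \<le> Y" "\<delta> * real H' \<le> Y"
      using H(1) H'(1) n n' \<delta> by (smt (verit) mult_left_mono of_nat_mono)+
    have bdH: "\<bar>psum l (diff_series \<delta> Y) - psum k (diff_series \<delta> Y)\<bar> \<le> A0 * ?E"
      if "k \<le> l" "\<delta> * real l \<le> Y" "\<tau> powr expo / 2 \<le> (\<delta> * real k) powr \<alpha>" for k l
    proof -
      have "a * \<tau> powr expo \<le> (a0 / 2) * \<tau> powr expo"
        using A0 by (intro mult_right_mono) (auto simp: a_def)
      also have "\<dots> \<le> a0 * (\<delta> * real k) powr \<alpha>"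
        using mult_left_mono[OF that(3), of a0] A0 by simp
      finally have "A0 * exp (- a0 * (\<delta> * real k) powr \<alpha>) \<le> A0 * ?E"
        using A0 by (intro mult_left_mono) auto
      then show ?thesis using bd[OF fm that(1,2)] by linarith
    qed
    have \<tau>n: "\<tau> powr expo \<le> (\<delta> * real n) powr expo" "\<tau> powr expo \<le> (\<delta> * real n') powr expo"
      using n(1) n'(1) \<tau> expo_pos by (auto intro!: powr_mono2)
    have "\<bar>psum H (diff_series \<delta> Y) - psum H' (diff_series \<delta> Y)\<bar> \<le> A0 * ?E"
    proof (cases "H \<le> H'")
      case True
      then show ?thesis using bdH[OF True HY(2)] H(3) \<tau>n by (simp add: abs_minus_commute)
    next
      case False
      then show ?thesis using bdH[OF _ HY(1), of H'] H'(3) \<tau>n by simp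
    qed
    then have "exp A0 * \<bar>psum H (diff_series \<delta> Y) - psum H' (diff_series \<delta> Y)\<bar> \<le> exp A0 * (A0 * ?E)"
      by (intro mult_left_mono) auto
    moreover have "\<bar>exp (psum H (diff_series \<delta> Y)) - exp (psum H' (diff_series \<delta> Y))\<bar> \<le> exp A0 * \<bar>psum H (diff_series \<delta> Y) - psum H' (diff_series \<delta> Y)\<bar>"
      using ps[OF fm HY(1)] ps[OF fm HY(2)] by (intro abs_exp_diff_le) auto
    ultimately have D: "\<bar>S \<delta> Y n - S \<delta> Y n'\<bar> \<le> 2 * (A1 * ?E) + exp A0 * (A0 * ?E)"
      using H(2) H'(2) mono[OF n(1)] mono[OF n'(1)] by linarith
    have E: "0 < ?E" "?E \<le> 1" using a by auto
    have "2 * (A1 * ?E) + exp A0 * (A0 * ?E) + exp A0 * ?E = A * ?E"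
      by (simp add: A_def algebra_simps)
    moreover have "0 < exp A0 * ?E" by simp
    moreover have "0 \<le> exp A0 * (A0 * ?E)" "0 \<le> A1 * ?E" using A0 A1 by simp_all
    moreover have "exp (- A0) \<le> exp (psum H (diff_series \<delta> Y))" "exp (psum H (diff_series \<delta> Y)) \<le> exp A0"
      using ps[OF fm HY(1)] by auto
    moreover have "A1 * ?E \<le> A1" using mult_left_mono[OF E(2), of A1] A1 by simp
    moreover have "A1 + exp A0 \<le> A" using A0 A1 by (simp add: A_def)
    moreover have "0 \<le> exp (psum H (diff_series \<delta> Y))" by simp
    ultimately show ?thesis
      using D H(2) mono[OF n(1)] by (intro conjI) linarith+
  qed
  then show ?thesis using A a by (intro exI[of _ A] conjI exI[of _ a] exI[of _ "exp (- A0)"]) auto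
qed

section \<open>Enclosing the integers between lattice counts\<close>

lemma gen_int_value_exp: "gen_int_value p M = exp (\<Sum>i\<in>#M. ln (p i))"
proof (induction M)
  case (add i M)
  then show ?case
    using prime_gt_1[OF beurling, of i] by (simp add: gen_int_value_def exp_add)
qed (simp add: gen_int_value_def)

lemma card_lattice_ints:
  assumes "\<delta> > 0"
  shows "real (card {M. set_mset M \<subseteq> {i. p i \<le> exp Y} \<and> (\<Sum>i\<in>#M. lat \<delta> i) \<le> n})
    = exp (\<delta> * real n) * S \<delta> Y n"
proof -
  have "real (card {M. set_mset M \<subseteq> {i. p i \<le> exp Y} \<and> (\<Sum>i\<in>#M. lat \<delta> i) \<le> n})
      = S \<delta> Y n / exp (- \<delta>) ^ n"
    unfolding diff_series_def by (rule card_reps_le_eq) (auto simp: lat_pos assms)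
  also have "exp (- \<delta>) ^ n = inverse (exp (\<delta> * real n))"
    by (simp add: exp_of_nat_mult[symmetric] exp_minus[symmetric] mult.commute)
  finally show ?thesis by (simp add: field_simps)
qed

text \<open>Rounding up only enlarges logarithms, so a product that fits on the lattice also fits
  before rounding.\<close>

lemma lattice_ints_le:
  assumes "\<delta> > 0" "\<delta> * real n \<le> y"
  shows "exp (\<delta> * real n) * S \<delta> Y n \<le> real (integer_count p (exp y))"
proof -
  have "{M. set_mset M \<subseteq> {i. p i \<le> exp Y} \<and> (\<Sum>i\<in>#M. lat \<delta> i) \<le> n} \<subseteq> {M. gen_int_value p M \<le> exp y}"
  proof safe
    fix M assume M: "(\<Sum>i\<in>#M. lat \<delta> i) \<le> n"
    have "(\<Sum>i\<in>#M. ln (p i)) \<le> \<delta> * real (\<Sum>i\<in>#M. lat \<delta> i)"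
    proof (induction M)
      case (add i M)
      then show ?case using ln_le_lat[OF assms(1), of i] by (simp add: algebra_simps)
    qed simp
    also have "\<dots> \<le> \<delta> * real n"
      using M assms by (intro mult_left_mono) (simp_all only: of_nat_le_iff less_imp_le)
    finally show "gen_int_value p M \<le> exp y" using assms by (simp add: gen_int_value_exp)
  qed
  then show ?thesis
    unfolding card_lattice_ints[OF assms(1), symmetric] integer_count_def
    by (intro of_nat_mono card_mono finite_gen_ints_le beurling)
qed

text \<open>Each factor moves up by at most one lattice step, and an integer up to exp y has fewer
  than K factors because every prime is at least \<open>p 0\<close>. So K extra steps
  suffice.\<close>

lemma ints_le_lattice:
  assumes \<delta>: "\<delta> > 0" and y: "y \<le> Y" and K: "exp y < p 0 ^ K" and n: "y / \<delta> + real K \<le> real n"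
  shows "real (integer_count p (exp y)) \<le> exp (\<delta> * real n) * S \<delta> Y n"
proof -
  let ?R = "{M. set_mset M \<subseteq> {i. p i \<le> exp Y} \<and> (\<Sum>i\<in>#M. lat \<delta> i) \<le> n}"
  have "{M. gen_int_value p M \<le> exp y} \<subseteq> ?R"
  proof (rule subsetI, intro CollectI conjI)
    fix M assume "M \<in> {M. gen_int_value p M \<le> exp y}"
    then have M: "gen_int_value p M \<le> exp y" by simp
    have "p 0 ^ size M < p 0 ^ K"
      using gen_int_value_ge_power[OF beurling, of M] M K by linarith
    then have sz: "size M < K"
      using prime_gt_1[OF beurling, of 0] power_less_imp_less_exp by blast
    show "set_mset M \<subseteq> {i. p i \<le> exp Y}"
    proof
      fix i assume that: "i \<in># M"
      have "exp y \<le> exp Y" using y by simp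
      then show "i \<in> {i. p i \<le> exp Y}"
        using prime_le_gen_int_value[OF beurling that] M by (simp only: mem_Collect_eq)
    qed
    have "real (\<Sum>i\<in>#M. lat \<delta> i) \<le> (\<Sum>i\<in>#M. ln (p i)) / \<delta> + real (size M)"
    proof (induction M)
      case (add i M)
      have "ln (p i) / \<delta> \<ge> 0" using \<delta> prime_gt_1[OF beurling, of i] by simp
      then have "real (lat \<delta> i) \<le> ln (p i) / \<delta> + 1"
        by (simp add: lat_def)
      then show ?case using add by (simp add: add_divide_distrib)
    qed simp
    also have "(\<Sum>i\<in>#M. ln (p i)) / \<delta> \<le> y / \<delta>"
      using M \<delta> by (intro divide_right_mono) (auto simp: gen_int_value_exp)
    finally show "(\<Sum>i\<in>#M. lat \<delta> i) \<le> n" using sz n by linarith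
  qed
  moreover have "finite ?R"
  proof -
    have "?R = (\<Union>k\<le>n. reps (lat \<delta>) {i. p i \<le> exp Y} k)" by (auto simp: reps_def)
    then show ?thesis using \<delta> by (auto intro!: finite_reps simp: lat_pos)
  qed
  ultimately show ?thesis
    unfolding card_lattice_ints[OF \<delta>, symmetric] integer_count_def
    by (intro of_nat_mono card_mono)
qed

abbreviation dens :: "real \<Rightarrow> real" where
  "dens y \<equiv> real (integer_count p (exp y)) / exp y"

text \<open>The bounds for \<open>S\<close> are uniform in the mesh, so the mesh may depend on y, y'
  and a tolerance \<eta>; letting \<eta> tend to 0 removes the lattice.\<close>

lemma dens_cauchy:
  "\<exists>A>0. \<exists>a>0. \<exists>L>0. \<forall>y y'. 2 \<le> y \<longrightarrow> y \<le> y' \<longrightarrow>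
     \<bar>dens y - dens y'\<bar> \<le> A * exp (- a * (y - 1) powr expo) \<and>
     L - A * exp (- a * (y - 1) powr expo) \<le> dens y"
proof -
  obtain A a L where AaL: "A > 0" "a > 0" "L > 0"
    and S: "\<And>\<delta> Y \<tau> n n'. fine_mesh \<delta> Y \<Longrightarrow> 1 \<le> \<tau> \<Longrightarrow>
     \<tau> \<le> \<delta> * real n \<Longrightarrow> \<delta> * real n \<le> Y \<Longrightarrow> \<tau> \<le> \<delta> * real n' \<Longrightarrow> \<delta> * real n' \<le> Y \<Longrightarrow>
     \<bar>S \<delta> Y n - S \<delta> Y n'\<bar> \<le> A * exp (- a * \<tau> powr expo) \<and>
     L - A * exp (- a * \<tau> powr expo) \<le> S \<delta> Y n \<and> \<bar>S \<delta> Y n\<bar> \<le> A"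
    using psum_Exp_cauchy by blast
  have "\<bar>dens y - dens y'\<bar> \<le> A * exp (- a * (y - 1) powr expo) \<and>
     L - A * exp (- a * (y - 1) powr expo) \<le> dens y" if y: "2 \<le> y" "y \<le> y'" for y y'
  proof -
    \<comment> \<open>The margin 1 leaves room for rounding above y', just as y - 1 in the estimates
      leaves room below y.\<close>
    define Y where "Y = y' + 1"
    obtain K where K: "exp Y < p 0 ^ K"
      using real_arch_pow[OF prime_gt_1[OF beurling, of 0]] by blast
    let ?E = "A * exp (- a * (y - 1) powr expo)"
    have approx: "\<bar>dens y - dens y'\<bar> \<le> ?E + 2 * \<eta> \<and> L - ?E \<le> dens y + \<eta>" if \<eta>: "\<eta> > 0" for \<eta>
    proof -
      \<comment> \<open>The first two bounds give \<open>fine_mesh\<close>. The last two make the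
        total shift x = \<delta> (K + 1) at most 1 and 2 A x at most \<eta>, so that the factors exp
        (\<delta> n - z) change S by at most \<eta>.\<close>
      define \<delta> where "\<delta> = min (min (1 / 2) (C * exp (- c * Y powr \<alpha>)))
        (min (1 / real (K + 1)) (\<eta> / (2 * A * real (K + 1))))"
      have \<delta>: "0 < \<delta>" "\<delta> \<le> 1 / 2" "\<delta> \<le> C * exp (- c * Y powr \<alpha>)" "\<delta> \<le> 1 / real (K + 1)"
        "\<delta> \<le> \<eta> / (2 * A * real (K + 1))"
        using params \<eta> AaL unfolding \<delta>_def by (simp, simp_all only: min_le_iff_disj order.refl simp_thms)
      have fm: "fine_mesh \<delta> Y" using \<delta> by (simp add: fine_mesh_def)
      define x where "x = \<delta> * real (K + 1)"
      have x: "0 < x" "x \<le> 1" "\<delta> \<le> x" "2 * A * x \<le> \<eta>"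
      proof -
        show "0 < x" "x \<le> 1" "\<delta> \<le> x"
          using \<delta>(1,4) by (auto simp: x_def pos_le_divide_eq simp del: of_nat_Suc of_nat_add)
        show "2 * A * x \<le> \<eta>"
          using \<delta>(5) AaL by (simp add: x_def pos_le_divide_eq mult_ac del: of_nat_Suc of_nat_add)
      qed
      have ex: "exp x - 1 \<le> 2 * x"
      proof -
        have "exp x \<le> 1 + x + x\<^sup>2" using x by (intro exp_bound) auto
        moreover have "x\<^sup>2 \<le> x" using x by (simp add: power2_eq_square mult_left_le)
        ultimately show ?thesis by simp
      qed
      have key: "\<exists>n0 n1. y - 1 \<le> \<delta> * real n0 \<and> \<delta> * real n0 \<le> Y \<and> y - 1 \<le> \<delta> * real n1 \<and> \<delta> * real n1 \<le> Y \<and>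
          S \<delta> Y n0 - \<eta> \<le> dens z \<and> dens z \<le> S \<delta> Y n1 + \<eta>" if z: "y \<le> z" "z \<le> y'" for z
      proof -
        define n0 where "n0 = nat \<lfloor>z / \<delta>\<rfloor>"
        define n1 where "n1 = n0 + K + 1"
        have "0 \<le> z / \<delta>" using z y \<delta> by simp
        then have n0: "real n0 \<le> z / \<delta>" "z / \<delta> < real n0 + 1"
          unfolding n0_def by linarith+
        have d0: "\<delta> * real n0 \<le> z" "z - \<delta> \<le> \<delta> * real n0"
          using n0 \<delta>(1) by (auto simp: field_simps)
        have d1: "\<delta> * real n1 = \<delta> * real n0 + x"
          by (simp add: n1_def x_def algebra_simps)
        have rng: "y - 1 \<le> \<delta> * real n0" "\<delta> * real n0 \<le> Y" "y - 1 \<le> \<delta> * real n1" "\<delta> * real n1 \<le> Y"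
          using d0 d1 x z \<delta>(2) by (simp_all add: Y_def)
        have Sb: "\<bar>S \<delta> Y n0\<bar> \<le> A" "\<bar>S \<delta> Y n1\<bar> \<le> A"
          using S[OF fm, of "y - 1" n0 n0] S[OF fm, of "y - 1" n1 n1] rng y by auto
        have lo: "S \<delta> Y n0 - \<eta> \<le> dens z"
        proof -
          define u where "u = exp (\<delta> * real n0 - z)"
          have u: "1 - u \<le> x" "u \<le> 1"
            unfolding u_def using d0 x exp_ge_add_one_self[of "\<delta> * real n0 - z"] by (linarith, simp)
          have "u * S \<delta> Y n0 \<le> dens z"
            using lattice_ints_le[OF \<delta>(1) d0(1), of Y] by (simp add: u_def exp_diff field_simps)
          moreover have "(1 - u) * S \<delta> Y n0 \<le> x * A"
            using u Sb by (intro order.trans[OF mult_left_mono[of "S \<delta> Y n0" A] mult_right_mono]) (use AaL in auto)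
          moreover have "x * A \<le> \<eta>"
          proof -
            have "0 \<le> x * A" using x AaL by simp
            moreover have "2 * (x * A) \<le> \<eta>" using x(4) by (simp add: mult_ac)
            ultimately show ?thesis by linarith
          qed
          ultimately show ?thesis by (simp add: algebra_simps)
        qed
        have up: "dens z \<le> S \<delta> Y n1 + \<eta>"
        proof -
          define u where "u = exp (\<delta> * real n1 - z)"
          have "u \<le> exp x" using d0 d1 by (simp add: u_def)
          moreover have "1 \<le> u" using d0 d1 x by (simp add: u_def)
          ultimately have u: "u - 1 \<le> 2 * x" "0 \<le> u - 1" using ex by auto
          have Kz: "exp z < p 0 ^ K"
            using K z exp_le_cancel_iff[of z Y] by (simp only: Y_def) linarith
          have nz: "z / \<delta> + real K \<le> real n1" using n0 by (simp add: n1_def)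
          have "dens z \<le> u * S \<delta> Y n1"
            using ints_le_lattice[OF \<delta>(1) _ Kz nz, of Y] z by (simp add: u_def Y_def exp_diff field_simps)
          moreover have "(u - 1) * S \<delta> Y n1 \<le> (2 * x) * A"
            using u Sb by (intro order.trans[OF mult_left_mono[of "S \<delta> Y n1" A] mult_right_mono]) (use AaL in auto)
          ultimately show ?thesis using x by (simp add: algebra_simps)
        qed
        show ?thesis using rng lo up by blast
      qed
      obtain n0 n1 where n: "y - 1 \<le> \<delta> * real n0" "\<delta> * real n0 \<le> Y" "y - 1 \<le> \<delta> * real n1" "\<delta> * real n1 \<le> Y"
          "S \<delta> Y n0 - \<eta> \<le> dens y" "dens y \<le> S \<delta> Y n1 + \<eta>"
        using key[of y] y by auto
      obtain m0 m1 where m: "y - 1 \<le> \<delta> * real m0" "\<delta> * real m0 \<le> Y" "y - 1 \<le> \<delta> * real m1" "\<delta> * real m1 \<le> Y"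
          "S \<delta> Y m0 - \<eta> \<le> dens y'" "dens y' \<le> S \<delta> Y m1 + \<eta>"
        using key[of y'] y by auto
      have y1: "1 \<le> y - 1" using y by simp
      show ?thesis
        using S[OF fm y1 n(3,4) m(1,2)] S[OF fm y1 m(3,4) n(1,2)] S[OF fm y1 n(1,2) n(1,2)] n(5,6) m(5,6)
        by (intro conjI) linarith+
    qed
    show ?thesis
    proof
      show "\<bar>dens y - dens y'\<bar> \<le> ?E"
      proof (rule field_le_epsilon)
        fix e :: real assume "e > 0"
        then show "\<bar>dens y - dens y'\<bar> \<le> ?E + e" using approx[of "e / 2"] by simp
      qed
      show "L - ?E \<le> dens y"
        by (rule field_le_epsilon) (use approx in blast)
    qed
  qed
  then show ?thesis using AaL by blast
qed

text \<open>The densities along the natural numbers form a Cauchy sequence. Its limit \<rho> is at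
  least L > 0, and sending y' to infinity in \<open>dens_cauchy\<close> gives the error. The shift y
  - 1 halves the constant in the exponent.\<close>

theorem integer_cond_expo: "integer_cond expo p"
proof -
  obtain A a L where AaL: "A > 0" "a > 0" "L > 0"
    and D: "\<And>y y'. 2 \<le> y \<Longrightarrow> y \<le> y' \<Longrightarrow>
     \<bar>dens y - dens y'\<bar> \<le> A * exp (- a * (y - 1) powr expo) \<and>
     L - A * exp (- a * (y - 1) powr expo) \<le> dens y"
    using dens_cauchy by blast
  have lim0: "((\<lambda>y. A * exp (- a * (y - 1) powr expo)) \<longlongrightarrow> 0) at_top"
  proof -
    obtain K where K: "\<And>t. t \<ge> 0 \<Longrightarrow> (1 + t) powr 1 * exp (- a * t powr expo) \<le> K"
      using poly_exp_powr_bounded[of a expo 1] AaL expo_pos by auto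
    have lim: "((\<lambda>y. A * K / y) \<longlongrightarrow> 0) at_top"
      by (rule tendsto_divide_0[OF tendsto_const filterlim_at_top_imp_at_infinity[OF filterlim_ident]])
    have "\<forall>\<^sub>F y in at_top. A * exp (- a * (y - 1) powr expo) \<le> A * K / y"
      using eventually_ge_at_top[of 1]
    proof eventually_elim
      case (elim y)
      have "A * (y * exp (- a * (y - 1) powr expo)) \<le> A * K"
        using K[of "y - 1"] elim AaL by (intro mult_left_mono) auto
      then show ?case using elim by (simp add: field_simps)
    qed
    then show ?thesis
      using AaL by (intro tendsto_sandwich[OF _ _ tendsto_const lim]) (auto intro: always_eventually)
  qed
  have "Cauchy (\<lambda>n. dens (real n))"
  proof (rule metric_CauchyI)
    fix e :: real assume e: "e > 0"
    have "\<forall>\<^sub>F y in at_top. A * exp (- a * (y - 1) powr expo) < e / 2"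
      using lim0 e by (intro order_tendstoD) auto
    then obtain y0 where y0: "\<And>y. y \<ge> y0 \<Longrightarrow> A * exp (- a * (y - 1) powr expo) < e / 2"
      by (auto simp: eventually_at_top_linorder)
    define n0 where "n0 = nat \<lceil>max y0 2\<rceil>"
    have n0: "real n0 \<ge> y0" "real n0 \<ge> 2" by (simp_all add: n0_def) linarith+
    have "\<bar>dens (real n0) - dens (real m)\<bar> < e / 2" if "m \<ge> n0" for m
      using D[of "real n0" "real m"] y0[OF n0(1)] n0 that by simp
    then have "dist (dens (real m)) (dens (real n)) < e" if "m \<ge> n0" "n \<ge> n0" for m n
      using that by (smt (verit, best) dist_real_def field_sum_of_halves)
    then show "\<exists>M. \<forall>m\<ge>M. \<forall>n\<ge>M. dist (dens (real m)) (dens (real n)) < e" by blast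
  qed
  then obtain \<rho> where \<rho>: "(\<lambda>n. dens (real n)) \<longlonglongrightarrow> \<rho>"
    using Cauchy_convergent convergent_def by blast
  have err: "\<bar>dens y - \<rho>\<bar> \<le> A * exp (- a * (y - 1) powr expo)" if y: "2 \<le> y" for y
  proof (rule tendsto_upperbound)
    show "(\<lambda>n. \<bar>dens y - dens (real n)\<bar>) \<longlonglongrightarrow> \<bar>dens y - \<rho>\<bar>"
      by (intro tendsto_intros \<rho>)
    show "\<forall>\<^sub>F n in sequentially. \<bar>dens y - dens (real n)\<bar> \<le> A * exp (- a * (y - 1) powr expo)"
      using eventually_ge_at_top[of "nat \<lceil>y\<rceil>"]
      by eventually_elim (use D y in \<open>auto simp: nat_ceiling_le_eq\<close>)
  qed simp
  have "L \<le> \<rho>"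
  proof (rule tendsto_le[OF trivial_limit_sequentially \<rho>])
    have "((\<lambda>n. L - A * exp (- a * (real n - 1) powr expo)) \<longlonglongrightarrow> L - 0)"
      by (intro tendsto_diff tendsto_const filterlim_compose[OF lim0] filterlim_real_sequentially)
    then show "((\<lambda>n. L - A * exp (- a * (real n - 1) powr expo)) \<longlonglongrightarrow> L)" by simp
    show "\<forall>\<^sub>F n in sequentially. L - A * exp (- a * (real n - 1) powr expo) \<le> dens (real n)"
      using eventually_ge_at_top[of 2]
      by eventually_elim (use D[OF _ order.refl] in auto)
  qed
  then have \<rho>0: "\<rho> > 0" using AaL by simp
  have "(\<lambda>x. real (integer_count p x) - \<rho> * x) \<in> O(\<lambda>x. x * exp (- (a / 2) * ln x powr expo))"
  proof (rule bigoI[of _ A])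
    show "\<forall>\<^sub>F x in at_top. norm (real (integer_count p x) - \<rho> * x) \<le> A * norm (x * exp (- (a / 2) * ln x powr expo))"
      using eventually_ge_at_top[of "exp 2"]
    proof eventually_elim
      case (elim x)
      have x: "x > 0" using elim by (smt (verit) exp_gt_zero)
      define y where "y = ln x"
      have y: "y \<ge> 2" using elim x by (simp add: y_def ln_ge_iff)
      have xy: "x = exp y" using x by (simp add: y_def)
      have "y powr expo / 2 \<le> (y - 1) powr expo"
      proof -
        have "(1 / 2 :: real) powr 1 \<le> (1 / 2) powr expo"
          using params by (intro powr_mono') (auto simp: field_simps)
        then have "y powr expo / 2 \<le> (1 / 2) powr expo * y powr expo"
          using mult_right_mono[of "1 / 2" "(1 / 2) powr expo" "y powr expo"] by simp
        also have "\<dots> = (y / 2) powr expo" using y by (simp add: powr_mult[symmetric])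
        also have "\<dots> \<le> (y - 1) powr expo" using y expo_pos by (intro powr_mono2) auto
        finally show ?thesis .
      qed
      then have "a * (y powr expo / 2) \<le> a * (y - 1) powr expo"
        using AaL by (intro mult_left_mono) auto
      then have "A * exp (- a * (y - 1) powr expo) \<le> A * exp (- (a / 2) * y powr expo)"
        using AaL by (intro mult_left_mono) auto
      then have "\<bar>dens y - \<rho>\<bar> \<le> A * exp (- (a / 2) * y powr expo)" using err[OF y] by linarith
      then have "x * \<bar>dens y - \<rho>\<bar> \<le> x * (A * exp (- (a / 2) * y powr expo))"
        using x by (intro mult_left_mono) auto
      moreover have "x * \<bar>dens y - \<rho>\<bar> = \<bar>real (integer_count p x) - \<rho> * x\<bar>"
      proof -
        have "x * \<bar>dens y - \<rho>\<bar> = \<bar>x * (dens y - \<rho>)\<bar>" using x by (simp add: abs_mult)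
        also have "x * (dens y - \<rho>) = real (integer_count p x) - \<rho> * x"
          using x by (simp add: xy[symmetric] field_simps)
        finally show ?thesis .
      qed
      ultimately have "\<bar>real (integer_count p x) - \<rho> * x\<bar> \<le> x * (A * exp (- (a / 2) * y powr expo))"
        by simp
      also have "\<dots> = A * norm (x * exp (- (a / 2) * ln x powr expo))"
        using x by (simp add: y_def)
      finally show ?case by simp
    qed
  qed
  then show ?thesis unfolding integer_cond_def using \<rho>0 AaL by (intro exI[of _ \<rho>] conjI exI[of _ "a / 2"]) auto
qed

end

text \<open>Enlarging the constant covers the bounded range below the threshold of the O-estimate,
  where the difference is at most \<open>B\<close>; this yields the locale assumption.\<close>

theorem prime_cond_imp_integer_cond:
  assumes \<alpha>: "0 < \<alpha>" "\<alpha> \<le> 1" and p: "beurling_system p" "prime_cond \<alpha> p"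
  shows "integer_cond (\<alpha> / (1 + \<alpha>)) p"
proof -
  obtain c where c: "c > 0"
    and O: "(\<lambda>x. real (prime_count p x) - Li x) \<in> O(\<lambda>x. x * exp (- c * ln x powr \<alpha>))"
    using p(2) by (auto simp: prime_cond_def)
  obtain C0 where C0: "C0 > 0"
    and ev: "\<forall>\<^sub>F x in at_top. norm (real (prime_count p x) - Li x) \<le> C0 * norm (x * exp (- c * ln x powr \<alpha>))"
    using landau_o.bigE[OF O] by blast
  obtain x0 where x0: "\<And>x. x \<ge> x0 \<Longrightarrow>
      \<bar>real (prime_count p x) - Li x\<bar> \<le> C0 * \<bar>x * exp (- c * ln x powr \<alpha>)\<bar>"
    using ev by (auto simp: eventually_at_top_linorder)
  define t0 where "t0 = ln (max 1 x0)"
  have t0: "t0 \<ge> 0" "x0 \<le> exp t0" by (auto simp: t0_def)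
  define B where "B = real (prime_count p (exp t0)) + Li (exp t0)"
  have B: "B \<ge> 0" using Li_nonneg[of "exp t0"] t0 by (simp add: B_def)
  define C where "C = C0 + B * exp (c * t0 powr \<alpha>)"
  have C: "C > 0" "C0 \<le> C" "B * exp (c * t0 powr \<alpha>) \<le> C" using C0 B by (auto simp: C_def intro!: add_pos_nonneg)
  have "malliavin p C c \<alpha>"
  proof
    fix t :: real assume t: "t \<ge> 0"
    show "\<bar>real (prime_count p (exp t)) - Li (exp t)\<bar> \<le> C * exp (t - c * t powr \<alpha>)"
    proof (cases "t \<ge> t0")
      case True
      then have "x0 \<le> exp t" using t0 by (meson exp_le_cancel_iff order.trans)
      then have "\<bar>real (prime_count p (exp t)) - Li (exp t)\<bar> \<le> C0 * exp (t - c * t powr \<alpha>)"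
        using x0[of "exp t"] by (simp add: abs_mult exp_diff exp_minus field_simps)
      also have "\<dots> \<le> C * exp (t - c * t powr \<alpha>)" using C by (intro mult_right_mono) auto
      finally show ?thesis .
    next
      case False
      have "prime_count p (exp t) \<le> prime_count p (exp t0)"
        unfolding prime_count_def
      proof (intro card_mono finite_primes_le p(1) subsetI)
        fix i assume "i \<in> {i. p i \<le> exp t}"
        moreover have "exp t \<le> exp t0" using False by simp
        ultimately show "i \<in> {i. p i \<le> exp t0}" by (simp only: mem_Collect_eq)
      qed
      moreover have "Li (exp t) \<le> Li (exp t0)" "0 \<le> Li (exp t)"
        using False t by (auto intro: Li_mono Li_nonneg)
      ultimately have "\<bar>real (prime_count p (exp t)) - Li (exp t)\<bar> \<le> B"
        by (simp add: B_def abs_le_iff)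
      also have "\<dots> = B * exp (c * t0 powr \<alpha>) * exp (- c * t0 powr \<alpha>)"
        by (simp add: mult.assoc flip: exp_add)
      also have "\<dots> \<le> C * exp (- c * t0 powr \<alpha>)"
        using C by (intro mult_right_mono) auto
      also have "\<dots> \<le> C * exp (t - c * t powr \<alpha>)"
      proof -
        have "c * t powr \<alpha> \<le> c * t0 powr \<alpha>"
          using False t c \<alpha> by (intro mult_left_mono powr_mono2) auto
        then show ?thesis using C t by (intro mult_left_mono) auto
      qed
      finally show ?thesis .
    qed
  qed (use \<alpha> p c C in auto)
  then show ?thesis by (rule malliavin.integer_cond_expo)
qed

section \<open>A system with large jumps\<close>

lemma Li_exp_ge: "real n / 2 \<le> Li (exp (real (Suc n)))"
proof (induction n)
  case 0
  then show ?case by (simp add: Li_nonneg)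
next
  case (Suc n)
  let ?j = "real (Suc n)"
  have e2: "1 + ?j \<le> exp ?j" by (rule exp_ge_add_one_self)
  have "2 * exp ?j \<le> exp 1 * exp ?j"
    using exp_ge_add_one_self[of 1] by (intro mult_right_mono) auto
  moreover have "exp (real (Suc (Suc n))) = exp 1 * exp ?j"
    by (simp flip: exp_add)
  ultimately have "exp ?j \<le> exp (real (Suc (Suc n))) - exp ?j"
    by linarith
  then have "(1 + ?j) / (2 * (1 + ?j)) \<le> (exp (real (Suc (Suc n))) - exp ?j) / (2 * ln (exp (real (Suc (Suc n)))))"
    using e2 by (intro frac_le) auto
  moreover have "(exp (real (Suc (Suc n))) - exp ?j) / (2 * ln (exp (real (Suc (Suc n)))))
      \<le> Li (exp (real (Suc (Suc n)))) - Li (exp ?j)"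
    using e2 by (intro Li_diff_ge) auto
  moreover have "(1 + ?j) / (2 * (1 + ?j)) = 1 / 2" by (simp add: field_simps)
  moreover have "real (Suc n) / 2 = real n / 2 + 1 / 2" by simp
  ultimately show ?case using Suc by linarith
qed

definition li_prime :: "nat \<Rightarrow> real" where
  "li_prime i = (SOME x. 1 < x \<and> Li x = real (Suc i))"

lemma li_prime: "1 < li_prime i" "Li (li_prime i) = real (Suc i)"
proof -
  let ?b = "exp (real (Suc (2 * Suc i)))"
  have "\<exists>x. 1 \<le> x \<and> x \<le> ?b \<and> Li x = real (Suc i)"
    using Li_exp_ge[of "2 * Suc i"]
    by (intro IVT' continuous_on_subset[OF continuous_on_Li]) auto
  then obtain x where x: "1 \<le> x" "Li x = real (Suc i)" by blast
  moreover have "x \<noteq> 1" using x(2) by auto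
  ultimately have "1 < x \<and> Li x = real (Suc i)" by simp
  then have "1 < li_prime i \<and> Li (li_prime i) = real (Suc i)"
    unfolding li_prime_def by (rule someI)
  then show "1 < li_prime i" "Li (li_prime i) = real (Suc i)" by auto
qed

lemma li_prime_leD: "li_prime i \<le> x \<Longrightarrow> real (Suc i) \<le> Li x"
  using Li_mono[of "li_prime i" x] li_prime[of i] by simp

lemma li_prime_leI:
  assumes "1 \<le> x" "real (Suc i) < Li x"
  shows "li_prime i \<le> x"
proof (rule ccontr)
  assume "\<not> li_prime i \<le> x"
  then have "Li x \<le> Li (li_prime i)" using assms by (intro Li_mono) auto
  then show False using assms li_prime[of i] by simp
qed

lemma li_prime_gtI:
  assumes "Li x < real (Suc i)"
  shows "x < li_prime i"
  using li_prime_leD[of i x] assms by linarith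

lemma li_prime_mono: "i \<le> i' \<Longrightarrow> li_prime i \<le> li_prime i'"
  using li_prime_leI[of "li_prime i'" i] li_prime[of i'] by (cases "i = i'") auto

lemma li_prime_ge: "real (Suc i) \<le> li_prime i"
  using Li_diff_le[of 1 "li_prime i"] li_prime[of i] by simp

section \<open>Rounding logarithms up inside unit windows\<close>

definition mesh :: "real \<Rightarrow> nat \<Rightarrow> nat" where
  "mesh \<alpha> j = nat \<lceil>exp (real j powr \<alpha>)\<rceil>"

text \<open>For y > 0 this is the j with j < y \<le> j + 1. The window contains its right end, which
  is a lattice point, so rounding up never leaves it.\<close>

definition window :: "real \<Rightarrow> nat" where
  "window y = nat (\<lceil>y\<rceil> - 1)"

definition round_up :: "real \<Rightarrow> real \<Rightarrow> real" where
  "round_up \<alpha> y = of_int \<lceil>real (mesh \<alpha> (window y)) * y\<rceil> / real (mesh \<alpha> (window y))"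

definition lat_prime :: "real \<Rightarrow> nat \<Rightarrow> real" where
  "lat_prime \<alpha> i = exp (round_up \<alpha> (ln (li_prime i)))"

lemma mesh_bounds:
  "exp (real j powr \<alpha>) \<le> real (mesh \<alpha> j)" "0 < mesh \<alpha> j" "real (mesh \<alpha> j) \<le> 2 * exp (real j powr \<alpha>)"
proof -
  have e: "1 \<le> exp (real j powr \<alpha>)" by simp
  show 1: "exp (real j powr \<alpha>) \<le> real (mesh \<alpha> j)" unfolding mesh_def by linarith
  show "0 < mesh \<alpha> j" using 1 e by (cases "mesh \<alpha> j") auto
  show "real (mesh \<alpha> j) \<le> 2 * exp (real j powr \<alpha>)" using e unfolding mesh_def by linarith
qed

lemma window_bounds:
  assumes "y > 0"
  shows "real (window y) < y" "y \<le> real (window y) + 1"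
  using assms unfolding window_def by linarith+

lemma window_eqI:
  assumes "real j < y" "y \<le> real j + 1"
  shows "window y = j"
  using assms window_bounds[of y] by linarith

lemma window_mono: "y \<le> y' \<Longrightarrow> window y \<le> window y'"
  unfolding window_def using ceiling_mono[of y y'] by (intro nat_mono) linarith

lemma round_up_ge: "y \<le> round_up \<alpha> y"
  using mesh_bounds(2)[of \<alpha> "window y"] by (simp add: round_up_def pos_le_divide_eq mult.commute)

lemma round_up_less: "round_up \<alpha> y < y + 1 / real (mesh \<alpha> (window y))"
proof -
  let ?m = "real (mesh \<alpha> (window y))"
  have m: "?m > 0" using mesh_bounds(2) by simp
  have "of_int \<lceil>?m * y\<rceil> < ?m * y + 1" by linarith
  then show ?thesis using m by (simp add: round_up_def field_simps)
qed

lemma ceiling_mesh_bounds: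
  assumes "real j < y" "y \<le> real j + 1"
  shows "int j * int m < \<lceil>real m * y\<rceil> \<or> m = 0" "\<lceil>real m * y\<rceil> \<le> (int j + 1) * int m"
proof -
  show "int j * int m < \<lceil>real m * y\<rceil> \<or> m = 0"
    using assms(1) by (cases "m = 0") (auto simp: less_ceiling_iff mult.commute)
  show "\<lceil>real m * y\<rceil> \<le> (int j + 1) * int m"
    using mult_left_mono[OF assms(2), of "real m"] by (simp add: ceiling_le_iff mult.commute)
qed

lemma round_up_le:
  assumes "y > 0"
  shows "round_up \<alpha> y \<le> real (window y) + 1"
proof -
  let ?m = "mesh \<alpha> (window y)"
  have "real_of_int \<lceil>real ?m * y\<rceil> \<le> real_of_int ((int (window y) + 1) * int ?m)"
    using ceiling_mesh_bounds(2)[OF window_bounds[OF assms], of ?m] by (simp only: of_int_le_iff)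
  then show ?thesis
    using mesh_bounds(2)[of \<alpha> "window y"] by (simp add: round_up_def pos_divide_le_eq)
qed

text \<open>Within a window the mesh is constant; values from different windows are separated by the
  right end of the lower one.\<close>

lemma round_up_mono:
  assumes "0 < y" "y \<le> y'"
  shows "round_up \<alpha> y \<le> round_up \<alpha> y'"
proof (cases "window y = window y'")
  case True
  then show ?thesis
    using assms mesh_bounds(2)[of \<alpha> "window y"]
    by (auto simp: round_up_def intro!: divide_right_mono ceiling_mono mult_left_mono)
next
  case False
  then have "real (window y) + 1 \<le> real (window y')"
    using window_mono[OF assms(2)] by simp
  also have "\<dots> < y'" using window_bounds[of y'] assms by simp
  also have "y' \<le> round_up \<alpha> y'" by (rule round_up_ge)
  finally show ?thesis using round_up_le[OF assms(1), of \<alpha>] by simp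
qed

lemma lat_prime_ge: "li_prime i \<le> lat_prime \<alpha> i"
proof -
  have "li_prime i = exp (ln (li_prime i))" using li_prime(1)[of i] by simp
  also have "\<dots> \<le> lat_prime \<alpha> i" by (simp add: lat_prime_def round_up_ge)
  finally show ?thesis .
qed

lemma beurling_lat_prime: "beurling_system (lat_prime \<alpha>)"
  unfolding beurling_system_def
proof (intro conjI)
  show "mono (lat_prime \<alpha>)"
  proof (rule monoI)
    fix i i' :: nat assume "i \<le> i'"
    then have "ln (li_prime i) \<le> ln (li_prime i')"
      using li_prime_mono[of i i'] li_prime(1)[of i] li_prime(1)[of i'] by simp
    then show "lat_prime \<alpha> i \<le> lat_prime \<alpha> i'"
      unfolding lat_prime_def using li_prime(1)[of i] by (simp add: round_up_mono)
  qed
  show "1 < lat_prime \<alpha> 0" using lat_prime_ge[of 0 \<alpha>] li_prime(1)[of 0] by simp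
  show "\<not> bdd_above (range (lat_prime \<alpha>))"
  proof
    assume "bdd_above (range (lat_prime \<alpha>))"
    then obtain B where B: "\<And>i. lat_prime \<alpha> i \<le> B" by (auto simp: bdd_above_def)
    obtain i where "B < real i" using reals_Archimedean2 by blast
    then show False using B[of i] lat_prime_ge[of i \<alpha>] li_prime_ge[of i] by simp
  qed
qed

lemma card_nat_between:
  assumes "0 \<le> a"
  shows "b - a - 1 \<le> real (card {i :: nat. a < real (Suc i) \<and> real (Suc i) < b})"
proof -
  let ?S = "{i :: nat. a < real (Suc i) \<and> real (Suc i) < b}"
  have "{nat \<lfloor>a\<rfloor>..<nat (\<lceil>b\<rceil> - 1)} \<subseteq> ?S"
    using assms by auto linarith+
  moreover have "finite ?S"
    by (rule finite_subset[of _ "{..nat \<lceil>b\<rceil>}"]) (auto, linarith)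
  ultimately have "card {nat \<lfloor>a\<rfloor>..<nat (\<lceil>b\<rceil> - 1)} \<le> card ?S" by (intro card_mono)
  moreover have "b - a - 1 \<le> real (card {nat \<lfloor>a\<rfloor>..<nat (\<lceil>b\<rceil> - 1)})"
    using assms by simp linarith
  ultimately show ?thesis by linarith
qed

lemma lat_prime_count_upper:
  assumes "x \<ge> 1"
  shows "real (prime_count (lat_prime \<alpha>) x) \<le> Li x"
proof -
  have "{i. lat_prime \<alpha> i \<le> x} \<subseteq> {..<nat \<lfloor>Li x\<rfloor>}"
  proof
    fix i assume "i \<in> {i. lat_prime \<alpha> i \<le> x}"
    then have "real (Suc i) \<le> Li x"
      using lat_prime_ge[of i \<alpha>] by (intro li_prime_leD) auto
    then show "i \<in> {..<nat \<lfloor>Li x\<rfloor>}" by simp linarith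
  qed
  then have "prime_count (lat_prime \<alpha>) x \<le> nat \<lfloor>Li x\<rfloor>"
    unfolding prime_count_def using card_mono[OF finite_lessThan] by fastforce
  then show ?thesis using Li_nonneg[OF assms] by linarith
qed

text \<open>Every Li-prime up to exp (y - 1 / m) stays \<le> exp y: in the window of y the shift is
  below 1 / m, and earlier windows end before y. By \<open>Li_diff_le\<close> the lost range has
  \<open>Li\<close>-mass at most exp y / m; passing to integers costs 1.\<close>

lemma lat_prime_count_lower:
  assumes y: "y \<ge> 2"
  shows "Li (exp y) - exp y / real (mesh \<alpha> (window y)) - 1 \<le> real (prime_count (lat_prime \<alpha>) (exp y))"
proof -
  let ?m = "real (mesh \<alpha> (window y))"
  define x' where "x' = exp (y - 1 / ?m)"
  have m: "?m \<ge> 1" using mesh_bounds(2)[of \<alpha> "window y"] by simp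
  then have m1: "1 / ?m \<le> 1" by simp
  have "1 / ?m \<le> y" using y m1 by linarith
  then have x': "1 \<le> x'" "x' \<le> exp y" using m by (simp_all add: x'_def)
  have "{i. 0 < real (Suc i) \<and> real (Suc i) < Li x'} \<subseteq> {i. lat_prime \<alpha> i \<le> exp y}"
  proof safe
    fix i assume "real (Suc i) < Li x'"
    then have "li_prime i \<le> x'" using x' by (intro li_prime_leI)
    then have "ln (li_prime i) \<le> ln x'"
      using li_prime(1)[of i] x' by (subst ln_le_cancel_iff) auto
    then have u: "ln (li_prime i) \<le> y - 1 / ?m" by (simp add: x'_def)
    have u0: "0 < ln (li_prime i)" using li_prime(1)[of i] by simp
    have "round_up \<alpha> (ln (li_prime i)) \<le> y"
    proof (cases "window (ln (li_prime i)) = window y")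
      case True
      then show ?thesis using round_up_less[of \<alpha> "ln (li_prime i)"] u by simp
    next
      case False
      have "0 < 1 / ?m" using m by simp
      then have "ln (li_prime i) \<le> y" using u by linarith
      then have "window (ln (li_prime i)) < window y"
        using False window_mono[of "ln (li_prime i)" y] by simp
      then show ?thesis
        using round_up_le[OF u0, of \<alpha>] window_bounds[of y] y by linarith
    qed
    then show "lat_prime \<alpha> i \<le> exp y" by (simp add: lat_prime_def)
  qed
  then have "card {i. 0 < real (Suc i) \<and> real (Suc i) < Li x'} \<le> prime_count (lat_prime \<alpha>) (exp y)"
    unfolding prime_count_def by (intro card_mono finite_primes_le beurling_lat_prime)
  then have "Li x' - 1 \<le> real (prime_count (lat_prime \<alpha>) (exp y))"
    using card_nat_between[of 0 "Li x'"] by linarith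
  moreover have "Li (exp y) - Li x' \<le> exp y / ?m"
  proof -
    have "Li (exp y) - Li x' \<le> exp y - x'" using x' by (intro Li_diff_le)
    also have "\<dots> = exp y * (1 - exp (- (1 / ?m)))"
      by (simp add: x'_def exp_diff exp_minus field_simps)
    also have "\<dots> \<le> exp y * (1 / ?m)"
      using exp_ge_add_one_self[of "- (1 / ?m)"] by (intro mult_left_mono) auto
    finally show ?thesis by simp
  qed
  ultimately show ?thesis by linarith
qed

text \<open>Rounding up only lowers the count. The window index is at least y - 1 \<ge> y / 2, so
  the mesh is at least exp (y^\<alpha> / 2), which gives the constant 1 / 2; the factor 2 accounts
  for the additional loss of 1.\<close>

lemma prime_cond_lat_prime:
  assumes \<alpha>: "0 < \<alpha>" "\<alpha> \<le> 1"
  shows "prime_cond \<alpha> (lat_prime \<alpha>)"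
proof -
  have "(\<lambda>x. real (prime_count (lat_prime \<alpha>) x) - Li x) \<in> O(\<lambda>x. x * exp (- (1 / 2) * ln x powr \<alpha>))"
  proof (rule bigoI[of _ 2])
    show "\<forall>\<^sub>F x in at_top. norm (real (prime_count (lat_prime \<alpha>) x) - Li x)
        \<le> 2 * norm (x * exp (- (1 / 2) * ln x powr \<alpha>))"
      using eventually_ge_at_top[of "exp 2"]
    proof eventually_elim
      case (elim x)
      have x: "x > 0" using elim by (smt (verit) exp_gt_zero)
      define y where "y = ln x"
      have y: "y \<ge> 2" using elim x by (simp add: y_def ln_ge_iff)
      have xy: "x = exp y" using x by (simp add: y_def)
      let ?E = "exp (- (1 / 2) * y powr \<alpha>)"
      have "1 \<le> x * ?E"
      proof -
        have "y powr \<alpha> \<le> y powr 1" using y \<alpha> by (intro powr_mono) auto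
        then show ?thesis using y by (simp add: xy flip: exp_add)
      qed
      moreover have "exp y / real (mesh \<alpha> (window y)) \<le> x * ?E"
      proof -
        have "y powr \<alpha> / 2 \<le> real (window y) powr \<alpha>"
        proof -
          have "(1 / 2 :: real) powr 1 \<le> (1 / 2) powr \<alpha>" using \<alpha> by (intro powr_mono') auto
          then have "y powr \<alpha> / 2 \<le> (1 / 2) powr \<alpha> * y powr \<alpha>"
            using mult_right_mono[of "1 / 2" "(1 / 2) powr \<alpha>" "y powr \<alpha>"] by simp
          also have "\<dots> = (y / 2) powr \<alpha>" using y by (simp add: powr_mult[symmetric])
          also have "\<dots> \<le> real (window y) powr \<alpha>"
            using y \<alpha> window_bounds[of y] by (intro powr_mono2) auto
          finally show ?thesis .
        qed
        then have "exp (y powr \<alpha> / 2) \<le> real (mesh \<alpha> (window y))"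
          using mesh_bounds(1)[of "window y" \<alpha>] by (meson exp_le_cancel_iff order.trans)
        then have "exp y / real (mesh \<alpha> (window y)) \<le> exp y / exp (y powr \<alpha> / 2)"
          by (intro divide_left_mono mult_pos_pos) (auto intro: mesh_bounds(2))
        then show ?thesis by (simp add: xy exp_minus field_simps)
      qed
      moreover have "real (prime_count (lat_prime \<alpha>) x) \<le> Li x"
        using x y xy by (intro lat_prime_count_upper) simp
      moreover note lat_prime_count_lower[OF y, of \<alpha>]
      ultimately have "\<bar>real (prime_count (lat_prime \<alpha>) x) - Li x\<bar> \<le> 2 * (x * ?E)"
        unfolding xy by linarith
      then show ?case using x by (simp add: y_def)
    qed
  qed
  then show ?thesis unfolding prime_cond_def by (intro exI[of _ "1 / 2"]) simp
qed

text \<open>All products of \<open>n\<close> primes from the window \<open>(exp j, exp (j + 1)]\<close> lie on \<open>n * mesh \<alpha> j\<close>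
  points, so at one of these points the integer counting function has a large jump.\<close>

lemma large_jump:
  assumes n: "0 < n" and W: "W \<subseteq> {i. exp (real j) < li_prime i \<and> li_prime i \<le> exp (real j + 1)}"
    and fin: "finite W"
  shows "\<exists>y. real (n * j) < y \<and> y \<le> real (n * (j + 1)) \<and>
    (\<forall>y'<y. real (card W choose n)
      \<le> real (n * mesh \<alpha> j) * (real (integer_count (lat_prime \<alpha>) (exp y)) - real (integer_count (lat_prime \<alpha>) (exp y'))))"
proof -
  let ?p = "lat_prime \<alpha>" and ?m = "mesh \<alpha> j"
  have m: "?m > 0" by (rule mesh_bounds)
  define k where "k i = \<lceil>real ?m * ln (li_prime i)\<rceil>" for i
  have Wi: "real j < ln (li_prime i)" "ln (li_prime i) \<le> real j + 1" if "i \<in> W" for i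
  proof -
    have i: "exp (real j) < li_prime i" "li_prime i \<le> exp (real j + 1)" using W that by auto
    have pos: "0 < li_prime i" using li_prime(1)[of i] by simp
    show "real j < ln (li_prime i)" using ln_less_cancel_iff[of "exp (real j)" "li_prime i"] i pos by simp
    show "ln (li_prime i) \<le> real j + 1" using ln_le_cancel_iff[of "li_prime i" "exp (real j + 1)"] i pos by simp
  qed
  have lat: "?p i = exp (of_int (k i) / real ?m)" if "i \<in> W" for i
    using window_eqI[OF Wi[OF that]] by (simp add: lat_prime_def round_up_def k_def)
  have k: "int j * int ?m < k i" "k i \<le> (int j + 1) * int ?m" if "i \<in> W" for i
    using ceiling_mesh_bounds[OF Wi[OF that], of ?m] m by (auto simp: k_def)
  \<comment> \<open>Sets of n distinct primes are counted by a binomial coefficient, and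
    \<open>mset_set\<close> sends them injectively to generalized integers.\<close>
  define F where "F = {A. A \<subseteq> W \<and> card A = n}"
  \<comment> \<open>Each ceiling lies strictly above j m and is at most (j + 1) m, so a sum of n of
    them has n m possible values: the pigeonholes.\<close>
  define V where "V = {int (n * j) * int ?m<..int (n * (j + 1)) * int ?m}"
  have cardF: "card F = card W choose n" unfolding F_def by (rule n_subsets[OF fin])
  have finF: "finite F" unfolding F_def using fin by simp
  have finA: "finite A" if "A \<in> F" for A using that fin by (auto simp: F_def intro: finite_subset)
  have cardV: "card V = n * ?m" by (simp add: V_def algebra_simps nat_mult_distrib)
  have FV: "(\<lambda>A. \<Sum>i\<in>A. k i) \<in> F \<rightarrow> V"
  proof
    fix A assume A: "A \<in> F"
    then have A': "A \<subseteq> W" "card A = n" "A \<noteq> {}" using n by (auto simp: F_def)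
    have "(\<Sum>i\<in>A. int j * int ?m) < (\<Sum>i\<in>A. k i)"
      using A' finA[OF A] k by (intro sum_strict_mono) auto
    moreover have "(\<Sum>i\<in>A. k i) \<le> (\<Sum>i\<in>A. (int j + 1) * int ?m)"
      using A' k by (intro sum_mono) auto
    ultimately show "(\<Sum>i\<in>A. k i) \<in> V" using A' by (simp add: V_def algebra_simps)
  qed
  have "V \<noteq> {}" using cardV n m by auto
  then obtain v where v: "v \<in> V"
    and pig: "card F \<le> card ((\<lambda>A. \<Sum>i\<in>A. k i) -` {v} \<inter> F) * card V"
    using pigeonhole_card[OF FV finF] by (auto simp: V_def)
  define J where "J = (\<lambda>A. \<Sum>i\<in>A. k i) -` {v} \<inter> F"
  define y where "y = of_int v / real ?m"
  have val: "gen_int_value ?p (mset_set A) = exp y" if "A \<in> J" for A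
  proof -
    have A: "A \<in> F" "(\<Sum>i\<in>A. k i) = v" using that by (auto simp: J_def)
    have "gen_int_value ?p (mset_set A) = (\<Prod>i\<in>A. ?p i)"
      by (simp add: gen_int_value_def prod_unfold_prod_mset)
    also have "\<dots> = (\<Prod>i\<in>A. exp (of_int (k i) / real ?m))"
      using A by (intro prod.cong refl lat) (auto simp: F_def)
    also have "\<dots> = exp (\<Sum>i\<in>A. of_int (k i) / real ?m)"
      using finA[OF A(1)] by (simp add: exp_sum)
    also have "(\<Sum>i\<in>A. of_int (k i) / real ?m) = y"
      unfolding y_def A(2)[symmetric] by (simp add: sum_divide_distrib)
    finally show ?thesis .
  qed
  \<comment> \<open>All members of \<open>J\<close> have exactly the value exp y, so they are
    counted at y and at no y' < y, however close.\<close>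
  have jump: "real (card J) \<le> real (integer_count ?p (exp y)) - real (integer_count ?p (exp y'))" if "y' < y" for y'
  proof -
    have "mset_set ` J \<union> {M. gen_int_value ?p M \<le> exp y'} \<subseteq> {M. gen_int_value ?p M \<le> exp y}"
    proof -
      have "exp y' \<le> exp y" using that by simp
      then show ?thesis using val by (auto intro: order.trans)
    qed
    then have "card (mset_set ` J \<union> {M. gen_int_value ?p M \<le> exp y'}) \<le> integer_count ?p (exp y)"
      unfolding integer_count_def by (intro card_mono finite_gen_ints_le beurling_lat_prime)
    moreover have "card (mset_set ` J \<union> {M. gen_int_value ?p M \<le> exp y'})
        = card (mset_set ` J) + card {M. gen_int_value ?p M \<le> exp y'}"
    proof (rule card_Un_disjoint)
      show "finite (mset_set ` J)" using finF by (simp add: J_def)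
      show "finite {M. gen_int_value ?p M \<le> exp y'}" by (intro finite_gen_ints_le beurling_lat_prime)
      show "mset_set ` J \<inter> {M. gen_int_value ?p M \<le> exp y'} = {}"
        using val that by auto
    qed
    moreover have "card (mset_set ` J) = card J"
    proof (rule card_image, rule inj_onI)
      fix A B assume "A \<in> J" "B \<in> J" "mset_set A = mset_set B"
      then show "A = B"
        using finA by (metis IntD2 J_def finite_set_mset_mset_set)
    qed
    ultimately show ?thesis by (simp add: integer_count_def)
  qed
  have "real (card W choose n)
      \<le> real (n * ?m) * (real (integer_count ?p (exp y)) - real (integer_count ?p (exp y')))" if "y' < y" for y'
  proof -
    have "card W choose n \<le> card J * (n * ?m)"
      using pig unfolding cardF cardV J_def .
    then have "real (card W choose n) \<le> real (n * ?m) * real (card J)"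
      by (metis mult.commute of_nat_le_iff of_nat_mult)
    also have "\<dots> \<le> real (n * ?m) * (real (integer_count ?p (exp y)) - real (integer_count ?p (exp y')))"
      by (intro mult_left_mono jump that) auto
    finally show ?thesis .
  qed
  moreover have "real (n * j) < y \<and> y \<le> real (n * (j + 1))"
  proof -
    have "int (n * j) * int ?m < v" "v \<le> int (n * (j + 1)) * int ?m" using v by (auto simp: V_def)
    then have "real_of_int (int (n * j) * int ?m) < of_int v" "of_int v \<le> real_of_int (int (n * (j + 1)) * int ?m)"
      by (simp_all only: of_int_less_iff of_int_le_iff)
    then show ?thesis using m by (simp add: y_def pos_less_divide_eq pos_divide_le_eq)
  qed
  ultimately show ?thesis by blast
qed

section \<open>Comparing the jump with the error term\<close>

lemma window_primes:
  assumes j: "300 \<le> j"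
  defines "W \<equiv> {i. exp (real j) < li_prime i \<and> li_prime i \<le> exp (real j + 1)}"
  shows "finite W" "exp (real j) / (4 * (real j + 1)) \<le> real (card W)" "2 * real j \<le> real (card W)"
proof -
  let ?e = "exp (real j)"
  have "W \<subseteq> {i. real (Suc i) \<le> Li (exp (real j + 1))}"
    using li_prime_leD by (auto simp: W_def)
  also have "\<dots> \<subseteq> {..nat \<lceil>Li (exp (real j + 1))\<rceil>}"
    by (auto, linarith)
  finally show fin: "finite W" by (rule finite_subset) simp
  \<comment> \<open>exp j is at least (j / 3)^3, and 216 = 8 * 27; the assumption j \<ge> 300
    ensures 216 (j + 1) \<le> 300 j \<le> j^2.\<close>
  have big: "8 * real j * (real j + 1) \<le> ?e"
  proof -
    have "(1 + real j / 3) ^ 3 \<le> ?e"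
      using exp_ge_one_plus_x_over_n_power_n[of 3 "real j"] by simp
    moreover have "(real j / 3) ^ 3 \<le> (1 + real j / 3) ^ 3" by (intro power_mono) auto
    moreover have "8 * real j * (real j + 1) \<le> (real j / 3) ^ 3"
    proof -
      have "216 * (real j + 1) \<le> 300 * real j" using j by simp
      also have "\<dots> \<le> real j * real j" using j by (intro mult_right_mono) auto
      finally have "real j * (216 * (real j + 1)) \<le> real j * (real j * real j)" by (intro mult_left_mono) auto
      moreover have "(real j / 3) ^ 3 = real j * (real j * real j) / 27"
        by (simp add: power3_eq_cube)
      ultimately show ?thesis by (simp add: algebra_simps)
    qed
    ultimately show ?thesis by linarith
  qed
  have e1: "2 * ?e \<le> exp (real j + 1)"
    using exp_ge_add_one_self[of 1] mult_right_mono[of 2 "exp 1" ?e] by (simp add: exp_add mult.commute)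
  have "8 * 1 * 1 \<le> 8 * real j * (real j + 1)" using j by (intro mult_mono) auto
  then have e2: "2 \<le> ?e" using big by linarith
  have "?e / (2 * (real j + 1)) \<le> (exp (real j + 1) - ?e) / (2 * ln (exp (real j + 1)))"
    using e1 by (simp add: divide_right_mono)
  also have "\<dots> \<le> Li (exp (real j + 1)) - Li ?e"
    using e2 by (intro Li_diff_ge) auto
  finally have 1: "?e / (2 * (real j + 1)) \<le> Li (exp (real j + 1)) - Li ?e" .
  have "{i. Li ?e < real (Suc i) \<and> real (Suc i) < Li (exp (real j + 1))} \<subseteq> W"
    by (auto simp: W_def simp del: of_nat_Suc intro!: li_prime_leI li_prime_gtI)
  then have "card {i. Li ?e < real (Suc i) \<and> real (Suc i) < Li (exp (real j + 1))} \<le> card W"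
    by (intro card_mono fin)
  moreover have "Li (exp (real j + 1)) - Li ?e - 1
      \<le> real (card {i. Li ?e < real (Suc i) \<and> real (Suc i) < Li (exp (real j + 1))})"
    by (intro card_nat_between Li_nonneg) simp
  ultimately have 2: "?e / (2 * (real j + 1)) - 1 \<le> real (card W)" using 1 by linarith
  have q: "2 * real j \<le> ?e / (4 * (real j + 1))"
    using big by (simp add: pos_le_divide_eq algebra_simps)
  have "X / (2 * (real j + 1)) = 2 * (X / (4 * (real j + 1)))" for X :: real by (simp add: field_simps)
  moreover have "1 \<le> real j" using j by simp
  ultimately show "?e / (4 * (real j + 1)) \<le> real (card W)" using 2 q by (simp only:)
  then show "2 * real j \<le> real (card W)" using q by linarith
qed

text \<open>As y' tends to y from the left the main terms cancel, so a jump is at most the sum of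
  two error terms. The decay is evaluated at z, a lower bound for the logarithms involved.\<close>

lemma integer_cond_jump:
  assumes "integer_cond \<beta> p"
  shows "\<exists>C>0. \<exists>c>0. \<exists>y0. \<forall>z y B. y0 \<le> z \<longrightarrow> 0 \<le> z \<longrightarrow> z < y \<longrightarrow> 0 \<le> \<beta> \<longrightarrow>
    (\<forall>y'<y. B \<le> real (integer_count p (exp y)) - real (integer_count p (exp y'))) \<longrightarrow>
    B \<le> C * exp (y - c * z powr \<beta>)"
proof -
  obtain \<rho> c where \<rho>: "\<rho> > 0" and c: "c > 0"
    and O: "(\<lambda>x. real (integer_count p x) - \<rho> * x) \<in> O(\<lambda>x. x * exp (- c * ln x powr \<beta>))"
    using assms by (auto simp: integer_cond_def)
  obtain C where C: "C > 0"
    and ev: "\<forall>\<^sub>F x in at_top. norm (real (integer_count p x) - \<rho> * x) \<le> C * norm (x * exp (- c * ln x powr \<beta>))"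
    using landau_o.bigE[OF O] by blast
  obtain x0 where x0: "\<And>x. x \<ge> x0 \<Longrightarrow>
      \<bar>real (integer_count p x) - \<rho> * x\<bar> \<le> C * \<bar>x * exp (- c * ln x powr \<beta>)\<bar>"
    using ev by (auto simp: eventually_at_top_linorder)
  have "B \<le> (2 * C) * exp (y - c * z powr \<beta>)"
    if z: "ln (max 1 x0) \<le> z" "0 \<le> z" "z < y" "0 \<le> \<beta>"
      and B: "\<forall>y'<y. B \<le> real (integer_count p (exp y)) - real (integer_count p (exp y'))" for z y B
  proof -
    have err: "\<bar>real (integer_count p (exp u)) - \<rho> * exp u\<bar> \<le> C * exp (y - c * z powr \<beta>)"
      if u: "z \<le> u" "u \<le> y" for u
    proof -
      have "max 1 x0 \<le> exp u"
        using z(1) u(1) by (metis exp_le_cancel_iff exp_ln less_max_iff_disj order.trans zero_less_one)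
      then have "\<bar>real (integer_count p (exp u)) - \<rho> * exp u\<bar> \<le> C * \<bar>exp u * exp (- c * u powr \<beta>)\<bar>"
        using x0[of "exp u"] by simp
      also have "\<dots> = C * exp (u - c * u powr \<beta>)" by (simp add: abs_mult flip: exp_add)
      also have "\<dots> \<le> C * exp (y - c * z powr \<beta>)"
      proof -
        have "c * z powr \<beta> \<le> c * u powr \<beta>"
          using u z c by (intro mult_left_mono powr_mono2) auto
        then show ?thesis using u C by (intro mult_left_mono) auto
      qed
      finally show ?thesis .
    qed
    have lim: "((\<lambda>y'. 2 * C * exp (y - c * z powr \<beta>) + \<rho> * (exp y - exp y')) \<longlongrightarrow>
        2 * C * exp (y - c * z powr \<beta>) + \<rho> * (exp y - exp y)) (at_left y)"
      by (intro tendsto_intros)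
    have "\<forall>\<^sub>F y' in at_left y. B \<le> 2 * C * exp (y - c * z powr \<beta>) + \<rho> * (exp y - exp y')"
      using eventually_at_left_real[OF z(3)]
    proof eventually_elim
      case (elim y')
      then have "B \<le> real (integer_count p (exp y)) - real (integer_count p (exp y'))"
        using B by simp
      then show ?case
        using err[of y] err[of y'] elim z by (simp add: right_diff_distrib)
    qed
    from tendsto_lowerbound[OF lim this] show ?thesis by simp
  qed
  then show ?thesis using C c by (intro exI[of _ "2 * C"] conjI exI[of _ c] exI[of _ "ln (max 1 x0)"]) auto
qed

text \<open>After cancelling exp (n j), the size of the jump forces (n j)^\<beta> = O(j^\<alpha> ln
  j). But (n j)^\<beta> is at least j^((1 + \<alpha>) \<beta>), and (1 + \<alpha>) \<beta> >
  \<alpha>.\<close>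

theorem not_integer_cond_lat_prime:
  assumes \<alpha>: "0 < \<alpha>" "\<alpha> \<le> 1" and \<beta>: "\<alpha> / (1 + \<alpha>) < \<beta>"
  shows "\<not> integer_cond \<beta> (lat_prime \<alpha>)"
proof
  assume "integer_cond \<beta> (lat_prime \<alpha>)"
  then obtain C c y0 where Cc: "C > 0" "c > 0"
    and J: "\<And>z y B. y0 \<le> z \<Longrightarrow> 0 \<le> z \<Longrightarrow> z < y \<Longrightarrow> 0 \<le> \<beta> \<Longrightarrow>
    (\<forall>y'<y. B \<le> real (integer_count (lat_prime \<alpha>) (exp y)) - real (integer_count (lat_prime \<alpha>) (exp y'))) \<Longrightarrow>
    B \<le> C * exp (y - c * z powr \<beta>)"
    using integer_cond_jump by blast
  have \<beta>0: "\<beta> > 0" using \<alpha> \<beta> by (meson add_pos_pos divide_pos_pos less_trans zero_less_one)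
  \<comment> \<open>Half the surplus of the exponents: one \<kappa> absorbs ln j through ln j \<le>
    j^\<kappa> / \<kappa>, the other is left for the contradiction.\<close>
  define \<kappa> where "\<kappa> = ((1 + \<alpha>) * \<beta> - \<alpha>) / 2"
  have \<kappa>: "\<kappa> > 0" using \<alpha> \<beta> by (simp add: \<kappa>_def field_simps)
  define K where "K = \<bar>ln C\<bar> + 2 * ln 2 + 1 / \<kappa> + 3 + 2 * ln 16 + 4 / \<kappa>"
  have K: "K > 0" using \<kappa> by (simp add: K_def add_nonneg_pos add_pos_nonneg)
  \<comment> \<open>Large enough for \<open>window_primes\<close>, for the threshold
    \<open>y0\<close>, and for c j^\<kappa> > K.\<close>
  define j where "j = nat \<lceil>max 300 (max y0 ((K / c + 1) powr (1 / \<kappa>)))\<rceil>"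
  have "max 300 (max y0 ((K / c + 1) powr (1 / \<kappa>))) \<le> real j" unfolding j_def by linarith
  then have j: "300 \<le> j" "y0 \<le> real j" "(K / c + 1) powr (1 / \<kappa>) \<le> real j" by auto
  let ?j = "real j"
  have j1: "1 \<le> ?j" using j by simp
  have j\<alpha>: "1 \<le> ?j powr \<alpha>" "?j powr \<alpha> \<le> ?j"
    using j1 \<alpha> powr_mono[of \<alpha> 1 ?j] by (auto simp: ge_one_powr_ge_zero)
  define n where "n = nat \<lceil>?j powr \<alpha>\<rceil>"
  have n: "?j powr \<alpha> \<le> real n" "real n \<le> 2 * ?j powr \<alpha>" "1 \<le> real n"
    using j\<alpha> unfolding n_def by linarith+
  then have n0: "0 < n" by simp
  define W where "W = {i. exp ?j < li_prime i \<and> li_prime i \<le> exp (?j + 1)}"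
  have W: "finite W" "exp ?j / (4 * (?j + 1)) \<le> real (card W)" "2 * ?j \<le> real (card W)"
    using window_primes[OF j(1)] by (simp_all add: W_def)
  let ?m = "real (mesh \<alpha> j)"
  have m: "?m > 0" "?m \<le> 2 * exp (?j powr \<alpha>)" using mesh_bounds(2,3)[of \<alpha> j] by auto
  obtain y where y: "real (n * j) < y" "y \<le> real (n * (j + 1))"
    and jump: "\<And>y'. y' < y \<Longrightarrow> real (card W choose n) \<le> real (n * mesh \<alpha> j) *
      (real (integer_count (lat_prime \<alpha>) (exp y)) - real (integer_count (lat_prime \<alpha>) (exp y')))"
    using large_jump[OF n0 _ W(1), where j = j and \<alpha> = \<alpha>] unfolding W_def by blast
  have nj: "?j \<le> real (n * j)" using mult_right_mono[OF n(3), of ?j] by simp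
  \<comment> \<open>Applied with z = n j; y exceeds this by at most n = O(j^\<alpha>), a term of the
    size of the other losses.\<close>
  have "real (card W choose n) / (real n * ?m) \<le> C * exp (y - c * real (n * j) powr \<beta>)"
  proof (rule J)
    show "y0 \<le> real (n * j)" using nj j(2) by linarith
    show "\<forall>y'<y. real (card W choose n) / (real n * ?m)
        \<le> real (integer_count (lat_prime \<alpha>) (exp y)) - real (integer_count (lat_prime \<alpha>) (exp y'))"
      using jump n0 m by (simp add: pos_divide_le_eq mult_ac)
  qed (use y \<beta>0 in auto)
  also have "\<dots> \<le> C * exp (real n * ?j + real n - c * real (n * j) powr \<beta>)"
    using y(2) Cc by (intro mult_left_mono) (auto simp: algebra_simps)
  finally have 1: "real (card W choose n) \<le> real n * ?m * (C * exp (real n * ?j + real n - c * real (n * j) powr \<beta>))"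
    using n0 m by (simp add: pos_divide_le_eq mult_ac)
  have "n \<le> card W" using n(2) j\<alpha>(2) W(3) by linarith
  then have "(real (card W) / real n) ^ n \<le> real (card W choose n)"
    by (rule binomial_ge_n_over_k_pow_k)
  moreover have "(exp ?j / (4 * (?j + 1) * real n)) ^ n \<le> (real (card W) / real n) ^ n"
  proof (rule power_mono)
    have "exp ?j / (4 * (?j + 1)) / real n \<le> real (card W) / real n"
      using W(2) by (rule divide_right_mono) simp
    then show "exp ?j / (4 * (?j + 1) * real n) \<le> real (card W) / real n" by simp
  qed auto
  moreover have "(exp ?j / (4 * (?j + 1) * real n)) ^ n = exp (real n * ?j - real n * ln (4 * (?j + 1) * real n))"
  proof -
    have "exp ?j / (4 * (?j + 1) * real n) = exp (?j - ln (4 * (?j + 1) * real n))"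
      using n0 by (simp add: exp_diff)
    then show ?thesis by (simp add: exp_of_nat_mult[symmetric] right_diff_distrib)
  qed
  moreover have "real n * ?m * (C * exp (real n * ?j + real n - c * real (n * j) powr \<beta>))
      = exp (ln (real n) + ln ?m + ln C + real n * ?j + real n - c * real (n * j) powr \<beta>)"
    using n0 m Cc by (simp add: exp_add exp_diff)
  ultimately have "exp (real n * ?j - real n * ln (4 * (?j + 1) * real n))
      \<le> exp (ln (real n) + ln ?m + ln C + real n * ?j + real n - c * real (n * j) powr \<beta>)"
    using 1 by linarith
  then have 2: "c * real (n * j) powr \<beta> \<le> ln (real n) + ln ?m + ln C + real n + real n * ln (4 * (?j + 1) * real n)"
    by simp
  define P where "P = ?j powr (\<alpha> + \<kappa>)"
  have P1: "1 \<le> P" using j1 \<alpha> \<kappa> by (simp add: P_def ge_one_powr_ge_zero)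
  have P\<alpha>: "?j powr \<alpha> \<le> P" unfolding P_def using j1 \<kappa> by (intro powr_mono) auto
  have lnj: "ln ?j \<le> ?j powr \<kappa> / \<kappa>" using j1 \<kappa> by (rule ln_powr_bound)
  have P\<alpha>l: "?j powr \<alpha> * ln ?j \<le> P / \<kappa>"
  proof -
    have "?j powr \<alpha> * ln ?j \<le> ?j powr \<alpha> * (?j powr \<kappa> / \<kappa>)" using lnj by (intro mult_left_mono) auto
    then show ?thesis by (simp add: P_def powr_add)
  qed
  have lnj0: "0 \<le> ln ?j" using j1 by simp
  have Pl: "ln ?j \<le> P / \<kappa>"
    using P\<alpha>l mult_right_mono[OF j\<alpha>(1) lnj0] by linarith
  have b1: "ln (real n) \<le> ln 2 + ln ?j"
  proof -
    have "real n \<le> 2 * ?j" using n(2) j\<alpha>(2) by linarith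
    then have "ln (real n) \<le> ln (2 * ?j)" using n0 j1 by (subst ln_le_cancel_iff) simp_all
    then show ?thesis using j1 by (simp add: ln_mult)
  qed
  have b2: "ln ?m \<le> ln 2 + ?j powr \<alpha>"
  proof -
    have "ln ?m \<le> ln (2 * exp (?j powr \<alpha>))" using m by (subst ln_le_cancel_iff) auto
    then show ?thesis by (simp add: ln_mult)
  qed
  have b3: "real n * ln (4 * (?j + 1) * real n) \<le> 2 * ?j powr \<alpha> * (ln 16 + 2 * ln ?j)"
  proof -
    have "4 * (?j + 1) * real n \<le> (8 * ?j) * (2 * ?j)"
    proof (rule mult_mono)
      show "4 * (?j + 1) \<le> 8 * ?j" using j1 by (simp add: algebra_simps)
      show "real n \<le> 2 * ?j" using n(2) j\<alpha>(2) by linarith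
    qed auto
    then have "ln (4 * (?j + 1) * real n) \<le> ln (16 * (?j * ?j))"
      using n0 j1 by (subst ln_le_cancel_iff) auto
    also have "\<dots> = ln 16 + 2 * ln ?j" using j1 by (simp add: ln_mult)
    finally have "real n * ln (4 * (?j + 1) * real n) \<le> real n * (ln 16 + 2 * ln ?j)"
      by (intro mult_left_mono) auto
    also have "\<dots> \<le> 2 * ?j powr \<alpha> * (ln 16 + 2 * ln ?j)"
      using n(2) lnj0 by (intro mult_right_mono) auto
    finally show ?thesis .
  qed
  have l2: "0 \<le> ln (2 :: real)" "0 \<le> ln (16 :: real)" by simp_all
  have "ln (real n) + ln ?m + ln C + real n + real n * ln (4 * (?j + 1) * real n)
      \<le> (ln 2 + ln ?j) + (ln 2 + ?j powr \<alpha>) + \<bar>ln C\<bar> + 2 * ?j powr \<alpha>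
        + (2 * ln 16 * ?j powr \<alpha> + 4 * (?j powr \<alpha> * ln ?j))"
    using b1 b2 b3 n(2) by (simp add: algebra_simps)
  also have "\<dots> \<le> (2 * ln 2 * P + P / \<kappa>) + \<bar>ln C\<bar> * P + 3 * P + (2 * ln 16 * P + 4 * (P / \<kappa>))"
  proof -
    have "ln 2 * 1 \<le> ln 2 * P" "\<bar>ln C\<bar> * 1 \<le> \<bar>ln C\<bar> * P" "2 * ln 16 * ?j powr \<alpha> \<le> 2 * ln 16 * P"
      using P1 P\<alpha> l2 by (intro mult_left_mono; simp)+
    then show ?thesis using Pl P\<alpha>l P\<alpha> by linarith
  qed
  also have "\<dots> = K * P" by (simp add: K_def algebra_simps)
  finally have 3: "c * real (n * j) powr \<beta> \<le> K * P" using 2 by linarith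
  have "P * ?j powr \<kappa> \<le> real (n * j) powr \<beta>"
  proof -
    have e: "\<alpha> + \<kappa> + \<kappa> = (1 + \<alpha>) * \<beta>" by (simp add: \<kappa>_def)
    have "P * ?j powr \<kappa> = ?j powr ((1 + \<alpha>) * \<beta>)"
      unfolding e[symmetric] P_def by (simp only: powr_add)
    also have "\<dots> = (?j powr (1 + \<alpha>)) powr \<beta>" by (simp add: powr_powr)
    also have "\<dots> \<le> real (n * j) powr \<beta>"
    proof (rule powr_mono2)
      have "?j powr (1 + \<alpha>) = ?j powr \<alpha> * ?j" using j1 by (simp add: powr_add)
      also have "\<dots> \<le> real n * ?j" using n(1) by (intro mult_right_mono) auto
      finally show "?j powr (1 + \<alpha>) \<le> real (n * j)" by simp
    qed (use \<beta>0 in auto)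
    finally show ?thesis .
  qed
  then have "c * (P * ?j powr \<kappa>) \<le> K * P" using 3 Cc by (smt (verit) mult_left_mono)
  then have "(c * ?j powr \<kappa>) * P \<le> K * P" by (simp add: mult_ac)
  then have 4: "c * ?j powr \<kappa> \<le> K" using P1 by simp
  have "K / c + 1 = ((K / c + 1) powr (1 / \<kappa>)) powr \<kappa>"
    using \<kappa> K Cc by (simp add: powr_powr add_nonneg_pos)
  also have "\<dots> \<le> ?j powr \<kappa>" using j(3) \<kappa> by (intro powr_mono2) auto
  finally have "K + c \<le> c * ?j powr \<kappa>"
    using Cc by (simp add: field_simps)
  then show False using 4 Cc by linarith
qed

theorem theorem1:
  fixes \<alpha> :: real
  assumes "0 < \<alpha>" and "\<alpha> \<le> 1"
  shows "beta_star \<alpha> = \<alpha> / (1 + \<alpha>)"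
  unfolding beta_star_def
proof (rule cSup_eq_maximum)
  have "0 < \<alpha> / (1 + \<alpha>)" "\<alpha> / (1 + \<alpha>) \<le> 1" using assms by (auto simp: field_simps)
  then show "\<alpha> / (1 + \<alpha>) \<in> {\<beta>. 0 < \<beta> \<and> \<beta> \<le> 1 \<and>
      (\<forall>p. beurling_system p \<longrightarrow> prime_cond \<alpha> p \<longrightarrow> integer_cond \<beta> p)}"
    using prime_cond_imp_integer_cond[OF assms] by blast
next
  fix \<beta> assume "\<beta> \<in> {\<beta>. 0 < \<beta> \<and> \<beta> \<le> 1 \<and>
      (\<forall>p. beurling_system p \<longrightarrow> prime_cond \<alpha> p \<longrightarrow> integer_cond \<beta> p)}"
  then have "integer_cond \<beta> (lat_prime \<alpha>)"
    using beurling_lat_prime prime_cond_lat_prime[OF assms] by blast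
  then show "\<beta> \<le> \<alpha> / (1 + \<alpha>)"
    using not_integer_cond_lat_prime[OF assms] by (meson not_le)
qed

end
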